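(* Let $d \geq 1$ and $\alpha \geq 0$ be integers. There exist constants $c(d,\alpha)$ and $C(d,\alpha)$ depending only on $d$ and $\alpha$ such that the following holds for every $\delta$ larger than $c(d,\alpha)$. Let $f : \mathbb{R}^d \to \mathbb{R}$ be any function such that for all $x,y$ with $\|x\|_2 \leq R$ and $\|y\|_2 \leq R$, $|f(x)| \leq \eta$ and $|f(x) - f(y)| \leq \eta R^{-1} \|x-y\|_2$. Then there exists $g \in \mathcal{F}_2$ such that $\gamma_2(g) \leq \delta$ and $$\sup_{\|x\|_2 \leq R} |f(x) - g(x)| \leq C(d,\alpha)\, \eta \Big(\frac{\delta}{\eta}\Big)^{-1/(\alpha+(d-1)/2)} \log\Big(\frac{\delta}{\eta}\Big).$$
   Context: $R>0$ and $\eta>0$ are real numbers. $\mathbb{S}^d = \{u \in \mathbb{R}^{d+1} : \|u\|_2 = 1\}$, $\tau_d$ is the uniform probability measure on $\mathbb{S}^d$, and $(u)_+^\alpha = \max\{u,0\}^\alpha$ with the convention $0^0=0$ (so it equals $1_{u>0}$ for $\alpha=0$). $\mathcal{F}_2$ is the space of functions $f$ on the ball $\{x \in \mathbb{R}^d : \|x\|_2 \leq R\}$ that can be written, for all $x$ in the ball, as $$f(x) = \int_{\mathbb{S}^d} (w^\top x + b)_+^\alpha \; p(u)\, d\tau_d(u), \qquad u = (Rw, b) \in \mathbb{S}^d,\ w \in \mathbb{R}^d,\ b \in \mathbb{R},$$ with $p \in L_2(\tau_d)$; $\gamma_2(f)^2$ is the infimum of $\int_{\mathbb{S}^d} |p(u)|^2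 d\tau_d(u)$ over all such representations.
   Formalization: The condition "δ larger than c(d,α)" is read as δ/η > c(d,α), since for η > δ the logarithm is negative and the literal claim fails; for d = 1, α = 0, where the exponent −1/0 is undefined, the power is read as its limit 0, so the approximation is exact. *)

theory Defs
  imports "HOL-Probability.Probability"
begin

text \<open>
  The uniform probability measure on the unit sphere, obtained as the image of the uniform
  distribution on the unit ball under the radial projection \<open>sgn x = x /\<^sub>R norm x\<close>.
  The projection sends the null set \<open>{0}\<close> to \<open>0\<close>, off the sphere, so it is taken into the
  whole space first and its distribution is then restricted to the sphere.
\<close>

definition sphere_unif :: "'a::euclidean_space measure" where
  "sphere_unif = restrict_space (distr (uniform_measure lborel (cball 0 1)) borel sgn) (sphere 0 1)"

lemma space_sphere_unif: "space (sphere_unif :: 'a::euclidean_space measure) = sphere 0 1"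
  by (simp add: sphere_unif_def space_restrict_space)

lemma sets_sphere_unif:
  "sets (sphere_unif :: 'a::euclidean_space measure) = sets (restrict_space borel (sphere 0 1))"
  unfolding sphere_unif_def by (rule sets_restrict_space_cong) simp

lemma prob_space_sphere_unif: "prob_space (sphere_unif :: 'a::euclidean_space measure)"
proof -
  let ?B = "cball (0 :: 'a) 1" and ?S = "sphere (0 :: 'a) 1"
  let ?M = "uniform_measure lborel ?B"
  have pos: "emeasure lborel ?B \<noteq> 0" and fin: "emeasure lborel ?B \<noteq> \<infinity>"
    using content_cball_pos[of 1 "0 :: 'a"] emeasure_lborel_cball_finite[of "0 :: 'a" 1]
    by (auto simp: measure_def)
  interpret M: prob_space ?M
    using pos fin by (rule prob_space_uniform_measure)
  have meas: "sgn \<in> measurable ?M (borel :: 'a measure)"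
    by (simp add: sgn_div_norm[abs_def] cong: measurable_cong_sets)
  have "AE x in (lborel :: 'a measure). x \<noteq> 0"
    by (rule AE_lborel_singleton)
  then have "AE x in ?M. sgn x \<in> ?S"
    by (intro AE_uniform_measureI) (auto simp: norm_sgn)
  then have "emeasure ?M (sgn -` ?S \<inter> space ?M) = 1"
    using measurable_sets[OF meas, of ?S] by (intro M.emeasure_eq_1_AE) auto
  then have "emeasure (distr ?M borel sgn) ?S = 1"
    by (subst emeasure_distr[OF meas]) auto
  then show ?thesis
    unfolding sphere_unif_def
    by (intro prob_spaceI) (simp add: space_restrict_space emeasure_restrict_space)
qed

definition pos_power :: "nat \<Rightarrow> real \<Rightarrow> real" where
  "pos_power \<alpha> t = (if t > 0 then t ^ \<alpha> else 0)"

text \<open>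
  A point \<open>u = (R w, b)\<close> of the sphere in \<open>\<real>\<^sup>d \<times> \<real>\<close> has \<open>w = fst u /\<^sub>R R\<close> and
  \<open>b = snd u\<close>. The integrand below is always integrable, being the product of a bounded function
  and a square-integrable one on a probability space. Only the values of \<open>f\<close> on the ball of
  radius \<open>R\<close> matter here, and so in \<open>F2\<close> and \<open>gamma2\<close>.
\<close>

definition F2_repr ::
  "real \<Rightarrow> nat \<Rightarrow> (real ^ 'd \<Rightarrow> real) \<Rightarrow> ((real ^ 'd) \<times> real \<Rightarrow> real) \<Rightarrow> bool" where
  "F2_repr R \<alpha> f p \<longleftrightarrow>
     p \<in> borel_measurable sphere_unif \<and> integrable sphere_unif (\<lambda>u. (p u)\<^sup>2) \<and>
     (\<forall>x\<in>cball 0 R.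
        f x = (LINT u|sphere_unif. pos_power \<alpha> ((fst u /\<^sub>R R) \<bullet> x + snd u) * p u))"

definition F2 :: "real \<Rightarrow> nat \<Rightarrow> (real ^ 'd \<Rightarrow> real) set" where
  "F2 R \<alpha> = {f. \<exists>p. F2_repr R \<alpha> f p}"

definition gamma2 :: "real \<Rightarrow> nat \<Rightarrow> (real ^ 'd \<Rightarrow> real) \<Rightarrow> real" where
  "gamma2 R \<alpha> f = sqrt (INF p\<in>{p. F2_repr R \<alpha> f p}. LINT u|sphere_unif. (p u)\<^sup>2)"

text \<open>
  \<open>t\<close> to the power \<open>-1/s\<close> for \<open>t > 1\<close>. For \<open>s = 0\<close> the exponent is read as \<open>-\<infinity>\<close> and the value
  is the limit \<open>0\<close> as \<open>s\<close> tends to \<open>0\<close> from above, not what \<open>1 / 0 = 0\<close> would give.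
\<close>

definition inv_root_power :: "real \<Rightarrow> real \<Rightarrow> real" where
  "inv_root_power t s = (if s = 0 then 0 else t powr (- 1 / s))"

end

theory Submission imports Defs begin

text \<open>
  After rescaling \<open>R = \<eta> = 1\<close>, and \<open>f\<close> is extended to a bounded Lipschitz function supported in the
  ball of radius 2. For \<open>\<epsilon> > 0\<close> and \<open>N = d + \<alpha> + 1\<close> take the density
  \<open>p(w, b) = c Re (i\<^sup>\<alpha>\<^sup>+\<^sup>1 \<integral> f(y) (\<epsilon> \<bar>w\<bar> + i (w \<bullet> y + b))\<^sup>-\<^sup>N dy)\<close>.
  All integrands on the sphere are homogeneous, so that integrals over the sphere may be computed on the
  shell \<open>1 \<le> \<bar>w\<bar> < 2\<close>. Integrating out \<open>b\<close> (a Beta integral) and then \<open>w\<close> (polar coordinates) shows that the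
  function represented by \<open>p\<close> is the convolution of \<open>f\<close> with the Poisson kernel, the Fourier transform of
  \<open>exp (- \<epsilon> \<bar>\<xi>\<bar>)\<close>. This kernel is a mixture of Gaussians, hence the error is of order \<open>\<epsilon> ln (1 / \<epsilon>)\<close>.
  The same two steps, with Plancherel's theorem in \<open>b\<close>, bound the square of the norm of \<open>p\<close> by the integral of
  \<open>\<bar>\<xi>\<bar>\<^sup>d\<^sup>+\<^sup>2\<^sup>\<alpha>\<^sup>+\<^sup>1 exp (- 2 \<epsilon> \<bar>\<xi>\<bar>)\<close> against the squared Fourier transform of \<open>f\<close>, which is
  \<open>O(\<epsilon>\<^sup>-\<^sup>2\<^sup>s)\<close> for \<open>s = \<alpha> + (d - 1) / 2\<close> because \<open>f\<close> is Lipschitz. It remains to choose \<open>\<epsilon>\<close> proportional to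
  \<open>\<delta>\<^sup>-\<^sup>1\<^sup>/\<^sup>s\<close>; if \<open>s = 0\<close>, the representation is exact with the derivative of \<open>f\<close> as its density.
\<close>

subsection \<open>Fourier and Beta integrals\<close>

text \<open>The exponent \<open>N\<close> is forced by homogeneity: the activation has degree
  \<alpha> and the density degree \<open>- N\<close>, so their product has degree
  \<open>- (d + 1)\<close>, which cancels the weight that central projection from the shell to the
  sphere brings in. The pole is displaced by \<epsilon> times the norm of \<open>w\<close>, not by
  \<epsilon> alone: this keeps the density homogeneous and becomes the damping
  \<open>exp (- \<epsilon> * norm \<xi>)\<close> at the frequency \<open>\<xi> = r w\<close>. The
  phase \<open>\<i> ^ Suc \<alpha>\<close> cancels the one that the Beta integral produces. The
  logarithm enters because the Poisson kernel decays like \<open>norm z\<close> to the power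
  \<open>- (d + 1)\<close>, so its first moment diverges logarithmically. In the norm estimate the
  degree of the weight exceeds \<open>2 s\<close> by two; these two powers are paid for by the
  square-integrable gradient of a compactly supported Lipschitz function. For \<open>s = 0\<close>
  the norm of the density stays bounded as \<epsilon> tends to 0, but the smoothing error at a fixed
  \<epsilon> need not vanish while the required bound is 0; hence the separate exact
  representation.\<close>

lemma integral_FTC_Ici:
  fixes F f :: "real \<Rightarrow> 'a::euclidean_space"
  assumes der: "\<And>x. 0 \<le> x \<Longrightarrow> (F has_vector_derivative f x) (at x)"
    and cont: "continuous_on {0..} f"
    and int: "integrable lborel (\<lambda>x. indicator {0..} x *\<^sub>R f x)"
    and lim: "(F \<longlongrightarrow> L) at_top"
  shows "(\<integral>x. indicator {0..} x *\<^sub>R f x \<partial>lborel) = L - F 0"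
proof (rule tendsto_unique[OF trivial_limit_at_top_linorder])
  show "((\<lambda>y. \<integral>x. indicator {..y} x *\<^sub>R (indicator {0..} x *\<^sub>R f x) \<partial>lborel) \<longlongrightarrow> (\<integral>x. indicator {0..} x *\<^sub>R f x \<partial>lborel)) at_top"
    by (rule tendsto_integral_at_top[OF _ int]) simp
  have "eventually (\<lambda>y. F y - F 0 = (\<integral>x. indicator {..y} x *\<^sub>R (indicator {0..} x *\<^sub>R f x) \<partial>lborel)) at_top"
    using eventually_ge_at_top[of 0]
  proof eventually_elim
    case (elim y)
    have "(\<integral>x. indicator {0..y} x *\<^sub>R f x \<partial>lborel) = F y - F 0"
      using elim by (intro integral_FTC_Icc)
        (auto intro!: has_vector_derivative_at_within der continuous_on_subset[OF cont])
    also have "(\<integral>x. indicator {0..y} x *\<^sub>R f x \<partial>lborel) = (\<integral>x. indicator {..y} x *\<^sub>R (indicator {0..} x *\<^sub>R f x) \<partial>lborel)"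
      by (intro Bochner_Integration.integral_cong) (auto split: split_indicator)
    finally show ?case by simp
  qed
  then show "((\<lambda>y. \<integral>x. indicator {..y} x *\<^sub>R (indicator {0..} x *\<^sub>R f x) \<partial>lborel) \<longlongrightarrow> L - F 0) at_top"
    by (rule tendsto_cong[THEN iffD1]) (intro tendsto_intros lim)
qed

text \<open>The Gamma integral at \<open>c = 1\<close>, transported by the dilation from
  \<open>x\<close> to \<open>c * x\<close>.\<close>

lemma integrable_power_exp:
  fixes c :: real assumes "c > 0"
  shows "integrable lborel (\<lambda>x. indicator {0..} x * (x ^ k * exp (- (c * x))))"
proof -
  have "integrable lborel (\<lambda>x::real. indicator {0..} x * (x ^ k * exp (- x)))"
  proof (rule integrableI_nonneg)
    have "(\<integral>\<^sup>+ x. ennreal (indicator {0..} x * (x ^ k * exp (- x))) \<partial>lborel)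
      = (\<integral>\<^sup>+ x. ennreal (x ^ k * exp (- x)) * indicator {0..} x \<partial>lborel)"
      by (intro nn_integral_cong) (auto split: split_indicator)
    then show "(\<integral>\<^sup>+ x. ennreal (indicator {0..} x * (x ^ k * exp (- x))) \<partial>lborel) < \<infinity>"
      using nn_intergal_power_times_exp_Ici[of k] by simp
  qed (auto split: split_indicator)
  then have "integrable lborel (\<lambda>x::real. indicator {0..} (0 + c * x) * ((0 + c * x) ^ k * exp (- (0 + c * x))))"
    by (rule lborel_integrable_real_affine) (use assms in auto)
  then have "integrable lborel (\<lambda>x::real. (1 / c ^ k) * (indicator {0..} (0 + c * x) * ((0 + c * x) ^ k * exp (- (0 + c * x)))))"
    by (rule integrable_mult_right)
  also have "(\<lambda>x::real. (1 / c ^ k) * (indicator {0..} (0 + c * x) * ((0 + c * x) ^ k * exp (- (0 + c * x)))))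
    = (\<lambda>x. indicator {0..} x * (x ^ k * exp (- (c * x))))"
    using assms by (auto simp: fun_eq_iff power_mult_distrib zero_le_mult_iff split: split_indicator)
  finally show ?thesis .
qed

lemma tendsto_power_exp_at_top:
  fixes c :: real assumes "c > 0"
  shows "((\<lambda>x. x ^ k * exp (- (c * x))) \<longlongrightarrow> 0) at_top"
proof -
  have "((\<lambda>x. (c * x) ^ k / exp (c * x)) \<longlongrightarrow> 0) at_top"
    by (rule filterlim_compose[OF tendsto_power_div_exp_0])
       (rule filterlim_tendsto_pos_mult_at_top[OF tendsto_const assms filterlim_ident])
  then have "((\<lambda>x. (1 / c ^ k) * ((c * x) ^ k / exp (c * x))) \<longlongrightarrow> (1 / c ^ k) * 0) at_top"
    by (intro tendsto_intros)
  then show ?thesis using assms by (simp add: power_mult_distrib exp_minus field_simps)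
qed

lemma integrable_power_exp_complex:
  fixes z :: complex assumes "Re z > 0"
  shows "integrable lborel (\<lambda>r. indicator {0..} r *\<^sub>R (of_real r ^ k * exp (- (of_real r * z))))"
  by (rule Bochner_Integration.integrable_bound[OF integrable_power_exp[OF assms, of k]])
     (auto simp: norm_mult norm_power mult.commute split: split_indicator)

lemma has_vector_derivative_power_exp:
  "((\<lambda>r. of_real r ^ k * exp (- (of_real r * z))) has_vector_derivative
      (of_nat k * of_real r ^ (k - 1) - of_real r ^ k * z) * exp (- (of_real r * z))) (at r)" for z :: complex
proof (rule has_vector_derivative_real_field)
  show "((\<lambda>u. u ^ k * exp (- (u * z))) has_field_derivative
    (of_nat k * of_real r ^ (k - 1) - of_real r ^ k * z) * exp (- (of_real r * z))) (at (of_real r))"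
    by (auto intro!: derivative_eq_intros simp: algebra_simps)
qed

text \<open>The Laplace transform of a monomial at a complex argument, by induction from the
  vanishing integral of the derivative of \<open>r ^ Suc k * exp (- r z)\<close>. It is used in both
  directions: to open an inverse power into an oscillating integral in
  \<open>ridge_transform_eq_ft\<close>, and to produce one in
  \<open>shell_average_power\<close>.\<close>

lemma integral_power_exp_complex:
  fixes z :: complex assumes z: "Re z > 0"
  shows "(\<integral>r. indicator {0..} r *\<^sub>R (of_real r ^ k * exp (- (of_real r * z))) \<partial>lborel) = fact k / z ^ Suc k"
proof (induction k)
  have lim: "((\<lambda>r. of_real r ^ k * exp (- (of_real r * z))) \<longlongrightarrow> 0) at_top" for k
  proof (rule tendsto_norm_zero_cancel)
    show "((\<lambda>r. norm (of_real r ^ k * exp (- (of_real r * z)))) \<longlongrightarrow> 0) at_top"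
      using tendsto_rabs[OF tendsto_power_exp_at_top[OF z, of k]]
      by (simp add: norm_mult norm_power abs_mult power_abs mult.commute)
  qed
  have z0: "z \<noteq> 0" using z by auto
  {
    case 0
    have "(\<integral>r. indicator {0..} r *\<^sub>R (of_real r ^ 0 * exp (- (of_real r * z))) \<partial>lborel)
      = 0 - (- 1 / z) * (of_real 0 ^ 0 * exp (- (of_real 0 * z)))"
    proof (rule integral_FTC_Ici[OF _ _ integrable_power_exp_complex[OF z]])
      show "((\<lambda>r. (- 1 / z) * (of_real r ^ 0 * exp (- (of_real r * z)))) has_vector_derivative
        (of_real x ^ 0 * exp (- (of_real x * z)))) (at x)" for x
        using has_vector_derivative_mult_right[OF has_vector_derivative_power_exp[of 0 z x], of "- 1 / z"] z0
        by simp
      show "((\<lambda>r. - 1 / z * (of_real r ^ 0 * exp (- (of_real r * z)))) \<longlongrightarrow> 0) at_top"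
        by (rule tendsto_mult_right_zero[OF lim])
    qed (auto intro!: continuous_intros)
    then show ?case by simp
  next
    case (Suc k)
    let ?f = "\<lambda>k r. indicator {0..} r *\<^sub>R (of_real r ^ k * exp (- (of_real r * z)))"
    have int: "integrable lborel (?f k)" for k by (rule integrable_power_exp_complex[OF z])
    have eq: "(\<lambda>r. indicator {0..} r *\<^sub>R ((of_nat (Suc k) * of_real r ^ (Suc k - 1) - of_real r ^ Suc k * z) * exp (- (of_real r * z))))
      = (\<lambda>r. of_nat (Suc k) * ?f k r - z * ?f (Suc k) r)"
      by (auto simp: fun_eq_iff algebra_simps split: split_indicator)
    have "(\<integral>r. indicator {0..} r *\<^sub>R ((of_nat (Suc k) * of_real r ^ (Suc k - 1) - of_real r ^ Suc k * z) * exp (- (of_real r * z))) \<partial>lborel)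
       = 0 - of_real 0 ^ Suc k * exp (- (of_real 0 * z))"
    proof (rule integral_FTC_Ici[OF has_vector_derivative_power_exp])
      show "integrable lborel (\<lambda>r. indicator {0..} r *\<^sub>R ((of_nat (Suc k) * of_real r ^ (Suc k - 1) - of_real r ^ Suc k * z) * exp (- (of_real r * z))))"
        unfolding eq by (intro Bochner_Integration.integrable_diff integrable_mult_right int)
    qed (auto intro!: continuous_intros lim simp del: of_nat_Suc power_Suc)
    then have "of_nat (Suc k) * integral\<^sup>L lborel (?f k) - z * integral\<^sup>L lborel (?f (Suc k)) = 0"
      unfolding eq Bochner_Integration.integral_diff[OF integrable_mult_right[OF int] integrable_mult_right[OF int]]
        integral_mult_right_zero by simp
    then have "z * integral\<^sup>L lborel (?f (Suc k)) = of_nat (Suc k) * (fact k / z ^ Suc k)"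
      unfolding Suc by simp
    then have "integral\<^sup>L lborel (?f (Suc k)) = of_nat (Suc k) * (fact k / z ^ Suc k) / z"
      using z0 by (metis nonzero_mult_div_cancel_left)
    then show ?case by (simp add: field_simps)
  }
qed

lemma integrable_inverse_square_Ici:
  "integrable lborel (\<lambda>t::real. indicator {0..} t * (1 / (1 + t)\<^sup>2))"
proof (rule integrableI_nonneg)
  have "(\<integral>\<^sup>+ t. ennreal (1 / (1 + t)\<^sup>2) * indicator {0..} t \<partial>lborel) = ennreal (0 - (- (1 / (1 + 0))))"
  proof (rule nn_integral_FTC_atLeast)
    show "((\<lambda>t::real. - (1 / (1 + t))) \<longlongrightarrow> 0) at_top"
      by real_asymp
  qed (auto intro!: derivative_eq_intros simp: power2_eq_square)
  moreover have "(\<integral>\<^sup>+ t. ennreal (indicator {0..} t * (1 / (1 + t)\<^sup>2)) \<partial>lborel)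
      = (\<integral>\<^sup>+ t. ennreal (1 / (1 + t)\<^sup>2) * indicator {0..} t \<partial>lborel)"
    by (intro nn_integral_cong) (auto split: split_indicator)
  ultimately show "(\<integral>\<^sup>+ t. ennreal (indicator {0..} t * (1 / (1 + t)\<^sup>2)) \<partial>lborel) < \<infinity>"
    by simp
qed auto

text \<open>The modulus is at least \<open>Re A\<close>, which is good for small \<open>t\<close>,
  and at least \<open>t - cmod A\<close>, which is good for large \<open>t\<close>. A weighted sum
  of the two gives one linear minorant for all \<open>t\<close>.\<close>

lemma cmod_add_imaginary_ge:
  fixes A :: complex assumes A: "Re A > 0" and t: "t \<ge> 0"
  shows "cmod (A + \<i> * of_real t) \<ge> Re A / (1 + cmod A + Re A) * (1 + t)"
proof -
  define \<rho> where "\<rho> = cmod (A + \<i> * of_real t)"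
  have 1: "\<rho> \<ge> Re A" unfolding \<rho>_def using complex_Re_le_cmod[of "A + \<i> * of_real t"] by simp
  have "t = cmod (\<i> * of_real t)" using t by (simp add: norm_mult)
  also have "\<dots> \<le> \<rho> + cmod A" unfolding \<rho>_def
    using norm_triangle_ineq4[of "A + \<i> * of_real t" A] by simp
  finally have 2: "t \<le> \<rho> + cmod A" .
  have "Re A * (1 + t) \<le> Re A * (1 + cmod A) + Re A * \<rho>"
    using mult_left_mono[OF 2, of "Re A"] A by (simp add: algebra_simps)
  also have "\<dots> \<le> \<rho> * (1 + cmod A) + Re A * \<rho>"
    using 1 A by (intro add_mono mult_right_mono) auto
  also have "\<dots> = \<rho> * (1 + cmod A + Re A)" by (simp add: algebra_simps)
  finally show ?thesis unfolding \<rho>_def[symmetric]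
    using A by (subst times_divide_eq_left, subst pos_divide_le_eq) (auto intro: add_pos_nonneg add_nonneg_pos)
qed

lemma add_imaginary_nonzero: "Re A > 0 \<Longrightarrow> A + \<i> * of_real t \<noteq> 0"
  by (metis Re_i_times Im_complex_of_real add.right_neutral less_irrefl minus_zero plus_complex.sel(1) zero_complex.sel(1))

text \<open>The numerator uses up \<open>a\<close> of the \<open>a + m\<close> powers, so decay of
  order \<open>m\<close> remains. The explicit dependence on \<open>A\<close> later makes the bound
  uniform when \<open>A\<close> varies over the support of a function.\<close>

lemma cmod_beta_le:
  fixes A :: complex assumes A: "Re A > 0" and t: "t \<ge> 0"
  shows "cmod (of_real t ^ a / (A + \<i> * of_real t) ^ (a + m)) \<le> ((1 + cmod A + Re A) / Re A) ^ (a + m) / (1 + t) ^ m"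
proof -
  let ?c = "Re A / (1 + cmod A + Re A)"
  have c: "?c > 0" using A by (auto intro!: divide_pos_pos add_pos_nonneg add_nonneg_pos)
  have "cmod (of_real t ^ a / (A + \<i> * of_real t) ^ (a + m)) = t ^ a / cmod (A + \<i> * of_real t) ^ (a + m)"
    using t by (simp add: norm_divide norm_power)
  also have "\<dots> \<le> (1 + t) ^ a / (?c * (1 + t)) ^ (a + m)"
    by (rule frac_le) (use t c in \<open>auto intro!: power_mono cmod_add_imaginary_ge A simp del: times_divide_eq_left\<close>)
  also have "\<dots> = (1 / ?c) ^ (a + m) / (1 + t) ^ m"
    using t c by (simp only: power_mult_distrib power_add power_one_over) (simp add: field_simps)
  also have "1 / ?c = (1 + cmod A + Re A) / Re A" by simp
  finally show ?thesis .
qed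

lemma integrable_beta_complex:
  fixes A :: complex assumes A: "Re A > 0" and m: "m \<ge> 2"
  shows "integrable lborel (\<lambda>t. indicator {0..} t *\<^sub>R (of_real t ^ a / (A + \<i> * of_real t) ^ (a + m)))"
proof (rule Bochner_Integration.integrable_bound[OF integrable_mult_right[OF integrable_inverse_square_Ici, of "((1 + cmod A + Re A) / Re A) ^ (a + m)"]])
  show "AE t in lborel. norm (indicator {0..} t *\<^sub>R (of_real t ^ a / (A + \<i> * of_real t) ^ (a + m)))
     \<le> norm (((1 + cmod A + Re A) / Re A) ^ (a + m) * (indicator {0..} t * (1 / (1 + t)\<^sup>2)))"
  proof (rule AE_I2)
    fix t :: real
    have "((1 + cmod A + Re A) / Re A) ^ (a + m) / (1 + t) ^ m \<le> ((1 + cmod A + Re A) / Re A) ^ (a + m) / (1 + t) ^ 2" if "t \<ge> 0"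
      using A m that by (intro divide_left_mono power_increasing) auto
    with cmod_beta_le[OF A, of t a m] A show "norm (indicator {0..} t *\<^sub>R (of_real t ^ a / (A + \<i> * of_real t) ^ (a + m)))
     \<le> norm (((1 + cmod A + Re A) / Re A) ^ (a + m) * (indicator {0..} t * (1 / (1 + t)\<^sup>2)))"
      by (auto split: split_indicator)
  qed
qed measurable

text \<open>Formally the substitution \<open>t = - \<i> A s\<close> turns this into Euler's Beta
  integral with parameters \<open>a + 1\<close> and \<open>m\<close>. To avoid rotating the contour,
  the induction on \<open>a\<close> integrates the derivative of
  \<open>t ^ Suc a / (A + \<i> t) ^ (Suc a + m)\<close>, which vanishes at both ends. The power of
  \<open>\<i>\<close> in the result is the phase that the density has to compensate.\<close>

lemma integral_beta_complex:
  fixes A :: complex assumes A: "Re A > 0" and m: "m \<ge> 1"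
  shows "(\<integral>t. indicator {0..} t *\<^sub>R (of_real t ^ a / (A + \<i> * of_real t) ^ (a + Suc m)) \<partial>lborel)
     = fact a * fact (m - 1) / fact (a + m) / (\<i> ^ Suc a * A ^ m)"
  using m
proof (induction a)
  have nz: "A + \<i> * of_real t \<noteq> 0" for t by (rule add_imaginary_nonzero[OF A])
  have A0: "A \<noteq> 0" using A by auto
  have lim: "((\<lambda>t. of_real t ^ a / (A + \<i> * of_real t) ^ (a + m)) \<longlongrightarrow> 0) at_top" if "m \<ge> 1" for a m
  proof (rule Lim_null_comparison)
    show "eventually (\<lambda>t. cmod (of_real t ^ a / (A + \<i> * of_real t) ^ (a + m)) \<le> ((1 + cmod A + Re A) / Re A) ^ (a + m) / (1 + t) ^ m) at_top"
      using eventually_ge_at_top[of 0] by eventually_elim (rule cmod_beta_le[OF A])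
    show "((\<lambda>t::real. ((1 + cmod A + Re A) / Re A) ^ (a + m) / (1 + t) ^ m) \<longlongrightarrow> 0) at_top"
      using that by (intro tendsto_divide_0[OF tendsto_const] filterlim_at_top_imp_at_infinity filterlim_pow_at_top
        filterlim_tendsto_add_at_top[OF tendsto_const filterlim_ident]) auto
  qed
  have der: "((\<lambda>t. of_real t ^ a / (A + \<i> * of_real t) ^ k) has_vector_derivative
     (of_nat a * of_real t ^ (a - 1) / (A + \<i> * of_real t) ^ k - of_nat k * \<i> * of_real t ^ a / (A + \<i> * of_real t) ^ Suc k)) (at t)"
    if "k \<ge> 1" for a k t
  proof (rule has_vector_derivative_real_field)
    have p: "(A + \<i> * of_real t) ^ k = (A + \<i> * of_real t) * (A + \<i> * of_real t) ^ (k - 1)"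
      using that by (cases k) auto
    have "((\<lambda>u. u ^ a / (A + \<i> * u) ^ k) has_field_derivative
       ((of_nat a * of_real t ^ (a - 1)) * (A + \<i> * of_real t) ^ k - of_real t ^ a * (of_nat k * (A + \<i> * of_real t) ^ (k - 1) * \<i>))
         / ((A + \<i> * of_real t) ^ k * (A + \<i> * of_real t) ^ k)) (at (of_real t))"
      by (rule DERIV_divide) (use nz[of t] in \<open>auto intro!: derivative_eq_intros\<close>)
    also have "((of_nat a * of_real t ^ (a - 1)) * (A + \<i> * of_real t) ^ k - of_real t ^ a * (of_nat k * (A + \<i> * of_real t) ^ (k - 1) * \<i>))
         / ((A + \<i> * of_real t) ^ k * (A + \<i> * of_real t) ^ k) =
        (of_nat a * of_real t ^ (a - 1) / (A + \<i> * of_real t) ^ k - of_nat k * \<i> * of_real t ^ a / (A + \<i> * of_real t) ^ Suc k)"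
      using nz[of t] by (simp add: p divide_simps) (simp add: algebra_simps)
    finally show "((\<lambda>u. u ^ a / (A + \<i> * u) ^ k) has_field_derivative
     (of_nat a * of_real t ^ (a - 1) / (A + \<i> * of_real t) ^ k - of_nat k * \<i> * of_real t ^ a / (A + \<i> * of_real t) ^ Suc k)) (at (of_real t))" .
  qed
  have int: "integrable lborel (\<lambda>t. indicator {0..} t *\<^sub>R (of_real t ^ a / (A + \<i> * of_real t) ^ (a + Suc m)))" for a
    using integrable_beta_complex[OF A, of "Suc m" a] m by simp
  {
    case 0
    have "(\<integral>t. indicator {0..} t *\<^sub>R (of_real t ^ 0 / (A + \<i> * of_real t) ^ (0 + Suc m)) \<partial>lborel)
      = 0 - (\<i> / of_nat m) * (of_real 0 ^ 0 / (A + \<i> * of_real 0) ^ (0 + m))"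
    proof (rule integral_FTC_Ici[OF _ _ int])
      show "((\<lambda>t. (\<i> / of_nat m) * (of_real t ^ 0 / (A + \<i> * of_real t) ^ (0 + m))) has_vector_derivative
        (of_real t ^ 0 / (A + \<i> * of_real t) ^ (0 + Suc m))) (at t)" for t
        using has_vector_derivative_mult_right[OF der[of m 0 t], of "\<i> / of_nat m"] 0 by simp
      show "((\<lambda>t. (\<i> / of_nat m) * (of_real t ^ 0 / (A + \<i> * of_real t) ^ (0 + m))) \<longlongrightarrow> 0) at_top"
        by (rule tendsto_mult_right_zero[OF lim[OF 0]])
    qed (use nz in \<open>auto intro!: continuous_intros\<close>)
    moreover have "(fact m :: complex) = of_nat m * fact (m - 1)" using 0 by (simp add: fact_reduce)
    ultimately show ?case using 0 A0 by (simp add: field_simps)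
  next
    case (Suc a)
    let ?f = "\<lambda>a t. indicator {0..} t *\<^sub>R (of_real t ^ a / (A + \<i> * of_real t) ^ (a + Suc m))"
    let ?k = "Suc a + m"
    have eq: "(\<lambda>t. indicator {0..} t *\<^sub>R (of_nat (Suc a) * of_real t ^ (Suc a - 1) / (A + \<i> * of_real t) ^ ?k
         - of_nat ?k * \<i> * of_real t ^ Suc a / (A + \<i> * of_real t) ^ Suc ?k))
       = (\<lambda>t. of_nat (Suc a) * ?f a t - (of_nat ?k * \<i>) * ?f (Suc a) t)"
      by (auto simp: fun_eq_iff split: split_indicator)
    have "(\<integral>t. indicator {0..} t *\<^sub>R (of_nat (Suc a) * of_real t ^ (Suc a - 1) / (A + \<i> * of_real t) ^ ?k
         - of_nat ?k * \<i> * of_real t ^ Suc a / (A + \<i> * of_real t) ^ Suc ?k) \<partial>lborel)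
       = 0 - of_real 0 ^ Suc a / (A + \<i> * of_real 0) ^ ?k"
    proof (rule integral_FTC_Ici[OF der])
      show "integrable lborel (\<lambda>t. indicator {0..} t *\<^sub>R (of_nat (Suc a) * of_real t ^ (Suc a - 1) / (A + \<i> * of_real t) ^ ?k
         - of_nat ?k * \<i> * of_real t ^ Suc a / (A + \<i> * of_real t) ^ Suc ?k))"
        unfolding eq by (intro Bochner_Integration.integrable_diff integrable_mult_right int)
      show "((\<lambda>t. of_real t ^ Suc a / (A + \<i> * of_real t) ^ ?k) \<longlongrightarrow> 0) at_top"
        by (rule lim[OF Suc.prems])
    qed (use nz in \<open>auto intro!: continuous_intros simp del: of_nat_Suc\<close>)
    then have "of_nat (Suc a) * integral\<^sup>L lborel (?f a) - (of_nat ?k * \<i>) * integral\<^sup>L lborel (?f (Suc a)) = 0"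
      unfolding eq Bochner_Integration.integral_diff[OF integrable_mult_right[OF int] integrable_mult_right[OF int]]
        integral_mult_right_zero by simp
    then have k1: "(of_nat ?k * \<i>) * integral\<^sup>L lborel (?f (Suc a)) = of_nat (Suc a) * (fact a * fact (m - 1) / fact (a + m) / (\<i> ^ Suc a * A ^ m))"
      using Suc.IH[OF Suc.prems] by simp
    have k0: "(of_nat ?k :: complex) * \<i> \<noteq> 0"
      by (simp del: of_nat_Suc of_nat_add)
    have "integral\<^sup>L lborel (?f (Suc a)) = of_nat (Suc a) * (fact a * fact (m - 1) / fact (a + m) / (\<i> ^ Suc a * A ^ m)) / (of_nat ?k * \<i>)"
      by (subst nonzero_eq_divide_eq[OF k0], subst mult.commute) (rule k1)
    also have "\<dots> = (of_nat (Suc a) * fact a) * fact (m - 1) / (of_nat ?k * fact (a + m)) / (\<i> ^ Suc (Suc a) * A ^ m)"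
      by (simp only: power_Suc times_divide_eq_left times_divide_eq_right divide_divide_eq_left mult_ac)
    also have "of_nat ?k * fact (a + m) = (fact (Suc a + m) :: complex)" by simp
    also have "of_nat (Suc a) * fact a = (fact (Suc a) :: complex)" by simp
    finally show ?case .
  }
qed

section \<open>Fourier transforms of Gaussians\<close>

lemma borel_measurable_cis [measurable (raw)]:
  "f \<in> borel_measurable M \<Longrightarrow> (\<lambda>x. cis (f x)) \<in> borel_measurable M"
  by (rule measurable_compose[OF _ borel_measurable_continuous_onI]) (auto intro: continuous_intros)

lemma
  fixes f :: "'a::euclidean_space \<Rightarrow> real \<Rightarrow> 'b::{real_normed_field,banach,second_countable_topology}"
  assumes int: "\<And>b. b \<in> Basis \<Longrightarrow> integrable lborel (f b)"
  shows integrable_lborel_prod: "integrable lborel (\<lambda>x::'a. \<Prod>b\<in>Basis. f b (x \<bullet> b))"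
    and integral_lborel_prod: "(\<integral>x. (\<Prod>b\<in>Basis. f b (x \<bullet> b)) \<partial>(lborel :: 'a measure)) = (\<Prod>b\<in>Basis. \<integral>x. f b x \<partial>lborel)"
proof -
  interpret product_sigma_finite "\<lambda>_::'a. lborel :: real measure"
    by standard
  have [measurable]: "b \<in> Basis \<Longrightarrow> f b \<in> borel_measurable borel" for b
    using int[of b] by (auto dest: borel_measurable_integrable)
  have 1: "(\<Prod>b\<in>Basis. f b ((\<Sum>c\<in>Basis. g c *\<^sub>R c) \<bullet> b)) = (\<Prod>b\<in>Basis. f b (g b))" for g :: "'a \<Rightarrow> real"
    by (intro prod.cong) auto
  have 2: "(\<lambda>x::'a. \<Prod>b\<in>Basis. f b (x \<bullet> b)) \<in> borel_measurable borel"
    by measurable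
  show "integrable lborel (\<lambda>x::'a. \<Prod>b\<in>Basis. f b (x \<bullet> b))"
    unfolding lborel_eq[where 'a='a]
    by (subst integrable_distr_eq) (auto intro!: product_integrable_prod int simp: 1 2)
  show "(\<integral>x. (\<Prod>b\<in>Basis. f b (x \<bullet> b)) \<partial>(lborel :: 'a measure)) = (\<Prod>b\<in>Basis. \<integral>x. f b x \<partial>lborel)"
    unfolding lborel_eq[where 'a='a]
    by (subst integral_distr) (auto intro!: product_integral_prod int simp: 1 2)
qed

text \<open>The characteristic function of the standard normal distribution, at the argument
  \<open>t / s\<close> after the dilation by \<open>s\<close>.\<close>

lemma
  fixes s t :: real assumes s: "s > 0"
  shows integrable_gaussian_cis_real: "integrable lborel (\<lambda>x. of_real (exp (- (s\<^sup>2 * x\<^sup>2 / 2))) * cis (x * t))"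
    and integral_gaussian_cis_real: "(\<integral>x. of_real (exp (- (s\<^sup>2 * x\<^sup>2 / 2))) * cis (x * t) \<partial>lborel) = of_real (sqrt (2 * pi) / s * exp (- (t\<^sup>2 / (2 * s\<^sup>2))))"
proof -
  let ?g = "\<lambda>x. of_real (std_normal_density x) * cis (x * (t / s))"
  have int: "integrable lborel ?g"
    by (rule Bochner_Integration.integrable_bound[OF integrable_std_normal_moment[of 0]])
       (auto simp: norm_mult)
  have "integral\<^sup>L lborel ?g = char std_normal_distribution (t / s)"
    unfolding char_def by (subst integral_density) (auto simp: cis_conv_exp scaleR_conv_of_real mult.commute)
  also have "\<dots> = of_real (exp (- (t / s)\<^sup>2 / 2))"
    by (simp add: char_std_normal_distribution)
  finally have I: "integral\<^sup>L lborel ?g = of_real (exp (- (t / s)\<^sup>2 / 2))" .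
  have eq: "of_real (exp (- (s\<^sup>2 * x\<^sup>2 / 2))) * cis (x * t) = of_real (sqrt (2 * pi)) * ?g (0 + s * x)" for x
    using s by (simp add: std_normal_density_def power_mult_distrib)
  show "integrable lborel (\<lambda>x. of_real (exp (- (s\<^sup>2 * x\<^sup>2 / 2))) * cis (x * t))"
    unfolding eq using s by (intro integrable_mult_right lborel_integrable_real_affine int) auto
  have "integral\<^sup>L lborel ?g = \<bar>s\<bar> *\<^sub>R (\<integral>x. ?g (0 + s * x) \<partial>lborel)"
    by (rule lborel_integral_real_affine) (use s in auto)
  then have "(\<integral>x. ?g (0 + s * x) \<partial>lborel) = of_real (exp (- (t / s)\<^sup>2 / 2) / s)"
    unfolding I using s by (simp add: scaleR_conv_of_real field_simps)
  then show "(\<integral>x. of_real (exp (- (s\<^sup>2 * x\<^sup>2 / 2))) * cis (x * t) \<partial>lborel) = of_real (sqrt (2 * pi) / s * exp (- (t\<^sup>2 / (2 * s\<^sup>2))))"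
    unfolding eq integral_mult_right_zero by (simp add: power_divide mult.commute)
qed

text \<open>The Fourier transform of the Gaussian
  \<open>exp (- s\<^sup>2 * (norm \<xi>)\<^sup>2 / 2)\<close>, without normalisation: as a function
  of \<open>z\<close> it is a Gaussian of width \<open>s\<close> whose total integral does not
  depend on \<open>s\<close>.\<close>

definition gauss_ft :: "real \<Rightarrow> 'a::euclidean_space \<Rightarrow> real" where
  "gauss_ft s z = (sqrt (2 * pi) / s) ^ DIM('a) * exp (- ((norm z)\<^sup>2 / (2 * s\<^sup>2)))"

lemma
  fixes z :: "'a::euclidean_space" assumes s: "s > 0"
  shows integrable_gaussian_cis: "integrable lborel (\<lambda>\<xi>::'a. of_real (exp (- (s\<^sup>2 * (norm \<xi>)\<^sup>2 / 2))) * cis (\<xi> \<bullet> z))"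
    and integral_gaussian_cis: "(\<integral>\<xi>. of_real (exp (- (s\<^sup>2 * (norm \<xi>)\<^sup>2 / 2))) * cis (\<xi> \<bullet> z) \<partial>lborel) = of_real (gauss_ft s z)"
proof -
  have eq: "of_real (exp (- (s\<^sup>2 * (norm \<xi>)\<^sup>2 / 2))) * cis (\<xi> \<bullet> z)
     = (\<Prod>b\<in>Basis. of_real (exp (- (s\<^sup>2 * (\<xi> \<bullet> b)\<^sup>2 / 2))) * cis ((\<xi> \<bullet> b) * (z \<bullet> b)))" for \<xi> :: 'a
  proof -
    have "(norm \<xi>)\<^sup>2 = (\<Sum>b\<in>Basis. (\<xi> \<bullet> b)\<^sup>2)"
      by (subst euclidean_inner[of \<xi> \<xi>, unfolded power2_norm_eq_inner[symmetric]]) (simp add: power2_eq_square)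
    then have 1: "exp (- (s\<^sup>2 * (norm \<xi>)\<^sup>2 / 2)) = (\<Prod>b\<in>Basis. exp (- (s\<^sup>2 * (\<xi> \<bullet> b)\<^sup>2 / 2)))"
      by (simp add: exp_sum[symmetric] sum_negf sum_distrib_left sum_divide_distrib)
    have 2: "cis (\<xi> \<bullet> z) = (\<Prod>b\<in>Basis. cis ((\<xi> \<bullet> b) * (z \<bullet> b)))"
      by (subst euclidean_inner) (simp add: cis_conv_exp exp_sum[symmetric] sum_distrib_left)
    show ?thesis unfolding 1 2 by (simp add: prod.distrib)
  qed
  show "integrable lborel (\<lambda>\<xi>::'a. of_real (exp (- (s\<^sup>2 * (norm \<xi>)\<^sup>2 / 2))) * cis (\<xi> \<bullet> z))"
    unfolding eq by (intro integrable_lborel_prod integrable_gaussian_cis_real s)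
  have "(\<integral>\<xi>. of_real (exp (- (s\<^sup>2 * (norm \<xi>)\<^sup>2 / 2))) * cis (\<xi> \<bullet> z) \<partial>lborel)
     = (\<Prod>b\<in>(Basis::'a set). of_real (sqrt (2 * pi) / s * exp (- ((z \<bullet> b)\<^sup>2 / (2 * s\<^sup>2)))))"
    unfolding eq by (subst integral_lborel_prod) (intro integrable_gaussian_cis_real s, simp only: integral_gaussian_cis_real[OF s])
  also have "\<dots> = of_real (gauss_ft s z)"
  proof -
    have "(norm z)\<^sup>2 = (\<Sum>b\<in>Basis. (z \<bullet> b)\<^sup>2)"
      by (subst euclidean_inner[of z z, unfolded power2_norm_eq_inner[symmetric]]) (simp add: power2_eq_square)
    then have 1: "exp (- ((norm z)\<^sup>2 / (2 * s\<^sup>2))) = (\<Prod>b\<in>Basis. exp (- ((z \<bullet> b)\<^sup>2 / (2 * s\<^sup>2))))"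
      by (simp add: exp_sum[symmetric] sum_negf sum_divide_distrib)
    show ?thesis unfolding gauss_ft_def 1 by (simp only: of_real_prod[symmetric] prod.distrib prod_constant)
  qed
  finally show "(\<integral>\<xi>. of_real (exp (- (s\<^sup>2 * (norm \<xi>)\<^sup>2 / 2))) * cis (\<xi> \<bullet> z) \<partial>lborel) = of_real (gauss_ft s z)" .
qed

section \<open>Subordination: an exponential as a mixture of Gaussians\<close>

lemma integral_exp_neg_square_real:
  "integrable lborel (\<lambda>x::real. exp (- x\<^sup>2))" "(\<integral>x. exp (- x\<^sup>2) \<partial>(lborel :: real measure)) = sqrt pi"
proof -
  have eq: "of_real (exp (- ((sqrt 2)\<^sup>2 * x\<^sup>2 / 2))) * cis (x * 0) = complex_of_real (exp (- x\<^sup>2))" for x :: real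
    by simp
  have "integrable lborel (\<lambda>x::real. complex_of_real (exp (- x\<^sup>2)))"
    using integrable_gaussian_cis_real[of "sqrt 2" 0] unfolding eq by simp
  then show "integrable lborel (\<lambda>x::real. exp (- x\<^sup>2))"
    by (simp only: complex_of_real_integrable_eq)
  have "(\<integral>x. complex_of_real (exp (- x\<^sup>2)) \<partial>lborel) = of_real (sqrt pi)"
    using integral_gaussian_cis_real[of "sqrt 2" 0] unfolding eq by (simp add: real_sqrt_mult)
  then show "(\<integral>x. exp (- x\<^sup>2) \<partial>(lborel :: real measure)) = sqrt pi"
    by (simp only: integral_complex_of_real of_real_eq_iff)
qed

text \<open>The map from \<open>v\<close> to \<open>v - r / v\<close> is an increasing bijection of
  the positive half line onto the whole line with derivative \<open>1 + r / v\<^sup>2\<close>, so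
  the integrand times this derivative has the full Gaussian integral. The inversion of
  \<open>v\<close> to \<open>r / v\<close> preserves the integrand and shows that the two summands
  of the derivative contribute equally; this gives the factor one half.\<close>

lemma
  fixes r :: real assumes r: "r > 0"
  shows absolutely_integrable_Cauchy_Schloemilch: "(\<lambda>v. exp (- (v - r / v)\<^sup>2)) absolutely_integrable_on {0<..}"
    and integral_Cauchy_Schloemilch: "integral {0<..} (\<lambda>v. exp (- (v - r / v)\<^sup>2)) = sqrt pi / 2"
proof -
  let ?F = "\<lambda>v. exp (- (v - r / v)\<^sup>2)" and ?S = "{0<..} :: real set"
  have S: "?S \<in> sets lebesgue" by simp
  have im1: "(\<lambda>v. v - r / v) ` ?S = UNIV"
  proof (intro equalityI subsetI UNIV_I)
    fix y :: real
    \<comment> \<open>The positive root of \<open>v\<^sup>2 - y v - r = 0\<close>, which is the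
      equation \<open>v - r / v = y\<close> cleared of its denominator.\<close>
    define v where "v = (y + sqrt (y\<^sup>2 + 4 * r)) / 2"
    have "\<bar>y\<bar> < sqrt (y\<^sup>2 + 4 * r)"
      using r by (intro real_less_rsqrt) auto
    then have v0: "v > 0" unfolding v_def by auto
    have "v * v - r = y * v"
      unfolding v_def using r by (simp add: field_simps power2_eq_square)
    then have "v - r / v = y" using v0 by (simp add: field_simps)
    then show "y \<in> (\<lambda>v. v - r / v) ` ?S" using v0 by auto
  qed
  have inj1: "inj_on (\<lambda>v. v - r / v) ?S"
  proof (rule strict_mono_on_imp_inj_on, rule strict_mono_onI)
    fix a b :: real assume "a \<in> ?S" "b \<in> ?S" "a < b"
    then have "r / b < r / a" using r by (intro divide_strict_left_mono) auto
    then show "a - r / a < b - r / b" using \<open>a < b\<close> by simp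
  qed
  have ai: "(\<lambda>y::real. exp (- y\<^sup>2)) absolutely_integrable_on UNIV"
    using integral_exp_neg_square_real(1) unfolding set_integrable_def by (auto intro: integrable_completion[THEN iffD2])
  have iv: "integral UNIV (\<lambda>y::real. exp (- y\<^sup>2)) = sqrt pi"
    using integral_exp_neg_square_real by (simp add: integral_lborel)
  have "(\<lambda>v. \<bar>1 + r / v\<^sup>2\<bar> * ?F v) absolutely_integrable_on ?S \<and> integral ?S (\<lambda>v. \<bar>1 + r / v\<^sup>2\<bar> * ?F v) = sqrt pi"
  proof (rule iffD2[OF has_absolute_integral_change_of_variables_1'[OF S _ inj1, of "\<lambda>v. 1 + r / v\<^sup>2" "\<lambda>y. exp (- y\<^sup>2)" "sqrt pi"]])
    show "((\<lambda>v. v - r / v) has_field_derivative 1 + r / x\<^sup>2) (at x within ?S)" if "x \<in> ?S" for x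
      using that by (auto intro!: derivative_eq_intros simp: power2_eq_square)
  qed (use ai iv im1 in auto)
  then have c1: "(\<lambda>v. \<bar>1 + r / v\<^sup>2\<bar> * ?F v) absolutely_integrable_on ?S"
    and c2: "integral ?S (\<lambda>v. \<bar>1 + r / v\<^sup>2\<bar> * ?F v) = sqrt pi" by auto
  have F: "?F absolutely_integrable_on ?S"
  proof (rule measurable_bounded_by_integrable_imp_absolutely_integrable[OF _ S])
    show "(\<lambda>v. \<bar>1 + r / v\<^sup>2\<bar> * ?F v) integrable_on ?S" using c1 set_lebesgue_integral_eq_integral(1) by blast
    show "?F \<in> borel_measurable (lebesgue_on ?S)"
      by (rule measurable_restrict_space1) (simp add: measurable_completion)
    show "norm (?F x) \<le> \<bar>1 + r / x\<^sup>2\<bar> * ?F x" if "x \<in> ?S" for x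
      using that r by (simp add: mult_le_cancel_right1)
  qed
  then show "?F absolutely_integrable_on ?S" .
  have im2: "(\<lambda>v. r / v) ` ?S = ?S"
  proof (intro equalityI subsetI)
    fix y assume "y \<in> ?S" then show "y \<in> (\<lambda>v. r / v) ` ?S"
      using r by (intro image_eqI[of _ _ "r / y"]) auto
  qed (use r in auto)
  have inj2: "inj_on (\<lambda>v. r / v) ?S" using r by (auto simp: inj_on_def)
  have "(\<lambda>v. \<bar>- r / v\<^sup>2\<bar> * ?F (r / v)) absolutely_integrable_on ?S \<and> integral ?S (\<lambda>v. \<bar>- r / v\<^sup>2\<bar> * ?F (r / v)) = integral ?S ?F"
  proof (rule iffD2[OF has_absolute_integral_change_of_variables_1'[OF S _ inj2, of "\<lambda>v. - r / v\<^sup>2" ?F "integral ?S ?F"]])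
    show "((\<lambda>v. r / v) has_field_derivative - r / x\<^sup>2) (at x within ?S)" if "x \<in> ?S" for x
      using that by (auto intro!: derivative_eq_intros simp: power2_eq_square)
  qed (use F im2 in auto)
  then have e1: "(\<lambda>v. \<bar>- r / v\<^sup>2\<bar> * ?F (r / v)) absolutely_integrable_on ?S" and e2: "integral ?S (\<lambda>v. \<bar>- r / v\<^sup>2\<bar> * ?F (r / v)) = integral ?S ?F"
    by auto
  have eq: "\<bar>- r / v\<^sup>2\<bar> * ?F (r / v) = (r / v\<^sup>2) * ?F v" if "v \<in> ?S" for v
    using that r by (simp add: power2_commute)
  have d1: "(\<lambda>v. (r / v\<^sup>2) * ?F v) absolutely_integrable_on ?S"
  proof -
    have "((\<lambda>v. \<bar>- r / v\<^sup>2\<bar> * ?F (r / v)) absolutely_integrable_on ?S) = ((\<lambda>v. (r / v\<^sup>2) * ?F v) absolutely_integrable_on ?S)"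
      by (rule set_integrable_cong[OF refl refl]) (rule eq)
    then show ?thesis using e1 by (rule iffD1)
  qed
  have d2: "integral ?S (\<lambda>v. (r / v\<^sup>2) * ?F v) = integral ?S ?F"
    unfolding e2[symmetric] by (rule Henstock_Kurzweil_Integration.integral_cong) (rule eq[symmetric])
  have "sqrt pi = integral ?S (\<lambda>v. ?F v + (r / v\<^sup>2) * ?F v)"
    unfolding c2[symmetric] by (intro Henstock_Kurzweil_Integration.integral_cong) (use r in \<open>auto simp: algebra_simps\<close>)
  also have "\<dots> = integral ?S ?F + integral ?S (\<lambda>v. (r / v\<^sup>2) * ?F v)"
    by (intro Henstock_Kurzweil_Integration.integral_add set_lebesgue_integral_eq_integral(1) F d1)
  finally show "integral ?S ?F = sqrt pi / 2" unfolding d2 by simp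
qed

text \<open>Completing the square gives \<open>v\<^sup>2 + r\<^sup>2 / v\<^sup>2 = (v - r /
  v)\<^sup>2 + 2 r\<close>. Each integrand is a Gaussian in \<open>r\<close>, so the exponential of
  \<open>- 2 r\<close> appears as a superposition of Gaussians of varying width.\<close>

lemma nn_integral_subordination:
  fixes r :: real assumes r: "r > 0"
  shows "(\<integral>\<^sup>+v. ennreal (exp (- v\<^sup>2 - r\<^sup>2 / v\<^sup>2)) * indicator {0<..} v \<partial>lborel) = ennreal (sqrt pi / 2 * exp (- (2 * r)))"
proof -
  let ?F = "\<lambda>v. exp (- (v - r / v)\<^sup>2)"
  have "(?F has_integral (sqrt pi / 2)) {0<..}"
    using absolutely_integrable_Cauchy_Schloemilch[OF r] integral_Cauchy_Schloemilch[OF r]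
      set_lebesgue_integral_eq_integral(1) integrable_integral by metis
  then have "((\<lambda>v. if v \<in> {0<..} then ?F v else 0) has_integral (sqrt pi / 2)) UNIV"
    by (subst has_integral_restrict_UNIV)
  then have "((\<lambda>v. ?F v * indicator {0<..} v) has_integral (sqrt pi / 2)) UNIV"
    by (rule has_integral_eq[rotated]) auto
  then have *: "(\<integral>\<^sup>+v. ennreal (?F v * indicator {0<..} v) \<partial>lborel) = ennreal (sqrt pi / 2)"
    by (intro nn_integral_has_integral_lborel) auto
  have "(\<integral>\<^sup>+v. ennreal (exp (- v\<^sup>2 - r\<^sup>2 / v\<^sup>2)) * indicator {0<..} v \<partial>lborel)
     = (\<integral>\<^sup>+v. ennreal (exp (- (2 * r))) * ennreal (?F v * indicator {0<..} v) \<partial>lborel)"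
    by (intro nn_integral_cong)
       (auto simp: ennreal_mult[symmetric] mult_exp_exp power2_diff power_divide field_simps split: split_indicator)
  also have "\<dots> = ennreal (exp (- (2 * r))) * ennreal (sqrt pi / 2)"
    by (subst nn_integral_cmult) (auto simp: *)
  finally show ?thesis by (simp add: ennreal_mult[symmetric] mult.commute)
qed

subsection \<open>Polar coordinates on an octave\<close>

lemma nn_integral_lborel_scaleR:
  fixes F :: "'a::euclidean_space \<Rightarrow> ennreal"
  assumes [measurable]: "F \<in> borel_measurable borel" and c: "c > 0"
  shows "(\<integral>\<^sup>+x. F x \<partial>lborel) = ennreal (c ^ DIM('a)) * (\<integral>\<^sup>+x. F (c *\<^sub>R x) \<partial>lborel)"
  using c by (subst lborel_affine[of c 0])
    (auto simp: nn_integral_density nn_integral_distr nn_integral_cmult)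

text \<open>The set is the octave of all \<open>s\<close> above \<open>t / 2\<close> and up to
  \<open>t\<close>, and the measure \<open>ds / s\<close> is invariant under dilations. Inserting
  this integral at the cost of \<open>ln 2\<close> localises any positive quantity \<open>t\<close>
  to one octave of scales.\<close>

lemma nn_integral_octave:
  assumes "t > 0"
  shows "(\<integral>\<^sup>+s. ennreal (inverse s) * indicator {s. 0 < s \<and> s \<le> t \<and> t < 2 * s} s \<partial>lborel) = ennreal (ln 2)"
proof -
  have "AE s in lborel. s \<noteq> t / 2" by (rule AE_lborel_singleton)
  then have "(\<integral>\<^sup>+s. ennreal (inverse s) * indicator {s. 0 < s \<and> s \<le> t \<and> t < 2 * s} s \<partial>lborel)
    = (\<integral>\<^sup>+s. ennreal (inverse s) * indicator {t / 2 .. t} s \<partial>lborel)"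
    using assms by (intro nn_integral_cong_AE) (auto elim!: eventually_mono split: split_indicator)
  also have "\<dots> = ennreal (ln t - ln (t / 2))"
    using assms by (intro nn_integral_FTC_Icc) (auto intro!: derivative_eq_intros simp: field_simps)
  also have "ln t - ln (t / 2) = ln 2" using assms by (simp add: ln_div)
  finally show ?thesis .
qed

text \<open>Polar coordinates with the surface measure replaced by Lebesgue measure on a thick
  spherical shell. For fixed \<open>r\<close> the substitution \<open>\<xi> = r w\<close> turns
  \<open>r ^ (DIM('a) - 1) dr dw\<close> into \<open>dr / r d\<xi>\<close>, and the condition on
  \<open>w\<close> says that \<open>norm \<xi>\<close> lies in the octave above \<open>r\<close>;
  integrating over \<open>r\<close> leaves \<open>ln 2\<close>.\<close>

lemma nn_integral_polar_octave:
  fixes F :: "'a::euclidean_space \<Rightarrow> ennreal"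
  assumes [measurable]: "F \<in> borel_measurable borel"
  shows "(\<integral>\<^sup>+w. (\<integral>\<^sup>+r. ennreal (r ^ (DIM('a) - 1)) * indicator {0<..} r * indicator {w. 1 \<le> norm w \<and> norm w < 2} w * F (r *\<^sub>R w) \<partial>lborel) \<partial>lborel)
     = ennreal (ln 2) * (\<integral>\<^sup>+\<xi>. F \<xi> \<partial>lborel)"
proof -
  let ?S = "{w::'a. 1 \<le> norm w \<and> norm w < 2}"
  have [measurable]: "?S \<in> sets borel" by measurable
  have "(\<integral>\<^sup>+w. (\<integral>\<^sup>+r. ennreal (r ^ (DIM('a) - 1)) * indicator {0<..} r * indicator ?S w * F (r *\<^sub>R w) \<partial>lborel) \<partial>lborel)
     = (\<integral>\<^sup>+r. (\<integral>\<^sup>+w. ennreal (r ^ (DIM('a) - 1)) * indicator {0<..} r * indicator ?S w * F (r *\<^sub>R w) \<partial>lborel) \<partial>lborel)"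
    by (rule lborel_pair.Fubini'[symmetric]) measurable
  also have "\<dots> = (\<integral>\<^sup>+r. (\<integral>\<^sup>+\<xi>. ennreal (inverse r) * indicator {s. 0 < s \<and> s \<le> norm \<xi> \<and> norm \<xi> < 2 * s} r * F \<xi> \<partial>lborel) \<partial>lborel)"
  proof (rule nn_integral_cong)
    fix r :: real
    show "(\<integral>\<^sup>+w. ennreal (r ^ (DIM('a) - 1)) * indicator {0<..} r * indicator ?S w * F (r *\<^sub>R w) \<partial>lborel)
      = (\<integral>\<^sup>+\<xi>. ennreal (inverse r) * indicator {s. 0 < s \<and> s \<le> norm \<xi> \<and> norm \<xi> < 2 * s} r * F \<xi> \<partial>lborel)"
    proof (cases "r > 0")
      case True
      have p: "r ^ DIM('a) * inverse r = r ^ (DIM('a) - 1)"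
        using True DIM_positive[where 'a='a] by (cases "DIM('a)") auto
      have "(\<integral>\<^sup>+\<xi>. ennreal (inverse r) * indicator {s. 0 < s \<and> s \<le> norm \<xi> \<and> norm \<xi> < 2 * s} r * F \<xi> \<partial>lborel)
        = ennreal (r ^ DIM('a)) * (\<integral>\<^sup>+w. ennreal (inverse r) * indicator {s. 0 < s \<and> s \<le> norm (r *\<^sub>R w) \<and> norm (r *\<^sub>R w) < 2 * s} r * F (r *\<^sub>R w) \<partial>lborel)"
        by (rule nn_integral_lborel_scaleR) (use True in auto)
      also have "\<dots> = (\<integral>\<^sup>+w. ennreal (r ^ DIM('a)) * (ennreal (inverse r) * indicator {s. 0 < s \<and> s \<le> norm (r *\<^sub>R w) \<and> norm (r *\<^sub>R w) < 2 * s} r * F (r *\<^sub>R w)) \<partial>lborel)"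
        by (rule nn_integral_cmult[symmetric]) measurable
      also have "\<dots> = (\<integral>\<^sup>+w. ennreal (r ^ (DIM('a) - 1)) * indicator {0<..} r * indicator ?S w * F (r *\<^sub>R w) \<partial>lborel)"
        using True by (intro nn_integral_cong) (auto simp: p ennreal_mult[symmetric] mult.assoc[symmetric] split: split_indicator)
      finally show ?thesis by simp
    next
      case False
      then show ?thesis by simp
    qed
  qed
  also have "\<dots> = (\<integral>\<^sup>+\<xi>. (\<integral>\<^sup>+r. ennreal (inverse r) * indicator {s. 0 < s \<and> s \<le> norm \<xi> \<and> norm \<xi> < 2 * s} r * F \<xi> \<partial>lborel) \<partial>lborel)"
    by (rule lborel_pair.Fubini') measurable
  also have "\<dots> = (\<integral>\<^sup>+\<xi>. ennreal (ln 2) * F \<xi> \<partial>lborel)"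
  proof (rule nn_integral_cong_AE)
    have "AE \<xi> in lborel. (\<xi>::'a) \<noteq> 0" by (rule AE_lborel_singleton)
    then show "AE \<xi> in lborel. (\<integral>\<^sup>+r. ennreal (inverse r) * indicator {s. 0 < s \<and> s \<le> norm \<xi> \<and> norm \<xi> < 2 * s} r * F \<xi> \<partial>lborel) = ennreal (ln 2) * F \<xi>"
    proof eventually_elim
      case (elim \<xi>)
      then show ?case by (subst nn_integral_multc) (auto simp: nn_integral_octave)
    qed
  qed
  also have "\<dots> = ennreal (ln 2) * (\<integral>\<^sup>+\<xi>. F \<xi> \<partial>lborel)"
    by (rule nn_integral_cmult) measurable
  finally show ?thesis .
qed

text \<open>The nonnegative formula, tested on indicators, says that the weighted product measure is
  mapped by multiplication to \<open>ln 2\<close> times Lebesgue measure. As an equality of measures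
  it applies to vector-valued integrands.\<close>

lemma integral_polar_octave:
  fixes F :: "'a::euclidean_space \<Rightarrow> 'b::{banach,second_countable_topology}"
  assumes int: "integrable lborel F"
  defines "H \<equiv> \<lambda>(w::'a, r). (r ^ (DIM('a) - 1) * indicator {0<..} r * indicator {w. 1 \<le> norm w \<and> norm w < 2} w) *\<^sub>R F (r *\<^sub>R w)"
  shows "integrable (lborel \<Otimes>\<^sub>M lborel) H" "integral\<^sup>L (lborel \<Otimes>\<^sub>M lborel) H = ln 2 *\<^sub>R integral\<^sup>L lborel F"
proof -
  let ?w = "\<lambda>x::'a \<times> real. snd x ^ (DIM('a) - 1) * indicator {0<..} (snd x) * indicator {w. 1 \<le> norm w \<and> norm w < 2} (fst x)"
  let ?M = "density (lborel \<Otimes>\<^sub>M lborel) (\<lambda>x. ennreal (?w x))"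
  have [measurable]: "F \<in> borel_measurable borel" using int by auto
  have [measurable]: "?w \<in> borel_measurable (lborel \<Otimes>\<^sub>M lborel)" by measurable
  have nn: "0 \<le> ?w x" for x by (auto split: split_indicator)
  have D: "distr ?M borel (\<lambda>x. snd x *\<^sub>R fst x) = density lborel (\<lambda>_. ennreal (ln 2))"
  proof (rule measure_eqI)
    fix A assume "A \<in> sets (distr ?M borel (\<lambda>x. snd x *\<^sub>R fst x :: 'a))"
    then have A[measurable]: "A \<in> sets borel" by simp
    have "emeasure (distr ?M borel (\<lambda>x. snd x *\<^sub>R fst x)) A = (\<integral>\<^sup>+x. indicator A x \<partial>distr ?M borel (\<lambda>x. snd x *\<^sub>R fst x))"
      by simp
    also have "\<dots> = (\<integral>\<^sup>+x. ennreal (?w x) * indicator A (snd x *\<^sub>R fst x) \<partial>(lborel \<Otimes>\<^sub>M lborel))"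
      by (subst nn_integral_distr, measurable) (subst nn_integral_density, auto simp: case_prod_beta)
    also have "\<dots> = (\<integral>\<^sup>+w. (\<integral>\<^sup>+r. ennreal (?w (w, r)) * indicator A (r *\<^sub>R w) \<partial>lborel) \<partial>lborel)"
      by (subst lborel.nn_integral_fst[symmetric]) auto
    also have "\<dots> = (\<integral>\<^sup>+w. (\<integral>\<^sup>+r. ennreal (r ^ (DIM('a) - 1)) * indicator {0<..} r * indicator {w. 1 \<le> norm w \<and> norm w < 2} w * indicator A (r *\<^sub>R w) \<partial>lborel) \<partial>lborel)"
      by (intro nn_integral_cong) (auto split: split_indicator)
    also have "\<dots> = ennreal (ln 2) * (\<integral>\<^sup>+\<xi>. indicator A \<xi> \<partial>lborel)"
      by (rule nn_integral_polar_octave) measurable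
    also have "\<dots> = emeasure (density lborel (\<lambda>_. ennreal (ln 2))) A"
      by (simp add: emeasure_density_const)
    finally show "emeasure (distr ?M borel (\<lambda>x. snd x *\<^sub>R fst x)) A = emeasure (density lborel (\<lambda>_. ennreal (ln 2))) A" .
  qed simp
  have H: "H = (\<lambda>x. ?w x *\<^sub>R F (snd x *\<^sub>R fst x))"
    unfolding H_def by auto
  have "integrable (density lborel (\<lambda>_::'a. ennreal (ln 2))) F"
    by (subst integrable_density) (auto intro: int)
  then show "integrable (lborel \<Otimes>\<^sub>M lborel) H"
    unfolding D[symmetric] H by (subst (asm) integrable_distr_eq, measurable, subst (asm) integrable_density, measurable) (use nn in auto)
  have "ln 2 *\<^sub>R integral\<^sup>L lborel F = integral\<^sup>L (density lborel (\<lambda>_::'a. ennreal (ln 2))) F"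
    by (subst integral_density) auto
  also have "\<dots> = integral\<^sup>L (lborel \<Otimes>\<^sub>M lborel) H"
    unfolding D[symmetric] H by (subst integral_distr, measurable, subst integral_density, measurable) (use nn in auto)
  finally show "integral\<^sup>L (lborel \<Otimes>\<^sub>M lborel) H = ln 2 *\<^sub>R integral\<^sup>L lborel F" by simp
qed

text \<open>Only the first component is restricted. The set is thus a product, on which
  \<open>w\<close> and \<open>b\<close> can be integrated separately, and every ray with nonzero
  first component meets it in exactly one octave.\<close>

definition shell :: "('a::euclidean_space \<times> real) set" where
  "shell = {v. 1 \<le> norm (fst v) \<and> norm (fst v) < 2}"

lemma shell_measurable [measurable]:
  "(shell :: ('a::euclidean_space \<times> real) set) \<in> sets borel"
  "(shell :: ('a \<times> real) set) \<in> sets (borel \<Otimes>\<^sub>M borel)"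
proof -
  have "shell = {v::'a \<times> real. 1 \<le> norm (fst v)} \<inter> {v. norm (fst v) < 2}" by (auto simp: shell_def)
  also have "\<dots> \<in> sets borel"
    by (intro sets.Int borel_closed borel_open closed_Collect_le open_Collect_less continuous_intros)
  finally show "(shell :: ('a \<times> real) set) \<in> sets borel" .
  then show "(shell :: ('a \<times> real) set) \<in> sets (borel \<Otimes>\<^sub>M borel)" unfolding borel_prod .
qed

lemma AE_lborel_fst_nonzero: "AE v in lborel. fst (v :: 'a::euclidean_space \<times> real) \<noteq> 0"
proof (rule AE_I')
  have "emeasure (lborel \<Otimes>\<^sub>M lborel) ({0::'a} \<times> (UNIV :: real set)) = 0"
    by (subst lborel.emeasure_pair_measure_Times) auto
  then show "{0::'a} \<times> (UNIV :: real set) \<in> null_sets lborel"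
    unfolding lborel_prod by (auto simp: null_sets_def closed_Times borel_closed)
qed auto

text \<open>The scale of the first component of \<open>v\<close> is localised to an octave, which
  costs \<open>ln 2\<close>, and \<open>v\<close> is dilated by the scale \<open>s\<close> so that
  it lands in the shell. The radial projection \<open>sgn v\<close> does not notice the dilation,
  while the unit ball becomes the condition \<open>s \<le> inverse (norm v)\<close>. The remaining
  integral of a power of \<open>s\<close> gives the weight on the right and the dimension on the
  left.\<close>

lemma nn_integral_sphere_shell:
  fixes \<phi> :: "'a::euclidean_space \<times> real \<Rightarrow> ennreal"
  assumes [measurable]: "\<phi> \<in> borel_measurable borel"
  shows "ennreal (DIM('a \<times> real) * ln 2) * (\<integral>\<^sup>+v. \<phi> (sgn v) * indicator (cball 0 1) v \<partial>lborel)
    = (\<integral>\<^sup>+v. \<phi> (sgn v) * ennreal (inverse (norm v ^ DIM('a \<times> real))) * indicator shell v \<partial>lborel)"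
  (is "_ = ?R")
proof -
  let ?n = "DIM('a \<times> real)"
  have [measurable]: "sgn \<in> borel_measurable (borel :: ('a \<times> real) measure)"
    by (simp add: sgn_div_norm[abs_def])
  have [measurable]: "fst \<in> borel_measurable (borel :: ('a \<times> real) measure)"
    by (intro borel_measurable_continuous_onI continuous_intros)
  have [measurable]: "(cball 0 1 :: ('a \<times> real) set) \<in> sets borel" by simp
  define \<psi> where "\<psi> v = \<phi> (sgn v) * indicator shell v" for v
  have [measurable]: "\<psi> \<in> borel_measurable borel" unfolding \<psi>_def by measurable
  have n0: "?n > 0" by simp
  have "ennreal (ln 2) * (\<integral>\<^sup>+v. \<phi> (sgn v) * indicator (cball 0 1) v \<partial>lborel)
     = (\<integral>\<^sup>+v. ennreal (ln 2) * (\<phi> (sgn v) * indicator (cball 0 1) v) \<partial>lborel)"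
    by (rule nn_integral_cmult[symmetric]) measurable
  also have "\<dots> = (\<integral>\<^sup>+v. (\<integral>\<^sup>+s. (ennreal (inverse s) * indicator {s. 0 < s \<and> s \<le> norm (fst v) \<and> norm (fst v) < 2 * s} s) * (\<phi> (sgn v) * indicator (cball 0 1) v) \<partial>lborel) \<partial>lborel)"
  proof (rule nn_integral_cong_AE)
    have "AE v in lborel. fst (v :: 'a \<times> real) \<noteq> 0"
      by (rule AE_lborel_fst_nonzero)
    then show "AE v in lborel. ennreal (ln 2) * (\<phi> (sgn v) * indicator (cball 0 1) v) =
       (\<integral>\<^sup>+s. (ennreal (inverse s) * indicator {s. 0 < s \<and> s \<le> norm (fst v) \<and> norm (fst v) < 2 * s} s) * (\<phi> (sgn v) * indicator (cball 0 1) v) \<partial>lborel)"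
    proof eventually_elim
      case (elim v)
      then show ?case by (subst nn_integral_multc) (auto simp: nn_integral_octave)
    qed
  qed
  also have "\<dots> = (\<integral>\<^sup>+s. (\<integral>\<^sup>+v. (ennreal (inverse s) * indicator {s. 0 < s \<and> s \<le> norm (fst v) \<and> norm (fst v) < 2 * s} s) * (\<phi> (sgn v) * indicator (cball 0 1) v) \<partial>lborel) \<partial>lborel)"
    by (rule lborel_pair.Fubini'[symmetric]) measurable
  \<comment> \<open>The inner variable is replaced by \<open>s *\<^sub>R v\<close>: the Jacobian
    \<open>s ^ ?n\<close> against \<open>inverse s\<close> leaves the exponent
    \<open>?n - 1\<close>.\<close>
  also have "\<dots> = (\<integral>\<^sup>+s. (\<integral>\<^sup>+v. ennreal (s ^ (?n - 1)) * indicator {t. 0 \<le> t \<and> t \<le> inverse (norm v)} s * \<psi> v \<partial>lborel) \<partial>lborel)"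
  proof (rule nn_integral_cong_AE)
    have "AE s in lborel. (s::real) \<noteq> 0" by (rule AE_lborel_singleton)
    then show "AE s in lborel. (\<integral>\<^sup>+v. (ennreal (inverse s) * indicator {s. 0 < s \<and> s \<le> norm (fst v) \<and> norm (fst v) < 2 * s} s) * (\<phi> (sgn v) * indicator (cball 0 1) v) \<partial>lborel)
       = (\<integral>\<^sup>+v. ennreal (s ^ (?n - 1)) * indicator {t. 0 \<le> t \<and> t \<le> inverse (norm v)} s * \<psi> v \<partial>lborel)"
    proof eventually_elim
      case (elim s)
      show ?case
      proof (cases "s > 0")
        case True
        have p: "s ^ ?n * inverse s = s ^ (?n - 1)"
          using True n0 by (cases ?n) auto
        have ep: "ennreal (s ^ ?n) * ennreal (inverse s) = ennreal (s ^ (?n - 1))"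
          using True by (subst ennreal_mult[symmetric]) (simp_all only: p zero_le_power less_imp_le inverse_nonnegative_iff_nonnegative)
        have sh: "indicator {t. 0 < t \<and> t \<le> norm (fst (s *\<^sub>R v)) \<and> norm (fst (s *\<^sub>R v)) < 2 * t} s = (indicator shell v :: ennreal)" for v :: "'a \<times> real"
          using True by (auto simp: shell_def split: split_indicator)
        have ba: "indicator shell v * indicator (cball 0 1) (s *\<^sub>R v) = (indicator {t. 0 \<le> t \<and> t \<le> inverse (norm v)} s * indicator shell v :: ennreal)" for v :: "'a \<times> real"
        proof -
          have "norm v > 0" if "v \<in> shell" using that by (auto simp: shell_def)
          then show ?thesis using True by (auto simp: field_simps split: split_indicator)
        qed
        define F where "F v = (ennreal (inverse s) * indicator {s. 0 < s \<and> s \<le> norm (fst v) \<and> norm (fst v) < 2 * s} s) * (\<phi> (sgn v) * indicator (cball 0 1) v)" for v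
        have [measurable]: "F \<in> borel_measurable borel" unfolding F_def by measurable
        have Fs: "F (s *\<^sub>R v) = (ennreal (inverse s) * indicator shell v) * (\<phi> (sgn v) * indicator (cball 0 1) (s *\<^sub>R v))" for v
          unfolding F_def sh using True by (simp add: sgn_scaleR)
        have "(\<integral>\<^sup>+v. F v \<partial>lborel) = ennreal (s ^ ?n) * (\<integral>\<^sup>+v. F (s *\<^sub>R v) \<partial>lborel)"
          by (rule nn_integral_lborel_scaleR[OF _ True]) measurable
        also have "\<dots> = (\<integral>\<^sup>+v. ennreal (s ^ ?n) * ((ennreal (inverse s) * indicator shell v) * (\<phi> (sgn v) * indicator (cball 0 1) (s *\<^sub>R v))) \<partial>lborel)"
          unfolding Fs[symmetric] by (rule nn_integral_cmult[symmetric]) measurable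
        also have "\<dots> = (\<integral>\<^sup>+v. (ennreal (s ^ ?n) * ennreal (inverse s)) * \<phi> (sgn v) * (indicator shell v * indicator (cball 0 1) (s *\<^sub>R v)) \<partial>lborel)"
          by (simp only: mult_ac)
        also have "\<dots> = (\<integral>\<^sup>+v. ennreal (s ^ (?n - 1)) * indicator {t. 0 \<le> t \<and> t \<le> inverse (norm v)} s * \<psi> v \<partial>lborel)"
          unfolding ba ep \<psi>_def by (simp only: mult_ac)
        finally show ?thesis unfolding F_def .
      next
        case False
        with elim show ?thesis by simp
      qed
    qed
  qed
  also have "\<dots> = (\<integral>\<^sup>+v. (\<integral>\<^sup>+s. ennreal (s ^ (?n - 1)) * indicator {t. 0 \<le> t \<and> t \<le> inverse (norm v)} s * \<psi> v \<partial>lborel) \<partial>lborel)"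
    by (rule lborel_pair.Fubini') measurable
  also have "\<dots> = (\<integral>\<^sup>+v. ennreal (1 / ?n) * (\<phi> (sgn v) * ennreal (inverse (norm v ^ ?n)) * indicator shell v) \<partial>lborel)"
  proof (rule nn_integral_cong)
    fix v :: "'a \<times> real"
    have der: "((\<lambda>s. s ^ k / k) has_real_derivative s ^ (k - 1)) (at s)" if "k > 0" for k :: nat and s
      using that by (auto intro!: derivative_eq_intros)
    have "(\<integral>\<^sup>+s. ennreal (s ^ (?n - 1)) * indicator {0 .. inverse (norm v)} s \<partial>lborel)
      = ennreal (inverse (norm v) ^ ?n / ?n - 0 ^ ?n / ?n)"
    proof (rule nn_integral_FTC_Icc)
      show "((\<lambda>s. s ^ ?n / ?n) has_real_derivative s ^ (?n - 1)) (at s)" for s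
        by (rule der[OF n0])
    qed auto
    also have "{0 .. inverse (norm v)} = {t. 0 \<le> t \<and> t \<le> inverse (norm v)}" by auto
    also have "inverse (norm v) ^ ?n / ?n - 0 ^ ?n / ?n = 1 / ?n * inverse (norm v ^ ?n)"
      using n0 by (simp add: power_inverse)
    finally have "(\<integral>\<^sup>+s. ennreal (s ^ (?n - 1)) * indicator {t. 0 \<le> t \<and> t \<le> inverse (norm v)} s \<partial>lborel) = ennreal (1 / ?n) * ennreal (inverse (norm v ^ ?n))"
      by (simp add: ennreal_mult[symmetric])
    then show "(\<integral>\<^sup>+s. ennreal (s ^ (?n - 1)) * indicator {t. 0 \<le> t \<and> t \<le> inverse (norm v)} s * \<psi> v \<partial>lborel)
      = ennreal (1 / ?n) * (\<phi> (sgn v) * ennreal (inverse (norm v ^ ?n)) * indicator shell v)"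
      by (subst nn_integral_multc) (auto simp: \<psi>_def mult_ac)
  qed
  also have "\<dots> = ennreal (1 / ?n) * ?R"
    by (rule nn_integral_cmult) measurable
  finally have "ennreal ?n * (ennreal (ln 2) * (\<integral>\<^sup>+v. \<phi> (sgn v) * indicator (cball 0 1) v \<partial>lborel)) = ennreal ?n * (ennreal (1 / ?n) * ?R)"
    by simp
  moreover have "ennreal ?n * ennreal (1 / ?n) = 1"
    using n0 by (subst ennreal_mult[symmetric]) auto
  ultimately show ?thesis by (simp add: mult.assoc[symmetric] ennreal_mult)
qed

text \<open>The volume of the unit ball times the dimension is the surface area of the unit sphere,
  and \<open>ln 2\<close> is the logarithmic length of an octave; the reciprocal normalises the
  shell integral to total mass one.\<close>

definition shell_const :: "'a::euclidean_space itself \<Rightarrow> real" where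
  "shell_const _ = 1 / (measure lborel (cball (0 :: 'a \<times> real) 1) * (DIM('a \<times> real) * ln 2))"

lemma shell_const_pos: "shell_const TYPE('a::euclidean_space) > 0"
  unfolding shell_const_def using content_cball_pos[of 1 "0 :: 'a \<times> real"] by (auto intro!: divide_pos_pos mult_pos_pos)

lemma sphere_unif_eq_distr_shell:
  "(sphere_unif :: ('a::euclidean_space \<times> real) measure) = restrict_space (distr (density lborel
     (\<lambda>v. ennreal (shell_const TYPE('a) * (inverse (norm v ^ DIM('a \<times> real)) * indicator shell v)))) borel sgn) (sphere 0 1)"
proof -
  let ?n = "DIM('a \<times> real)" and ?B = "cball (0 :: 'a \<times> real) 1"
  have [measurable]: "sgn \<in> borel_measurable (borel :: ('a \<times> real) measure)"
    by (simp add: sgn_div_norm[abs_def])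
  have V: "emeasure lborel ?B = ennreal (measure lborel ?B)" "measure lborel ?B > 0"
    using content_cball_pos[of 1 "0 :: 'a \<times> real"] emeasure_lborel_cball_finite[of "0 :: 'a \<times> real" 1]
    by (auto simp: emeasure_eq_ennreal_measure)
  have nl: "real ?n * ln 2 > 0" by simp
  have "distr (uniform_measure lborel ?B) borel sgn = distr (density lborel
     (\<lambda>v. ennreal (shell_const TYPE('a) * (inverse (norm v ^ ?n) * indicator shell v)))) borel sgn"
    (is "?L = ?R")
  proof (rule measure_eqI)
    fix A assume "A \<in> sets ?L"
    then have A[measurable]: "A \<in> sets borel" by simp
    have "ennreal (?n * ln 2) * (emeasure lborel ?B * emeasure ?L A) = ennreal (?n * ln 2) * (emeasure lborel ?B * (\<integral>\<^sup>+x. indicator A x \<partial>?L))"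
      by simp
    also have "(\<integral>\<^sup>+x. indicator A x \<partial>?L) = (\<integral>\<^sup>+v. indicator A (sgn v) * indicator ?B v \<partial>lborel) / emeasure lborel ?B"
      by (subst nn_integral_distr, measurable) (subst nn_integral_uniform_measure, auto)
    also have "emeasure lborel ?B * ((\<integral>\<^sup>+v. indicator A (sgn v) * indicator ?B v \<partial>lborel) / emeasure lborel ?B)
       = (\<integral>\<^sup>+v. indicator A (sgn v) * indicator ?B v \<partial>lborel)"
      using V by (simp add: ennreal_divide_times ennreal_times_divide[symmetric] mult.commute[of "ennreal (measure lborel ?B)"] ennreal_mult_divide_eq)
    also have "ennreal (?n * ln 2) * \<dots> = (\<integral>\<^sup>+v. indicator A (sgn v) * ennreal (inverse (norm v ^ ?n)) * indicator shell v \<partial>lborel)"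
      by (rule nn_integral_sphere_shell) measurable
    finally have 1: "ennreal (?n * ln 2) * (emeasure lborel ?B * emeasure ?L A) = (\<integral>\<^sup>+v. indicator A (sgn v) * ennreal (inverse (norm v ^ ?n)) * indicator shell v \<partial>lborel)" .
    have "emeasure ?R A = (\<integral>\<^sup>+x. indicator A x \<partial>?R)" by simp
    also have "\<dots> = (\<integral>\<^sup>+v. ennreal (shell_const TYPE('a) * (inverse (norm v ^ ?n) * indicator shell v)) * indicator A (sgn v) \<partial>lborel)"
      by (subst nn_integral_distr, measurable) (subst nn_integral_density, auto)
    also have "\<dots> = (\<integral>\<^sup>+v. ennreal (shell_const TYPE('a)) * (indicator A (sgn v) * ennreal (inverse (norm v ^ ?n)) * indicator shell v) \<partial>lborel)"
      by (intro nn_integral_cong) (auto simp: ennreal_mult[symmetric] less_imp_le[OF shell_const_pos] split: split_indicator)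
    also have "\<dots> = ennreal (shell_const TYPE('a)) * (\<integral>\<^sup>+v. indicator A (sgn v) * ennreal (inverse (norm v ^ ?n)) * indicator shell v \<partial>lborel)"
      by (rule nn_integral_cmult) measurable
    finally have 2: "emeasure ?R A = ennreal (shell_const TYPE('a)) * (ennreal (?n * ln 2) * (ennreal (measure lborel ?B) * emeasure ?L A))"
      unfolding 1[symmetric] V .
    have "shell_const TYPE('a) * (?n * ln 2 * measure lborel ?B) = 1"
      using V(2) nl unfolding shell_const_def by (simp add: field_simps del: DIM_prod)
    then have "ennreal (shell_const TYPE('a)) * (ennreal (?n * ln 2) * ennreal (measure lborel ?B)) = 1"
      by (metis ennreal_1 ennreal_mult' less_imp_le nl shell_const_pos)
    then show "emeasure ?L A = emeasure ?R A"
      unfolding 2 by (simp only: mult.assoc[symmetric]) simp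
  qed simp
  then show ?thesis unfolding sphere_unif_def by simp
qed

lemma measurable_sphere_unif:
  "f \<in> borel_measurable borel \<Longrightarrow> f \<in> borel_measurable sphere_unif"
  unfolding sphere_unif_def by (rule measurable_restrict_space1) simp

text \<open>All sphere integrals below are computed through these formulas. If \<phi> is homogeneous
  of degree \<open>- DIM('a \<times> real)\<close>, the weight combines with
  \<open>\<phi> (sgn v)\<close> to the plain value \<open>\<phi> v\<close>.\<close>

lemma
  fixes \<phi> :: "'a::euclidean_space \<times> real \<Rightarrow> real"
  assumes [measurable]: "\<phi> \<in> borel_measurable borel"
  shows integrable_sphere_unif_shell:
      "integrable sphere_unif \<phi> \<longleftrightarrow> integrable lborel (\<lambda>v. inverse (norm v ^ DIM('a \<times> real)) * indicator shell v * \<phi> (sgn v))"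
    and integral_sphere_unif_shell:
      "(LINT u|sphere_unif. \<phi> u) = shell_const TYPE('a) * (LINT v|lborel. inverse (norm v ^ DIM('a \<times> real)) * indicator shell v * \<phi> (sgn v))"
    and nn_integral_sphere_unif_shell:
      "(\<integral>\<^sup>+u. ennreal (\<phi> u) \<partial>sphere_unif) = ennreal (shell_const TYPE('a)) * (\<integral>\<^sup>+v. ennreal (inverse (norm v ^ DIM('a \<times> real)) * indicator shell v) * ennreal (\<phi> (sgn v)) \<partial>lborel)"
proof -
  let ?n = "DIM('a \<times> real)" and ?S = "sphere (0 :: 'a \<times> real) 1" and ?K = "shell_const TYPE('a)"
  let ?w = "\<lambda>v. ?K * (inverse (norm v ^ ?n) * indicator shell v) :: real"
  let ?D = "density lborel (\<lambda>v. ennreal (?w v)) :: ('a \<times> real) measure"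
  have [measurable]: "sgn \<in> borel_measurable (borel :: ('a \<times> real) measure)"
    by (simp add: sgn_div_norm[abs_def])
  have S[measurable]: "?S \<in> sets borel" by simp
  have K: "?K > 0" by (rule shell_const_pos)
  have w: "0 \<le> ?w v" for v using K by (auto split: split_indicator)
  have sg: "sgn v \<in> ?S" if "v \<in> shell" for v
    using that by (auto simp: shell_def norm_sgn)
  have e: "?w v * (indicator ?S (sgn v) * \<phi> (sgn v)) = ?K * (inverse (norm v ^ ?n) * indicator shell v * \<phi> (sgn v))" for v
    using sg[of v] by (auto split: split_indicator)
  have "integrable sphere_unif \<phi> \<longleftrightarrow> integrable (distr ?D borel sgn) (\<lambda>u. indicator ?S u *\<^sub>R \<phi> u)"
    unfolding sphere_unif_eq_distr_shell by (rule integrable_restrict_space) simp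
  also have "\<dots> \<longleftrightarrow> integrable ?D (\<lambda>v. indicator ?S (sgn v) *\<^sub>R \<phi> (sgn v))"
    by (rule integrable_distr_eq) measurable
  also have "\<dots> \<longleftrightarrow> integrable lborel (\<lambda>v. ?w v *\<^sub>R (indicator ?S (sgn v) *\<^sub>R \<phi> (sgn v)))"
    by (rule integrable_density) (measurable, rule AE_I2, rule w)
  also have "\<dots> \<longleftrightarrow> integrable lborel (\<lambda>v. ?K * (inverse (norm v ^ ?n) * indicator shell v * \<phi> (sgn v)))"
    by (simp only: real_scaleR_def e)
  finally show "integrable sphere_unif \<phi> \<longleftrightarrow> integrable lborel (\<lambda>v. inverse (norm v ^ ?n) * indicator shell v * \<phi> (sgn v))"
    using K by (simp only: integrable_mult_left_iff integrable_mult_right_iff) simp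
  have "integral\<^sup>L sphere_unif \<phi> = (LINT u|distr ?D borel sgn. indicator ?S u *\<^sub>R \<phi> u)"
    unfolding sphere_unif_eq_distr_shell by (rule integral_restrict_space) simp
  also have "\<dots> = (LINT v|?D. indicator ?S (sgn v) *\<^sub>R \<phi> (sgn v))"
    by (rule integral_distr) measurable
  also have "\<dots> = (LINT v|lborel. ?w v *\<^sub>R (indicator ?S (sgn v) *\<^sub>R \<phi> (sgn v)))"
    by (rule integral_density) (measurable, rule AE_I2, rule w)
  also have "\<dots> = (LINT v|lborel. ?K * (inverse (norm v ^ ?n) * indicator shell v * \<phi> (sgn v)))"
    by (simp only: real_scaleR_def e)
  finally show "integral\<^sup>L sphere_unif \<phi> = ?K * (LINT v|lborel. inverse (norm v ^ ?n) * indicator shell v * \<phi> (sgn v))"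
    by simp
  have "(\<integral>\<^sup>+u. ennreal (\<phi> u) \<partial>sphere_unif) = (\<integral>\<^sup>+u. ennreal (\<phi> u) * indicator ?S u \<partial>distr ?D borel sgn)"
    unfolding sphere_unif_eq_distr_shell by (rule nn_integral_restrict_space) simp
  also have "\<dots> = (\<integral>\<^sup>+v. ennreal (\<phi> (sgn v)) * indicator ?S (sgn v) \<partial>?D)"
    by (rule nn_integral_distr) measurable
  also have "\<dots> = (\<integral>\<^sup>+v. ennreal (?w v) * (ennreal (\<phi> (sgn v)) * indicator ?S (sgn v)) \<partial>lborel)"
    by (rule nn_integral_density) measurable
  also have "\<dots> = (\<integral>\<^sup>+v. ennreal ?K * (ennreal (inverse (norm v ^ ?n) * indicator shell v) * ennreal (\<phi> (sgn v))) \<partial>lborel)"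
    using sg K by (intro nn_integral_cong) (auto simp: ennreal_mult mult_ac split: split_indicator)
  also have "\<dots> = ennreal ?K * (\<integral>\<^sup>+v. ennreal (inverse (norm v ^ ?n) * indicator shell v) * ennreal (\<phi> (sgn v)) \<partial>lborel)"
    by (rule nn_integral_cmult) measurable
  finally show "(\<integral>\<^sup>+u. ennreal (\<phi> u) \<partial>sphere_unif) = ennreal ?K * (\<integral>\<^sup>+v. ennreal (inverse (norm v ^ ?n) * indicator shell v) * ennreal (\<phi> (sgn v)) \<partial>lborel)" .
qed

subsection \<open>Gaussian Plancherel estimates\<close>

lemma nn_integral_lborel_reflect:
  fixes F :: "'a::euclidean_space \<Rightarrow> ennreal"
  assumes [measurable]: "F \<in> borel_measurable borel"
  shows "(\<integral>\<^sup>+y. F (x - y) \<partial>lborel) = (\<integral>\<^sup>+y. F y \<partial>lborel)"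
  by (subst (2) lborel_affine[of "-1" x]) (auto simp: nn_integral_density nn_integral_distr)

lemma nn_integral_lborel_translate:
  fixes F :: "'a::euclidean_space \<Rightarrow> ennreal"
  assumes [measurable]: "F \<in> borel_measurable borel"
  shows "(\<integral>\<^sup>+y. F (y - x) \<partial>lborel) = (\<integral>\<^sup>+y. F y \<partial>lborel)"
  by (subst (2) lborel_affine[of 1 "- x"]) (auto simp: nn_integral_density nn_integral_distr)

lemma gauss_ft_nonneg: "s > 0 \<Longrightarrow> gauss_ft s z \<ge> 0"
  by (simp add: gauss_ft_def)

lemma gauss_ft_measurable [measurable]: "gauss_ft s \<in> borel_measurable borel"
  unfolding gauss_ft_def[abs_def] by measurable

lemma gauss_ft_scaleR:
  fixes z :: "'a::euclidean_space" assumes "s > 0"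
  shows "gauss_ft s (s *\<^sub>R z) = gauss_ft 1 z / s ^ DIM('a)"
  using assms by (simp add: gauss_ft_def power_mult_distrib power_divide)

lemma integrable_bounded_support:
  fixes f :: "'a::euclidean_space \<Rightarrow> real"
  assumes bd: "\<And>x. \<bar>f x\<bar> \<le> 1" and supp: "\<And>x. norm x > \<rho> \<Longrightarrow> f x = 0" and [measurable]: "f \<in> borel_measurable borel"
  shows "integrable lborel f"
proof (rule Bochner_Integration.integrable_bound)
  show "integrable lborel (indicator (cball (0::'a) \<rho>) :: 'a \<Rightarrow> real)"
    using emeasure_lborel_cball_finite[of "0::'a" \<rho>] by simp
qed (use bd supp in \<open>auto simp: indicator_def not_le\<close>)

text \<open>The moment of order 0 is the constant of the unnormalised Fourier inversion formula and
  also the mass of the Poisson kernel; order 1 enters the smoothing error and order 2 the norm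
  estimate.\<close>

definition gauss_moment :: "'a::euclidean_space itself \<Rightarrow> nat \<Rightarrow> real" where
  "gauss_moment _ k = (\<integral>z. norm z ^ k * gauss_ft 1 (z::'a) \<partial>lborel)"

text \<open>Half of the Gaussian exponent absorbs the polynomial, since
  \<open>1 + (norm z)\<^sup>2\<close> is at most
  \<open>5 * exp ((norm z)\<^sup>2 / 4)\<close>.\<close>

lemma integrable_gauss_moment:
  assumes k: "k \<le> 2"
  shows "integrable lborel (\<lambda>z::'a::euclidean_space. norm z ^ k * gauss_ft 1 z)"
proof (rule Bochner_Integration.integrable_bound)
  let ?c = "5 * sqrt (2 * pi) ^ DIM('a)"
  have "integrable lborel (\<lambda>z::'a. complex_of_real (exp (- ((1 / sqrt 2)\<^sup>2 * (norm z)\<^sup>2 / 2))) * cis (z \<bullet> 0))"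
    by (rule integrable_gaussian_cis) simp
  also have "(\<lambda>z::'a. complex_of_real (exp (- ((1 / sqrt 2)\<^sup>2 * (norm z)\<^sup>2 / 2))) * cis (z \<bullet> 0)) = (\<lambda>z. complex_of_real (exp (- ((norm z)\<^sup>2 / 4))))"
    by (simp add: power_divide)
  finally have "integrable lborel (\<lambda>z::'a. exp (- ((norm z)\<^sup>2 / 4)))"
    by (simp only: complex_of_real_integrable_eq)
  then show "integrable lborel (\<lambda>z::'a. ?c * exp (- ((norm z)\<^sup>2 / 4)))"
    by (rule integrable_mult_right)
  show "AE z in lborel. norm (norm z ^ k * gauss_ft 1 z) \<le> norm (?c * exp (- ((norm (z::'a))\<^sup>2 / 4)))"
  proof (rule AE_I2)
    fix z :: 'a
    have "norm z ^ k \<le> 1 + (norm z)\<^sup>2"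
    proof -
      consider "k = 0" | "k = 1" | "k = 2" using k by linarith
      then show ?thesis
      proof cases
        case 2
        have "0 \<le> (norm z - 1 / 2)\<^sup>2" by simp
        then have "norm z \<le> 1 + (norm z)\<^sup>2" by (simp add: power2_diff power_divide)
        then show ?thesis using 2 by simp
      qed auto
    qed
    also have "\<dots> \<le> 5 * exp ((norm z)\<^sup>2 / 4)"
      using exp_ge_add_one_self[of "(norm z)\<^sup>2 / 4"] zero_le_power2[of "norm z"] by linarith
    finally have "norm z ^ k * exp (- ((norm z)\<^sup>2 / 2)) \<le> 5 * exp ((norm z)\<^sup>2 / 4) * exp (- ((norm z)\<^sup>2 / 2))"
      by (intro mult_right_mono) auto
    also have "\<dots> = 5 * exp (- ((norm z)\<^sup>2 / 4))"
      by (simp add: mult_exp_exp)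
    finally have "sqrt (2 * pi) ^ DIM('a) * (norm z ^ k * exp (- ((norm z)\<^sup>2 / 2))) \<le> sqrt (2 * pi) ^ DIM('a) * (5 * exp (- ((norm z)\<^sup>2 / 4)))"
      by (intro mult_left_mono) auto
    then show "norm (norm z ^ k * gauss_ft 1 z) \<le> norm (?c * exp (- ((norm z)\<^sup>2 / 4)))"
      by (simp add: gauss_ft_def abs_mult mult_ac)
  qed
qed (measurable)

lemma nn_integral_gauss_moment:
  assumes s: "s > 0" and k: "k \<le> 2"
  shows "(\<integral>\<^sup>+z. ennreal (norm z ^ k * gauss_ft s (z::'a::euclidean_space)) \<partial>lborel) = ennreal (s ^ k * gauss_moment TYPE('a) k)"
proof -
  have "(\<integral>\<^sup>+z. ennreal (norm z ^ k * gauss_ft s (z::'a)) \<partial>lborel)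
     = ennreal (s ^ DIM('a)) * (\<integral>\<^sup>+z. ennreal (norm (s *\<^sub>R z) ^ k * gauss_ft s (s *\<^sub>R z::'a)) \<partial>lborel)"
    by (rule nn_integral_lborel_scaleR[OF _ s]) measurable
  also have "\<dots> = (\<integral>\<^sup>+z. ennreal (s ^ DIM('a)) * ennreal (norm (s *\<^sub>R z) ^ k * gauss_ft s (s *\<^sub>R z::'a)) \<partial>lborel)"
    by (rule nn_integral_cmult[symmetric]) measurable
  also have "\<dots> = (\<integral>\<^sup>+z. ennreal (s ^ k) * ennreal (norm z ^ k * gauss_ft 1 (z::'a)) \<partial>lborel)"
    using s by (intro nn_integral_cong) (auto simp: ennreal_mult[symmetric] gauss_ft_nonneg gauss_ft_scaleR power_mult_distrib)
  also have "\<dots> = ennreal (s ^ k) * (\<integral>\<^sup>+z. ennreal (norm z ^ k * gauss_ft 1 (z::'a)) \<partial>lborel)"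
    by (rule nn_integral_cmult) measurable
  also have "(\<integral>\<^sup>+z. ennreal (norm z ^ k * gauss_ft 1 (z::'a)) \<partial>lborel) = ennreal (gauss_moment TYPE('a) k)"
    unfolding gauss_moment_def
    by (rule nn_integral_eq_integral[OF integrable_gauss_moment[OF k]]) (auto simp: gauss_ft_nonneg)
  finally show ?thesis using s by (simp add: ennreal_mult' )
qed

lemma gauss_moment_nonneg: "gauss_moment TYPE('a::euclidean_space) k \<ge> 0"
  unfolding gauss_moment_def by (intro integral_nonneg_AE AE_I2) (auto simp: gauss_ft_nonneg)

lemma gauss_moment_0_pos: "gauss_moment TYPE('a::euclidean_space) 0 > 0"
proof (rule ccontr)
  assume "\<not> gauss_moment TYPE('a) 0 > 0"
  then have "gauss_moment TYPE('a) 0 = 0" using gauss_moment_nonneg[of 0, where 'a='a] by linarith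
  then have "AE z in lborel. gauss_ft 1 (z::'a) = 0"
    using integrable_gauss_moment[of 0, where 'a='a] unfolding gauss_moment_def
    by (subst (asm) integral_nonneg_eq_0_iff_AE) (auto simp: gauss_ft_nonneg)
  then have "AE z in (lborel :: 'a measure). False"
    by eventually_elim (simp add: gauss_ft_def)
  then show False by (simp add: eventually_False ae_filter_eq_bot_iff)
qed

section \<open>Fourier transforms in a Gaussian-weighted square mean\<close>

lemma borel_measurable_cnj [measurable (raw)]:
  "f \<in> borel_measurable M \<Longrightarrow> (\<lambda>x. cnj (f x)) \<in> borel_measurable M"
  by (rule measurable_compose[OF _ borel_measurable_continuous_onI]) (auto intro: continuous_intros)

definition ft :: "('a::euclidean_space \<Rightarrow> complex) \<Rightarrow> 'a \<Rightarrow> complex" where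
  "ft \<phi> \<xi> = (\<integral>y. \<phi> y * cis (- (\<xi> \<bullet> y)) \<partial>lborel)"

lemma ft_measurable [measurable]:
  assumes [measurable]: "\<phi> \<in> borel_measurable borel"
  shows "ft \<phi> \<in> borel_measurable borel"
  unfolding ft_def[abs_def] by (rule lborel.borel_measurable_lebesgue_integral) measurable

lemma integrable_mult_cis:
  fixes g :: "'a \<Rightarrow> real"
  assumes "integrable M \<phi>" and [measurable]: "g \<in> borel_measurable M"
  shows "integrable M (\<lambda>y. \<phi> y * cis (g y))"
proof -
  have [measurable]: "\<phi> \<in> borel_measurable M" using assms(1) by auto
  show ?thesis
    by (rule Bochner_Integration.integrable_bound[OF integrable_norm[OF assms(1)]]) (auto simp: norm_mult)
qed

lemma integrable_pair_mult:
  fixes \<phi> :: "'a::euclidean_space \<Rightarrow> complex" and \<psi> :: "'b::euclidean_space \<Rightarrow> complex"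
  assumes "integrable lborel \<phi>" "integrable lborel \<psi>"
  shows "integrable (lborel \<Otimes>\<^sub>M lborel) (\<lambda>x. \<phi> (fst x) * \<psi> (snd x))"
proof -
  have [measurable]: "\<phi> \<in> borel_measurable borel" "\<psi> \<in> borel_measurable borel" using assms by auto
  have "(\<integral>\<^sup>+x. ennreal (norm (\<phi> (fst x) * \<psi> (snd x))) \<partial>(lborel \<Otimes>\<^sub>M lborel)) = (\<integral>\<^sup>+x. \<integral>\<^sup>+y. ennreal (norm (\<phi> x)) * ennreal (norm (\<psi> y)) \<partial>lborel \<partial>lborel)"
    by (subst lborel.nn_integral_fst[symmetric]) (auto simp: norm_mult ennreal_mult)
  also have "\<dots> = (\<integral>\<^sup>+x. ennreal (norm (\<phi> x)) \<partial>lborel) * (\<integral>\<^sup>+y. ennreal (norm (\<psi> y)) \<partial>lborel)"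
    by (simp add: nn_integral_cmult nn_integral_multc)
  also have "\<dots> < \<infinity>"
    using assms by (auto simp: integrable_iff_bounded ennreal_mult_less_top)
  finally show ?thesis by (intro integrableI_bounded) auto
qed

lemma ft_norm_square:
  assumes int: "integrable lborel \<phi>"
  shows "complex_of_real ((norm (ft \<phi> \<xi>))\<^sup>2) = (\<integral>x. \<phi> (fst x) * cnj (\<phi> (snd x)) * cis (\<xi> \<bullet> (snd x - fst x)) \<partial>(lborel \<Otimes>\<^sub>M lborel))"
proof -
  have [measurable]: "\<phi> \<in> borel_measurable borel" using int by auto
  let ?u = "\<lambda>y. \<phi> y * cis (- (\<xi> \<bullet> y))"
  have u: "integrable lborel ?u" by (rule integrable_mult_cis[OF int]) measurable
  have uc: "integrable lborel (\<lambda>y. cnj (?u y))" using u by (rule Bochner_Integration.integrable_cnj)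
  have "complex_of_real ((norm (ft \<phi> \<xi>))\<^sup>2) = ft \<phi> \<xi> * cnj (ft \<phi> \<xi>)"
    by (simp add: complex_norm_square[symmetric])
  also have "cnj (ft \<phi> \<xi>) = (\<integral>y. cnj (?u y) \<partial>lborel)"
    unfolding ft_def by (rule Bochner_Integration.integral_cnj[symmetric])
  also have "ft \<phi> \<xi> * \<dots> = (\<integral>x. ?u x * (\<integral>y. cnj (?u y) \<partial>lborel) \<partial>lborel)"
    unfolding ft_def by (rule integral_mult_left_zero[symmetric])
  also have "\<dots> = (\<integral>x. \<integral>y. ?u x * cnj (?u y) \<partial>lborel \<partial>lborel)"
    by (simp only: integral_mult_right_zero)
  also have "\<dots> = (\<integral>x. ?u (fst x) * cnj (?u (snd x)) \<partial>(lborel \<Otimes>\<^sub>M lborel))"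
    using lborel_pair.integral_fst'[OF integrable_pair_mult[OF u uc]] by simp
  also have "\<dots> = (\<integral>x. \<phi> (fst x) * cnj (\<phi> (snd x)) * cis (\<xi> \<bullet> (snd x - fst x)) \<partial>(lborel \<Otimes>\<^sub>M lborel))"
    by (intro Bochner_Integration.integral_cong) (auto simp: cis_cnj cis_mult inner_diff_right)
  finally show ?thesis .
qed

text \<open>The Gaussian weight makes the triple integral over the frequency and the two space
  variables absolutely convergent, so the frequency can be integrated out. The weighted energy of
  the transform becomes a quadratic form with a Gaussian kernel, for every integrable
  \<phi>.\<close>

lemma integral_gauss_ft_norm_square:
  fixes \<phi> :: "'a::euclidean_space \<Rightarrow> complex"
  assumes int: "integrable lborel \<phi>" and s: "s > 0"
  shows "integrable lborel (\<lambda>\<xi>. exp (- (s\<^sup>2 * (norm \<xi>)\<^sup>2 / 2)) * (norm (ft \<phi> \<xi>))\<^sup>2)"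
    and "complex_of_real (\<integral>\<xi>. exp (- (s\<^sup>2 * (norm \<xi>)\<^sup>2 / 2)) * (norm (ft \<phi> \<xi>))\<^sup>2 \<partial>lborel)
      = (\<integral>x. \<phi> (fst x) * cnj (\<phi> (snd x)) * of_real (gauss_ft s (snd x - fst x)) \<partial>(lborel \<Otimes>\<^sub>M lborel))"
proof -
  let ?P = "lborel \<Otimes>\<^sub>M lborel :: ('a \<times> 'a) measure"
  have P: "sigma_finite_measure ?P" by (simp add: lborel_prod sigma_finite_lborel)
  interpret LP: pair_sigma_finite "lborel :: 'a measure" ?P
    by (simp add: pair_sigma_finite_def lborel_prod sigma_finite_lborel)
  have [measurable]: "\<phi> \<in> borel_measurable borel" using int by auto
  let ?e = "\<lambda>\<xi>::'a. exp (- (s\<^sup>2 * (norm \<xi>)\<^sup>2 / 2))"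
  let ?h = "\<lambda>\<xi> x. of_real (?e \<xi>) * (\<phi> (fst x) * cnj (\<phi> (snd x)) * cis (\<xi> \<bullet> (snd x - fst x)))"
  have intc: "integrable lborel (\<lambda>y. cnj (\<phi> y))" using int by (rule Bochner_Integration.integrable_cnj)
  have pm: "integrable ?P (\<lambda>x. \<phi> (fst x) * cnj (\<phi> (snd x)))"
    by (rule integrable_pair_mult[OF int intc])
  have e: "integrable lborel ?e"
    using integrable_gaussian_cis[OF s, of "0::'a"] by (simp only: inner_zero_right cis_zero mult_1_right complex_of_real_integrable_eq)
  have [measurable]: "(\<lambda>(\<xi>, x). ?h \<xi> x) \<in> borel_measurable (lborel \<Otimes>\<^sub>M ?P)"
    by measurable
  have I: "integrable (lborel \<Otimes>\<^sub>M ?P) (\<lambda>(\<xi>, x). ?h \<xi> x)"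
  proof (rule integrableI_bounded)
    have "(\<integral>\<^sup>+z. ennreal (norm (case z of (\<xi>, x) \<Rightarrow> ?h \<xi> x)) \<partial>(lborel \<Otimes>\<^sub>M ?P))
       = (\<integral>\<^sup>+\<xi>. \<integral>\<^sup>+x. ennreal (?e \<xi>) * ennreal (norm (\<phi> (fst x) * cnj (\<phi> (snd x)))) \<partial>?P \<partial>lborel)"
      by (subst sigma_finite_measure.nn_integral_fst[OF P, symmetric]) (auto simp: norm_mult ennreal_mult)
    also have "\<dots> = (\<integral>\<^sup>+\<xi>. ennreal (?e \<xi>) \<partial>lborel) * (\<integral>\<^sup>+x. ennreal (norm (\<phi> (fst x) * cnj (\<phi> (snd x)))) \<partial>?P)"
      by (subst nn_integral_cmult, measurable) (subst nn_integral_multc, auto)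
    also have "\<dots> < \<infinity>"
      using pm e by (auto simp: integrable_iff_bounded ennreal_mult_less_top)
    finally show "(\<integral>\<^sup>+z. ennreal (norm (case z of (\<xi>, x) \<Rightarrow> ?h \<xi> x)) \<partial>(lborel \<Otimes>\<^sub>M ?P)) < \<infinity>" .
  qed measurable
  have eq: "(\<integral>x. ?h \<xi> x \<partial>?P) = complex_of_real (?e \<xi> * (norm (ft \<phi> \<xi>))\<^sup>2)" for \<xi>
    unfolding of_real_mult ft_norm_square[OF int] integral_mult_right_zero ..
  have "integrable lborel (\<lambda>\<xi>. complex_of_real (?e \<xi> * (norm (ft \<phi> \<xi>))\<^sup>2))"
    using LP.integrable_fst'[OF I] by (simp only: eq prod.case)
  then show "integrable lborel (\<lambda>\<xi>. ?e \<xi> * (norm (ft \<phi> \<xi>))\<^sup>2)"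
    by (simp only: complex_of_real_integrable_eq)
  have "complex_of_real (\<integral>\<xi>. ?e \<xi> * (norm (ft \<phi> \<xi>))\<^sup>2 \<partial>lborel) = (\<integral>\<xi>. \<integral>x. ?h \<xi> x \<partial>?P \<partial>lborel)"
    unfolding eq integral_complex_of_real ..
  also have "\<dots> = (\<integral>x. \<integral>\<xi>. ?h \<xi> x \<partial>lborel \<partial>?P)"
    by (rule LP.Fubini_integral[OF I, symmetric])
  also have "\<dots> = (\<integral>x. \<phi> (fst x) * cnj (\<phi> (snd x)) * of_real (gauss_ft s (snd x - fst x)) \<partial>?P)"
  proof (intro Bochner_Integration.integral_cong refl)
    fix x
    have "(\<integral>\<xi>. ?h \<xi> x \<partial>lborel) = (\<integral>\<xi>. (\<phi> (fst x) * cnj (\<phi> (snd x))) * (of_real (?e \<xi>) * cis (\<xi> \<bullet> (snd x - fst x))) \<partial>lborel)"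
      by (simp only: mult_ac)
    also have "\<dots> = \<phi> (fst x) * cnj (\<phi> (snd x)) * of_real (gauss_ft s (snd x - fst x))"
      unfolding integral_mult_right_zero integral_gaussian_cis[OF s] ..
    finally show "(\<integral>\<xi>. ?h \<xi> x \<partial>lborel) = \<phi> (fst x) * cnj (\<phi> (snd x)) * of_real (gauss_ft s (snd x - fst x))" .
  qed
  finally show "complex_of_real (\<integral>\<xi>. ?e \<xi> * (norm (ft \<phi> \<xi>))\<^sup>2 \<partial>lborel)
      = (\<integral>x. \<phi> (fst x) * cnj (\<phi> (snd x)) * of_real (gauss_ft s (snd x - fst x)) \<partial>?P)" .
qed

text \<open>The two marginals of the kernel, as needed for Schur's test: the kernel depends only on
  the difference, so translation or reflection of the inner variable leaves a moment that is
  independent of the outer one. Order 0 is used for boundedness and order 2 for Lipschitz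
  functions.\<close>

lemma
  fixes h :: "'a::euclidean_space \<Rightarrow> ennreal"
  assumes [measurable]: "h \<in> borel_measurable borel" and s: "s > 0" and k: "k \<le> 2"
  shows nn_integral_fst_gauss: "(\<integral>\<^sup>+x. h (fst x) * ennreal (norm (snd x - fst x) ^ k * gauss_ft s (snd x - fst x)) \<partial>(lborel \<Otimes>\<^sub>M lborel))
      = (\<integral>\<^sup>+x. h x \<partial>lborel) * ennreal (s ^ k * gauss_moment TYPE('a) k)"
    and nn_integral_snd_gauss: "(\<integral>\<^sup>+x. h (snd x) * ennreal (norm (snd x - fst x) ^ k * gauss_ft s (snd x - fst x)) \<partial>(lborel \<Otimes>\<^sub>M lborel))
      = (\<integral>\<^sup>+x. h x \<partial>lborel) * ennreal (s ^ k * gauss_moment TYPE('a) k)"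
proof -
  let ?g = "\<lambda>z::'a. ennreal (norm z ^ k * gauss_ft s z)"
  have "(\<integral>\<^sup>+x. h (fst x) * ?g (snd x - fst x) \<partial>(lborel \<Otimes>\<^sub>M lborel)) = (\<integral>\<^sup>+x. \<integral>\<^sup>+y. h x * ?g (y - x) \<partial>lborel \<partial>lborel)"
    by (subst lborel.nn_integral_fst[symmetric]) auto
  also have "\<dots> = (\<integral>\<^sup>+x. h x * (\<integral>\<^sup>+y. ?g (y - x) \<partial>lborel) \<partial>lborel)"
    by (intro nn_integral_cong nn_integral_cmult) measurable
  also have "\<dots> = (\<integral>\<^sup>+x. h x * (\<integral>\<^sup>+y. ?g y \<partial>lborel) \<partial>lborel)"
    by (subst nn_integral_lborel_translate) auto
  also have "\<dots> = (\<integral>\<^sup>+x. h x \<partial>lborel) * ennreal (s ^ k * gauss_moment TYPE('a) k)"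
    by (subst nn_integral_multc) (auto simp: nn_integral_gauss_moment[OF s k])
  finally show "(\<integral>\<^sup>+x. h (fst x) * ?g (snd x - fst x) \<partial>(lborel \<Otimes>\<^sub>M lborel)) = (\<integral>\<^sup>+x. h x \<partial>lborel) * ennreal (s ^ k * gauss_moment TYPE('a) k)" .
  have "(\<integral>\<^sup>+x. h (snd x) * ?g (snd x - fst x) \<partial>(lborel \<Otimes>\<^sub>M lborel)) = (\<integral>\<^sup>+y. \<integral>\<^sup>+x. h y * ?g (y - x) \<partial>lborel \<partial>lborel)"
    by (subst lborel_pair.nn_integral_snd[symmetric]) auto
  also have "\<dots> = (\<integral>\<^sup>+y. h y * (\<integral>\<^sup>+x. ?g (y - x) \<partial>lborel) \<partial>lborel)"
    by (intro nn_integral_cong nn_integral_cmult) measurable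
  also have "\<dots> = (\<integral>\<^sup>+y. h y * (\<integral>\<^sup>+x. ?g x \<partial>lborel) \<partial>lborel)"
    by (subst nn_integral_lborel_reflect) auto
  also have "\<dots> = (\<integral>\<^sup>+x. h x \<partial>lborel) * ennreal (s ^ k * gauss_moment TYPE('a) k)"
    by (subst nn_integral_multc) (auto simp: nn_integral_gauss_moment[OF s k])
  finally show "(\<integral>\<^sup>+x. h (snd x) * ?g (snd x - fst x) \<partial>(lborel \<Otimes>\<^sub>M lborel)) = (\<integral>\<^sup>+x. h x \<partial>lborel) * ennreal (s ^ k * gauss_moment TYPE('a) k)" .
qed

lemma norm_integral_le_nn_integral:
  fixes f :: "'a \<Rightarrow> 'b::{banach,second_countable_topology}"
  shows "ennreal (norm (integral\<^sup>L M f)) \<le> (\<integral>\<^sup>+x. ennreal (norm (f x)) \<partial>M)"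
  by (cases "integrable M f") (auto simp: integral_norm_bound_ennreal not_integrable_integral_eq)

text \<open>Schur's test with the Gaussian kernel replaces Plancherel's theorem.\<close>

lemma nn_integral_gauss_ft_norm_square_le:
  fixes \<phi> :: "'a::euclidean_space \<Rightarrow> complex"
  assumes int: "integrable lborel \<phi>" and s: "s > 0"
  shows "(\<integral>\<^sup>+\<xi>. ennreal (exp (- (s\<^sup>2 * (norm \<xi>)\<^sup>2 / 2)) * (norm (ft \<phi> \<xi>))\<^sup>2) \<partial>lborel)
     \<le> ennreal (gauss_moment TYPE('a) 0) * (\<integral>\<^sup>+y. ennreal ((norm (\<phi> y))\<^sup>2) \<partial>lborel)"
proof -
  have [measurable]: "\<phi> \<in> borel_measurable borel" using int by auto
  let ?I = "\<integral>\<xi>. exp (- (s\<^sup>2 * (norm \<xi>)\<^sup>2 / 2)) * (norm (ft \<phi> \<xi>))\<^sup>2 \<partial>lborel"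
  let ?P = "lborel \<Otimes>\<^sub>M lborel :: ('a \<times> 'a) measure"
  let ?g = "\<lambda>x::'a \<times> 'a. gauss_ft s (snd x - fst x)"
  let ?h = "\<lambda>y. ennreal ((norm (\<phi> y))\<^sup>2 / 2)"
  have "?I \<ge> 0" by (intro integral_nonneg_AE AE_I2) auto
  then have "ennreal ?I = ennreal (norm (complex_of_real ?I))" by simp
  also have "\<dots> \<le> (\<integral>\<^sup>+x. ennreal (norm (\<phi> (fst x) * cnj (\<phi> (snd x)) * of_real (?g x))) \<partial>?P)"
    unfolding integral_gauss_ft_norm_square(2)[OF int s] by (rule norm_integral_le_nn_integral)
  also have "\<dots> \<le> (\<integral>\<^sup>+x. ?h (fst x) * ennreal (norm (snd x - fst x) ^ 0 * ?g x) + ?h (snd x) * ennreal (norm (snd x - fst x) ^ 0 * ?g x) \<partial>?P)"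
  proof (rule nn_integral_mono)
    fix x
    \<comment> \<open>After this splitting each summand depends on one variable apart from the
      kernel, so the kernel can be integrated in the other.\<close>
    have "norm (\<phi> (fst x)) * norm (\<phi> (snd x)) \<le> (norm (\<phi> (fst x)))\<^sup>2 / 2 + (norm (\<phi> (snd x)))\<^sup>2 / 2"
      using zero_le_power2[of "norm (\<phi> (fst x)) - norm (\<phi> (snd x))"] by (simp add: power2_diff field_simps)
    then have "norm (\<phi> (fst x) * cnj (\<phi> (snd x)) * of_real (?g x)) \<le> (norm (\<phi> (fst x)))\<^sup>2 / 2 * ?g x + (norm (\<phi> (snd x)))\<^sup>2 / 2 * ?g x"
      using mult_right_mono[OF _ gauss_ft_nonneg[OF s, of "snd x - fst x"], of "norm (\<phi> (fst x)) * norm (\<phi> (snd x))"] gauss_ft_nonneg[OF s, of "snd x - fst x"]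
      unfolding distrib_right[symmetric] by (simp add: norm_mult)
    then show "ennreal (norm (\<phi> (fst x) * cnj (\<phi> (snd x)) * of_real (?g x))) \<le> ?h (fst x) * ennreal (norm (snd x - fst x) ^ 0 * ?g x) + ?h (snd x) * ennreal (norm (snd x - fst x) ^ 0 * ?g x)"
      using gauss_ft_nonneg[OF s, of "snd x - fst x"] by (simp add: ennreal_mult[symmetric] ennreal_plus[symmetric] ennreal_leI del: ennreal_plus)
  qed
  also have "\<dots> = (\<integral>\<^sup>+y. ?h y \<partial>lborel) * ennreal (s ^ 0 * gauss_moment TYPE('a) 0) + (\<integral>\<^sup>+y. ?h y \<partial>lborel) * ennreal (s ^ 0 * gauss_moment TYPE('a) 0)"
    by (subst nn_integral_add, measurable) (subst nn_integral_fst_gauss, measurable, rule s, simp, subst nn_integral_snd_gauss, measurable, rule s, simp, rule refl)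
  also have "\<dots> = ennreal (gauss_moment TYPE('a) 0) * (\<integral>\<^sup>+y. ?h y + ?h y \<partial>lborel)"
    by (subst nn_integral_add) (auto simp: distrib_left mult.commute)
  also have "(\<lambda>y. ?h y + ?h y) = (\<lambda>y. ennreal ((norm (\<phi> y))\<^sup>2))"
    by (auto simp: ennreal_plus[symmetric] simp del: ennreal_plus)
  finally show ?thesis
    using integral_gauss_ft_norm_square(1)[OF int s] by (subst nn_integral_eq_integral) auto
qed

text \<open>The quantity \<open>D\<close> is what the Gaussian weight removes from the energy of the
  transform. Polarisation writes it as half the integral of \<open>(f x - f y)\<^sup>2\<close>
  against the Gaussian kernel, which shows its sign; the Lipschitz bound replaces the square by
  \<open>L\<^sup>2\<close> times the squared distance, and the second moment supplies
  \<open>s\<^sup>2\<close>. This expresses in the square mean that \<open>f\<close> has one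
  derivative.\<close>

lemma gauss_ft_norm_square_deficit:
  fixes f :: "'a::euclidean_space \<Rightarrow> real"
  assumes lip: "\<And>x y. \<bar>f x - f y\<bar> \<le> L * norm (x - y)"
    and bd: "\<And>x. \<bar>f x\<bar> \<le> 1" and supp: "\<And>x. norm x > \<rho> \<Longrightarrow> f x = 0"
    and [measurable]: "f \<in> borel_measurable borel" and s: "s > 0" and L: "L \<ge> 0"
  defines "D \<equiv> gauss_moment TYPE('a) 0 * (\<integral>x. (f x)\<^sup>2 \<partial>lborel) - (\<integral>\<xi>. exp (- (s\<^sup>2 * (norm \<xi>)\<^sup>2 / 2)) * (norm (ft (\<lambda>x. of_real (f x)) \<xi>))\<^sup>2 \<partial>lborel)"
  shows "0 \<le> D" and "D \<le> L\<^sup>2 * measure lborel (cball (0::'a) \<rho>) * gauss_moment TYPE('a) 2 * s\<^sup>2"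
proof -
  let ?B = "cball (0::'a) \<rho>" and ?P = "lborel \<Otimes>\<^sub>M lborel :: ('a \<times> 'a) measure"
  let ?g = "\<lambda>x::'a \<times> 'a. gauss_ft s (snd x - fst x)"
  have g: "?g x \<ge> 0" for x by (rule gauss_ft_nonneg[OF s])
  have ball: "emeasure lborel ?B < \<infinity>" by (rule emeasure_lborel_cball_finite)
  have [measurable]: "?B \<in> sets borel" by simp
  have f1: "integrable lborel f"
    by (rule integrable_bounded_support[of f \<rho>]) (use bd supp in auto)
  have ff: "(f x)\<^sup>2 \<le> \<bar>f x\<bar>" for x
    using mult_right_mono[OF bd[of x], of "\<bar>f x\<bar>"] by (simp add: power2_eq_square)
  have f2: "integrable lborel (\<lambda>x. (f x)\<^sup>2)"
    by (rule Bochner_Integration.integrable_bound[OF f1]) (use ff in auto)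
  have fc: "integrable lborel (\<lambda>x. complex_of_real (f x))" using f1 by simp
  have n2: "(\<integral>\<^sup>+x. ennreal ((f x)\<^sup>2) \<partial>lborel) = ennreal (\<integral>x. (f x)\<^sup>2 \<partial>lborel)"
    by (rule nn_integral_eq_integral[OF f2]) auto
  have F0: "0 \<le> (\<integral>x. (f x)\<^sup>2 \<partial>lborel)" by (intro integral_nonneg_AE AE_I2) auto
  have hb: "has_bochner_integral ?P (\<lambda>x. (f (fst x))\<^sup>2 * ?g x) (gauss_moment TYPE('a) 0 * (\<integral>x. (f x)\<^sup>2 \<partial>lborel))"
    "has_bochner_integral ?P (\<lambda>x. (f (snd x))\<^sup>2 * ?g x) (gauss_moment TYPE('a) 0 * (\<integral>x. (f x)\<^sup>2 \<partial>lborel))"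
    using nn_integral_fst_gauss[of "\<lambda>x. ennreal ((f x)\<^sup>2)" s 0] nn_integral_snd_gauss[of "\<lambda>x. ennreal ((f x)\<^sup>2)" s 0] s g F0 gauss_moment_nonneg[of 0, where 'a='a]
    by (auto intro!: has_bochner_integral_nn_integral simp: n2 ennreal_mult[symmetric] mult.commute)
  have i3: "integrable ?P (\<lambda>x. f (fst x) * f (snd x) * ?g x)"
  proof (rule Bochner_Integration.integrable_bound[OF Bochner_Integration.integrable_add[OF hb(1)[THEN integrable.intros] hb(2)[THEN integrable.intros]]])
    show "AE x in ?P. norm (f (fst x) * f (snd x) * ?g x) \<le> norm ((f (fst x))\<^sup>2 * ?g x + (f (snd x))\<^sup>2 * ?g x)"
    proof (rule AE_I2)
      fix x
      have "\<bar>f (fst x) * f (snd x)\<bar> \<le> (f (fst x))\<^sup>2 + (f (snd x))\<^sup>2"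
        using zero_le_power2[of "\<bar>f (fst x)\<bar> - \<bar>f (snd x)\<bar>"] zero_le_power2[of "f (fst x)"] zero_le_power2[of "f (snd x)"]
        unfolding power2_diff abs_mult power2_abs by linarith
      then show "norm (f (fst x) * f (snd x) * ?g x) \<le> norm ((f (fst x))\<^sup>2 * ?g x + (f (snd x))\<^sup>2 * ?g x)"
        using mult_right_mono[OF _ g[of x]] g[of x] by (simp add: abs_mult distrib_right[symmetric])
    qed
  qed measurable
  have "(\<integral>\<xi>. exp (- (s\<^sup>2 * (norm \<xi>)\<^sup>2 / 2)) * (norm (ft (\<lambda>x. of_real (f x)) \<xi>))\<^sup>2 \<partial>lborel) = (\<integral>x. f (fst x) * f (snd x) * ?g x \<partial>?P)"
    using integral_gauss_ft_norm_square(2)[OF fc s]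
    by (simp only: complex_cnj_complex_of_real of_real_mult[symmetric] integral_complex_of_real of_real_eq_iff)
  then have "has_bochner_integral ?P (\<lambda>x. ((f (fst x))\<^sup>2 * ?g x + (f (snd x))\<^sup>2 * ?g x - 2 * (f (fst x) * f (snd x) * ?g x)) / 2)
     ((gauss_moment TYPE('a) 0 * (\<integral>x. (f x)\<^sup>2 \<partial>lborel) + gauss_moment TYPE('a) 0 * (\<integral>x. (f x)\<^sup>2 \<partial>lborel) - 2 * (\<integral>\<xi>. exp (- (s\<^sup>2 * (norm \<xi>)\<^sup>2 / 2)) * (norm (ft (\<lambda>x. of_real (f x)) \<xi>))\<^sup>2 \<partial>lborel)) / 2)"
    by (simp only:) (intro has_bochner_integral_divide_zero has_bochner_integral_diff has_bochner_integral_add hb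
      has_bochner_integral_mult_right has_bochner_integral_integrable i3)
  moreover have "((f (fst x))\<^sup>2 * ?g x + (f (snd x))\<^sup>2 * ?g x - 2 * (f (fst x) * f (snd x) * ?g x)) / 2 = (f (fst x) - f (snd x))\<^sup>2 / 2 * ?g x" for x
    by (simp add: power2_diff algebra_simps)
  moreover have "(gauss_moment TYPE('a) 0 * (\<integral>x. (f x)\<^sup>2 \<partial>lborel) + gauss_moment TYPE('a) 0 * (\<integral>x. (f x)\<^sup>2 \<partial>lborel) - 2 * (\<integral>\<xi>. exp (- (s\<^sup>2 * (norm \<xi>)\<^sup>2 / 2)) * (norm (ft (\<lambda>x. of_real (f x)) \<xi>))\<^sup>2 \<partial>lborel)) / 2 = D"
    unfolding D_def by simp
  ultimately have D: "has_bochner_integral ?P (\<lambda>x. (f (fst x) - f (snd x))\<^sup>2 / 2 * ?g x) D"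
    by (simp only:)
  then have D': "D = (\<integral>x. (f (fst x) - f (snd x))\<^sup>2 / 2 * ?g x \<partial>?P)" "integrable ?P (\<lambda>x. (f (fst x) - f (snd x))\<^sup>2 / 2 * ?g x)"
    by (auto simp: has_bochner_integral_iff)
  show "0 \<le> D" unfolding D' by (intro integral_nonneg_AE AE_I2) (use g in auto)
  \<comment> \<open>The integrand vanishes unless one of the two points lies in the ball, so the
    indicators of both cases are added; the two halves restore \<open>L\<^sup>2\<close>.\<close>
  let ?h = "\<lambda>x::'a. ennreal (L\<^sup>2 / 2) * indicator ?B x"
  have "ennreal D = (\<integral>\<^sup>+x. ennreal ((f (fst x) - f (snd x))\<^sup>2 / 2 * ?g x) \<partial>?P)"
    unfolding D'(1) by (rule nn_integral_eq_integral[symmetric, OF D'(2)]) (use g in auto)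
  also have "\<dots> \<le> (\<integral>\<^sup>+x. ?h (fst x) * ennreal (norm (snd x - fst x) ^ 2 * ?g x) + ?h (snd x) * ennreal (norm (snd x - fst x) ^ 2 * ?g x) \<partial>?P)"
  proof (rule nn_integral_mono)
    fix x
    have "(f (fst x) - f (snd x))\<^sup>2 \<le> (L * norm (snd x - fst x))\<^sup>2"
      using lip[of "fst x" "snd x"] L by (intro abs_le_square_iff[THEN iffD1]) (simp add: norm_minus_commute)
    then have 1: "(f (fst x) - f (snd x))\<^sup>2 / 2 * ?g x \<le> L\<^sup>2 / 2 * (norm (snd x - fst x) ^ 2 * ?g x)"
      using mult_right_mono[OF _ g[of x], of "(f (fst x) - f (snd x))\<^sup>2" "(L * norm (snd x - fst x))\<^sup>2"] by (simp add: power_mult_distrib mult.assoc)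
    show "ennreal ((f (fst x) - f (snd x))\<^sup>2 / 2 * ?g x) \<le> ?h (fst x) * ennreal (norm (snd x - fst x) ^ 2 * ?g x) + ?h (snd x) * ennreal (norm (snd x - fst x) ^ 2 * ?g x)"
    proof (cases "fst x \<in> ?B \<or> snd x \<in> ?B")
      case True
      have "ennreal ((f (fst x) - f (snd x))\<^sup>2 / 2 * ?g x) \<le> ennreal (L\<^sup>2 / 2) * ennreal (norm (snd x - fst x) ^ 2 * ?g x)"
        using ennreal_leI[OF 1] by (subst (asm) (2) ennreal_mult) (use g[of x] in auto)
      also have "\<dots> \<le> ?h (fst x) * ennreal (norm (snd x - fst x) ^ 2 * ?g x) + ?h (snd x) * ennreal (norm (snd x - fst x) ^ 2 * ?g x)"
        using True by (auto simp: indicator_def)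
      finally show ?thesis .
    next
      case False
      then have "f (fst x) = 0" "f (snd x) = 0" using supp[of "fst x"] supp[of "snd x"] by auto
      then show ?thesis by simp
    qed
  qed
  also have "\<dots> = (\<integral>\<^sup>+x. ?h x \<partial>lborel) * ennreal (s ^ 2 * gauss_moment TYPE('a) 2) + (\<integral>\<^sup>+x. ?h x \<partial>lborel) * ennreal (s ^ 2 * gauss_moment TYPE('a) 2)"
    by (subst nn_integral_add, measurable) (subst nn_integral_fst_gauss, measurable, rule s, simp, subst nn_integral_snd_gauss, measurable, rule s, simp, rule refl)
  also have "(\<integral>\<^sup>+x. ?h x \<partial>lborel) = ennreal (L\<^sup>2 / 2) * ennreal (measure lborel ?B)"
    using ball by (subst nn_integral_cmult) (auto simp: emeasure_eq_ennreal_measure)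
  finally have "ennreal D \<le> ennreal (L\<^sup>2 / 2 * measure lborel ?B * (s ^ 2 * gauss_moment TYPE('a) 2) + L\<^sup>2 / 2 * measure lborel ?B * (s ^ 2 * gauss_moment TYPE('a) 2))"
    using gauss_moment_nonneg[of 2, where 'a='a] by (simp add: ennreal_mult[symmetric] ennreal_plus[symmetric] del: ennreal_plus)
  then show "D \<le> L\<^sup>2 * measure lborel ?B * gauss_moment TYPE('a) 2 * s\<^sup>2"
    using gauss_moment_nonneg[of 2, where 'a='a] by (subst (asm) ennreal_le_iff) (auto simp: field_simps)
qed

lemma power_le_fact_exp:
  fixes a :: real assumes "a \<ge> 0"
  shows "a ^ n \<le> fact n * exp a"
proof -
  have "(\<Sum>k\<in>{n}. a ^ k /\<^sub>R fact k) \<le> (\<Sum>k. a ^ k /\<^sub>R fact k)"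
    using assms by (intro sum_le_suminf summable_exp_generic) auto
  then have "a ^ n / fact n \<le> exp a" by (simp add: exp_def divide_inverse mult.commute)
  then show ?thesis by (simp add: field_simps)
qed

text \<open>Near 0 both sides are governed by \<open>a\<^sup>2\<close>: here
  \<open>M \<ge> 2\<close> enters, and \<open>1 - exp (- x) \<ge> x / 2\<close> at
  \<open>x = a\<^sup>2 / 2\<close> gives the factor 4. Beyond 1 the left side is at most
  \<open>fact M\<close>, by comparison with one term of the exponential series, while the factor
  next to it on the right stays above 1. This trades the weight of the density norm for the one in
  the Gaussian deficit.\<close>

lemma power_exp_le_gauss:
  fixes a :: real assumes a: "a \<ge> 0" and M: "M \<ge> 2"
  shows "a ^ M * exp (- (2 * a)) \<le> 4 * fact M * (1 - exp (- (a\<^sup>2 / 2)))"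
proof (cases "a \<le> 1")
  case True
  define x where "x = a\<^sup>2 / 2"
  have x: "0 \<le> x" "x \<le> 1" by (use power_le_one[OF a True, of 2] in \<open>auto simp: x_def\<close>)
  have "exp (- x) \<le> 1 / (1 + x)"
    using exp_ge_add_one_self[of x] x by (auto simp: exp_minus inverse_eq_divide intro!: divide_left_mono mult_pos_pos)
  also have "\<dots> \<le> 1 - x / 2"
  proof -
    have "1 \<le> (1 - x / 2) * (1 + x)" using mult_nonneg_nonneg[of x "1 - x"] x by (simp add: algebra_simps)
    then show ?thesis using x by (simp add: pos_divide_le_eq)
  qed
  finally have 1: "x / 2 \<le> 1 - exp (- x)" by simp
  have "a ^ M * exp (- (2 * a)) \<le> a ^ 2 * 1"
    using a True M by (intro mult_mono power_decreasing) auto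
  also have "\<dots> \<le> 4 * (1 - exp (- x))" using 1 by (simp add: x_def)
  also have "\<dots> \<le> 4 * fact M * (1 - exp (- x))"
    using x mult_right_mono[OF fact_ge_1[of M, where 'a=real], of "1 - exp (- x)"] by simp
  finally show ?thesis by (simp add: x_def)
next
  case False
  have "a ^ M * exp (- (2 * a)) \<le> fact M * exp a * exp (- (2 * a))"
    by (intro mult_right_mono power_le_fact_exp a) auto
  also have "\<dots> = fact M * exp (- a)" by (simp add: mult_exp_exp)
  also have "\<dots> \<le> fact M * 1" using a by (intro mult_left_mono) auto
  also have "\<dots> \<le> fact M * (4 * (1 - exp (- (a\<^sup>2 / 2))))"
  proof (intro mult_left_mono)
    have "1 \<le> a\<^sup>2" using False one_le_power[of a 2] by simp
    then have "exp (- (a\<^sup>2 / 2)) \<le> exp (- (1 / 2))" by simp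
    also have "\<dots> \<le> 1 / (1 + 1 / 2)"
      using exp_ge_add_one_self[of "1/2::real"] by (simp add: exp_minus inverse_eq_divide pos_divide_le_eq)
    finally show "1 \<le> 4 * (1 - exp (- (a\<^sup>2 / 2)))" by simp
  qed simp
  finally show ?thesis by (simp only: mult_ac)
qed

text \<open>By Plancherel the left side would be the deficit at \<epsilon>. To work with Gaussian
  weights only, an additional weight of width \<open>k n\<close> is inserted and removed by monotone
  convergence.\<close>

lemma nn_integral_ft_smoothed:
  fixes f :: "'a::euclidean_space \<Rightarrow> real"
  assumes lip: "\<And>x y. \<bar>f x - f y\<bar> \<le> L * norm (x - y)"
    and bd: "\<And>x. \<bar>f x\<bar> \<le> 1" and supp: "\<And>x. norm x > \<rho> \<Longrightarrow> f x = 0"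
    and fm[measurable]: "f \<in> borel_measurable borel" and \<epsilon>: "\<epsilon> > 0" and L: "L \<ge> 0"
  shows "(\<integral>\<^sup>+\<xi>. ennreal ((1 - exp (- (\<epsilon>\<^sup>2 * (norm \<xi>)\<^sup>2 / 2))) * (norm (ft (\<lambda>x. of_real (f x)) \<xi>))\<^sup>2) \<partial>lborel)
     \<le> ennreal (L\<^sup>2 * measure lborel (cball (0::'a) \<rho>) * gauss_moment TYPE('a) 2 * \<epsilon>\<^sup>2)"
proof -
  let ?C = "L\<^sup>2 * measure lborel (cball (0::'a) \<rho>) * gauss_moment TYPE('a) 2"
  have C: "?C \<ge> 0" using gauss_moment_nonneg[of 2, where 'a='a] by simp
  let ?F = "\<lambda>\<xi>. (norm (ft (\<lambda>x. complex_of_real (f x)) \<xi>))\<^sup>2"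
  have "integrable lborel f"
    by (rule integrable_bounded_support[of f \<rho>]) (use bd supp in auto)
  then have fc: "integrable lborel (\<lambda>x. complex_of_real (f x))" by simp
  define k where "k n = 1 / real (Suc n)" for n
  have k: "k n > 0" for n by (simp add: k_def)
  define h where "h n \<xi> = exp (- ((k n)\<^sup>2 * (norm \<xi>)\<^sup>2 / 2)) * (1 - exp (- (\<epsilon>\<^sup>2 * (norm \<xi>)\<^sup>2 / 2))) * ?F \<xi>" for n and \<xi> :: 'a
  have h0: "0 \<le> h n \<xi>" for n \<xi> unfolding h_def by simp
  have [measurable]: "h n \<in> borel_measurable borel" for n unfolding h_def by measurable
  have "(\<integral>\<^sup>+\<xi>. ennreal (h n \<xi>) \<partial>lborel) \<le> ennreal (?C * ((k n)\<^sup>2 + \<epsilon>\<^sup>2))" for n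
  proof -
    \<comment> \<open>Chosen so that the product of the Gaussian weights for \<open>k n\<close> and
      \<epsilon> is the one for \<open>s\<close>; thus \<open>h n\<close> is a difference of two
      weighted energies.\<close>
    define s where "s = sqrt ((k n)\<^sup>2 + \<epsilon>\<^sup>2)"
    have s: "s > 0" "s\<^sup>2 = (k n)\<^sup>2 + \<epsilon>\<^sup>2" using \<epsilon> by (auto simp: s_def add_pos_pos add_nonneg_pos)
    let ?E = "\<lambda>s. \<integral>\<xi>. exp (- (s\<^sup>2 * (norm \<xi>)\<^sup>2 / 2)) * ?F \<xi> \<partial>lborel"
    have h: "h n \<xi> = exp (- ((k n)\<^sup>2 * (norm \<xi>)\<^sup>2 / 2)) * ?F \<xi> - exp (- (s\<^sup>2 * (norm \<xi>)\<^sup>2 / 2)) * ?F \<xi>" for \<xi>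
    proof -
      have "exp (- (s\<^sup>2 * (norm \<xi>)\<^sup>2 / 2)) = exp (- ((k n)\<^sup>2 * (norm \<xi>)\<^sup>2 / 2)) * exp (- (\<epsilon>\<^sup>2 * (norm \<xi>)\<^sup>2 / 2))"
        unfolding s by (simp add: mult_exp_exp distrib_right add_divide_distrib)
      then show ?thesis unfolding h_def by (simp only: right_diff_distrib left_diff_distrib mult_1_right)
    qed
    have hi: "has_bochner_integral lborel (h n) (?E (k n) - ?E s)"
      unfolding h by (intro has_bochner_integral_diff has_bochner_integral_integrable integral_gauss_ft_norm_square(1) fc k s)
    have "(\<integral>\<^sup>+\<xi>. ennreal (h n \<xi>) \<partial>lborel) = ennreal (?E (k n) - ?E s)"
      using hi h0 by (subst nn_integral_eq_integral) (auto simp: has_bochner_integral_iff)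
    also have "\<dots> \<le> ennreal (?C * ((k n)\<^sup>2 + \<epsilon>\<^sup>2))"
    proof (rule ennreal_leI)
      \<comment> \<open>The difference of the energies is the deficit at \<open>s\<close> minus the
        deficit at \<open>k n\<close>; the former is bounded above and the latter is
        nonnegative.\<close>
      show "?E (k n) - ?E s \<le> ?C * ((k n)\<^sup>2 + \<epsilon>\<^sup>2)"
        using gauss_ft_norm_square_deficit(1)[where \<rho>=\<rho>, OF lip bd supp fm k[of n] L]
          gauss_ft_norm_square_deficit(2)[where \<rho>=\<rho>, OF lip bd supp fm s(1) L] unfolding s(2) by linarith
    qed
    finally show ?thesis .
  qed
  moreover have "(\<lambda>n. \<integral>\<^sup>+\<xi>. ennreal (h n \<xi>) \<partial>lborel) \<longlonglongrightarrow> (\<integral>\<^sup>+\<xi>. ennreal ((1 - exp (- (\<epsilon>\<^sup>2 * (norm \<xi>)\<^sup>2 / 2))) * ?F \<xi>) \<partial>lborel)"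
  proof (rule nn_integral_LIMSEQ)
    show "incseq (\<lambda>n \<xi>. ennreal (h n \<xi>))"
    proof (intro incseq_SucI le_funI ennreal_leI)
      fix n and \<xi> :: 'a
      have "k (Suc n) \<le> k n" unfolding k_def by (intro divide_left_mono) auto
      then have "(k (Suc n))\<^sup>2 \<le> (k n)\<^sup>2" using k[of "Suc n"] by (intro power_mono) auto
      then show "h n \<xi> \<le> h (Suc n) \<xi>" unfolding h_def
        by (intro mult_right_mono) (auto intro!: mult_right_mono divide_right_mono)
    qed
    show "(\<lambda>n. ennreal (h n \<xi>)) \<longlonglongrightarrow> ennreal ((1 - exp (- (\<epsilon>\<^sup>2 * (norm \<xi>)\<^sup>2 / 2))) * ?F \<xi>)" for \<xi>
    proof (rule tendsto_ennrealI)
      have "k \<longlonglongrightarrow> 0" unfolding k_def by (rule LIMSEQ_Suc[OF lim_1_over_n])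
      then have "(\<lambda>n. h n \<xi>) \<longlonglongrightarrow> exp (- (0\<^sup>2 * (norm \<xi>)\<^sup>2 / 2)) * (1 - exp (- (\<epsilon>\<^sup>2 * (norm \<xi>)\<^sup>2 / 2))) * ?F \<xi>"
        unfolding h_def by (intro tendsto_intros) auto
      then show "(\<lambda>n. h n \<xi>) \<longlonglongrightarrow> (1 - exp (- (\<epsilon>\<^sup>2 * (norm \<xi>)\<^sup>2 / 2))) * ?F \<xi>" by simp
    qed
  qed (auto)
  moreover have "(\<lambda>n. ennreal (?C * ((k n)\<^sup>2 + \<epsilon>\<^sup>2))) \<longlonglongrightarrow> ennreal (?C * \<epsilon>\<^sup>2)"
  proof (rule tendsto_ennrealI)
    have "k \<longlonglongrightarrow> 0" unfolding k_def by (rule LIMSEQ_Suc[OF lim_1_over_n])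
    then have "(\<lambda>n. ?C * ((k n)\<^sup>2 + \<epsilon>\<^sup>2)) \<longlonglongrightarrow> ?C * (0\<^sup>2 + \<epsilon>\<^sup>2)" by (intro tendsto_intros)
    then show "(\<lambda>n. ?C * ((k n)\<^sup>2 + \<epsilon>\<^sup>2)) \<longlonglongrightarrow> ?C * \<epsilon>\<^sup>2" by simp
  qed
  ultimately show ?thesis by (intro LIMSEQ_le) auto
qed

text \<open>The pointwise comparison at \<open>a = \<epsilon> * norm \<xi>\<close>, integrated. With
  \<open>M = d + 2 * \<alpha> + 1\<close> the resulting power
  \<open>\<epsilon>\<^sup>2 / \<epsilon> ^ M\<close> is \<epsilon> to the exponent
  \<open>- 2 s\<close>.\<close>

lemma nn_integral_ft_weighted:
  fixes f :: "'a::euclidean_space \<Rightarrow> real"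
  assumes lip: "\<And>x y. \<bar>f x - f y\<bar> \<le> L * norm (x - y)"
    and bd: "\<And>x. \<bar>f x\<bar> \<le> 1" and supp: "\<And>x. norm x > \<rho> \<Longrightarrow> f x = 0"
    and fm[measurable]: "f \<in> borel_measurable borel" and \<epsilon>: "\<epsilon> > 0" and L: "L \<ge> 0" and M: "M \<ge> 2"
  shows "(\<integral>\<^sup>+\<xi>. ennreal (norm \<xi> ^ M * exp (- (2 * \<epsilon> * norm \<xi>)) * (norm (ft (\<lambda>x. of_real (f x)) \<xi>))\<^sup>2) \<partial>lborel)
     \<le> ennreal (4 * fact M * L\<^sup>2 * measure lborel (cball (0::'a) \<rho>) * gauss_moment TYPE('a) 2 * \<epsilon>\<^sup>2 / \<epsilon> ^ M)"
proof -
  let ?C = "L\<^sup>2 * measure lborel (cball (0::'a) \<rho>) * gauss_moment TYPE('a) 2 * \<epsilon>\<^sup>2"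
  have C: "?C \<ge> 0" using gauss_moment_nonneg[of 2, where 'a='a] by simp
  let ?F = "\<lambda>\<xi>. (norm (ft (\<lambda>x. complex_of_real (f x)) \<xi>))\<^sup>2"
  have "(\<integral>\<^sup>+\<xi>. ennreal (norm \<xi> ^ M * exp (- (2 * \<epsilon> * norm \<xi>)) * ?F \<xi>) \<partial>lborel)
    \<le> (\<integral>\<^sup>+\<xi>. ennreal (4 * fact M / \<epsilon> ^ M) * ennreal ((1 - exp (- (\<epsilon>\<^sup>2 * (norm \<xi>)\<^sup>2 / 2))) * ?F \<xi>) \<partial>lborel)"
  proof (rule nn_integral_mono)
    fix \<xi> :: 'a
    have "(\<epsilon> * norm \<xi>) ^ M * exp (- (2 * (\<epsilon> * norm \<xi>))) \<le> 4 * fact M * (1 - exp (- ((\<epsilon> * norm \<xi>)\<^sup>2 / 2)))"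
      using \<epsilon> M by (intro power_exp_le_gauss) auto
    then have "norm \<xi> ^ M * exp (- (2 * \<epsilon> * norm \<xi>)) \<le> 4 * fact M / \<epsilon> ^ M * (1 - exp (- (\<epsilon>\<^sup>2 * (norm \<xi>)\<^sup>2 / 2)))"
      using \<epsilon> by (simp add: power_mult_distrib field_simps)
    from mult_right_mono[OF this, of "?F \<xi>"]
    show "ennreal (norm \<xi> ^ M * exp (- (2 * \<epsilon> * norm \<xi>)) * ?F \<xi>) \<le> ennreal (4 * fact M / \<epsilon> ^ M) * ennreal ((1 - exp (- (\<epsilon>\<^sup>2 * (norm \<xi>)\<^sup>2 / 2))) * ?F \<xi>)"
      using \<epsilon> by (subst ennreal_mult[symmetric]) (auto intro!: ennreal_leI simp: mult.assoc)
  qed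
  also have "\<dots> = ennreal (4 * fact M / \<epsilon> ^ M) * (\<integral>\<^sup>+\<xi>. ennreal ((1 - exp (- (\<epsilon>\<^sup>2 * (norm \<xi>)\<^sup>2 / 2))) * ?F \<xi>) \<partial>lborel)"
    by (rule nn_integral_cmult) measurable
  also have "\<dots> \<le> ennreal (4 * fact M / \<epsilon> ^ M) * ennreal ?C"
    by (intro mult_left_mono nn_integral_ft_smoothed[where \<rho>=\<rho>] lip bd supp fm \<epsilon> L) auto
  also have "\<dots> = ennreal (4 * fact M * L\<^sup>2 * measure lborel (cball (0::'a) \<rho>) * gauss_moment TYPE('a) 2 * \<epsilon>\<^sup>2 / \<epsilon> ^ M)"
    using \<epsilon> C by (subst ennreal_mult[symmetric]) (auto simp: mult_ac)
  finally show ?thesis .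
qed

subsection \<open>Ridge transforms\<close>

lemma borel_measurable_fst_borel [measurable]: "fst \<in> borel_measurable (borel :: ('a::euclidean_space \<times> 'b::euclidean_space) measure)"
  and borel_measurable_snd_borel [measurable]: "snd \<in> borel_measurable (borel :: ('a::euclidean_space \<times> 'b::euclidean_space) measure)"
  by (intro borel_measurable_continuous_onI continuous_intros)+

lemma norm_lebesgue_integral_le:
  fixes f :: "'a \<Rightarrow> 'b::{banach,second_countable_topology}"
  assumes g: "integrable M g" and le: "\<And>x. norm (f x) \<le> g x"
  shows "norm (integral\<^sup>L M f) \<le> integral\<^sup>L M g"
proof (cases "integrable M f")
  case True
  have "norm (integral\<^sup>L M f) \<le> (\<integral>x. norm (f x) \<partial>M)" by (rule integral_norm_bound)
  also have "\<dots> \<le> integral\<^sup>L M g" using True g le by (intro integral_mono integrable_norm) auto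
  finally show ?thesis .
next
  case False
  have "0 \<le> integral\<^sup>L M g" by (intro integral_nonneg_AE AE_I2 order_trans[OF norm_ge_zero le])
  with False show ?thesis by (simp add: not_integrable_integral_eq)
qed

text \<open>A filtered and regularised Radon transform: \<open>f\<close> is integrated against a
  function of the single variable \<open>fst v \<bullet> y + snd v\<close>, an inverse power whose
  pole is moved off the real axis. As the displacement scales with \<open>fst v\<close>, the
  transform is homogeneous of degree \<open>- N\<close>.\<close>

definition ridge_transform :: "real \<Rightarrow> nat \<Rightarrow> ('a::euclidean_space \<Rightarrow> real) \<Rightarrow> 'a \<times> real \<Rightarrow> complex" where
  "ridge_transform \<epsilon> N f v = (\<integral>y. of_real (f y) / (of_real (\<epsilon> * norm (fst v)) + \<i> * of_real (fst v \<bullet> y + snd v)) ^ N \<partial>lborel)"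

lemma ridge_transform_measurable [measurable]:
  assumes [measurable]: "f \<in> borel_measurable borel"
  shows "ridge_transform \<epsilon> N f \<in> borel_measurable borel"
  unfolding ridge_transform_def[abs_def] by (rule lborel.borel_measurable_lebesgue_integral) measurable

lemma ridge_transform_scaleR:
  assumes c: "c > 0"
  shows "ridge_transform \<epsilon> N f (c *\<^sub>R v) = ridge_transform \<epsilon> N f v / of_real c ^ N"
proof -
  have "of_real (f y) / (of_real (\<epsilon> * norm (fst (c *\<^sub>R v))) + \<i> * of_real (fst (c *\<^sub>R v) \<bullet> y + snd (c *\<^sub>R v))) ^ N
    = of_real (f y) / (of_real (\<epsilon> * norm (fst v)) + \<i> * of_real (fst v \<bullet> y + snd v)) ^ N / of_real c ^ N" for y
  proof -
    have "of_real (\<epsilon> * norm (fst (c *\<^sub>R v))) + \<i> * of_real (fst (c *\<^sub>R v) \<bullet> y + snd (c *\<^sub>R v))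
      = of_real c * (of_real (\<epsilon> * norm (fst v)) + \<i> * of_real (fst v \<bullet> y + snd v) :: complex)"
      using c by (simp add: algebra_simps)
    then show ?thesis by (simp add: power_mult_distrib mult.commute)
  qed
  then show ?thesis unfolding ridge_transform_def by (simp only: integral_divide_zero)
qed

lemma norm_ridge_transform_le:
  fixes f :: "'a::euclidean_space \<Rightarrow> real"
  assumes bd: "\<And>x. \<bar>f x\<bar> \<le> 1" and supp: "\<And>x. norm x > \<rho> \<Longrightarrow> f x = 0"
    and a: "a > 0" and ge: "\<And>y. norm y \<le> \<rho> \<Longrightarrow> cmod (of_real (\<epsilon> * norm (fst v)) + \<i> * of_real (fst v \<bullet> y + snd v)) \<ge> a"
  shows "cmod (ridge_transform \<epsilon> N f v) \<le> measure lborel (cball (0::'a) \<rho>) / a ^ N"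
proof -
  let ?g = "\<lambda>y. of_real (f y) / (of_real (\<epsilon> * norm (fst v)) + \<i> * of_real (fst v \<bullet> y + snd v)) ^ N"
  have B: "integrable lborel (indicator (cball (0::'a) \<rho>) :: 'a \<Rightarrow> real)"
    using emeasure_lborel_cball_finite[of "0::'a" \<rho>] by simp
  have "cmod (ridge_transform \<epsilon> N f v) \<le> (\<integral>y. indicator (cball (0::'a) \<rho>) y * (1 / a ^ N) \<partial>lborel)"
    unfolding ridge_transform_def
  proof (rule norm_lebesgue_integral_le)
    show "integrable lborel (\<lambda>y. indicator (cball (0::'a) \<rho>) y * (1 / a ^ N))" using B by (rule integrable_mult_left)
    fix y
    show "norm (?g y) \<le> indicator (cball 0 \<rho>) y * (1 / a ^ N)"
    proof (cases "norm y \<le> \<rho>")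
      case True
      then have "norm (?g y) \<le> 1 / a ^ N"
        unfolding norm_divide norm_power using a ge[OF True] bd[of y] by (intro frac_le power_mono) auto
      then show ?thesis using True by simp
    qed (use supp[of y] a in auto)
  qed
  also have "\<dots> = measure lborel (cball (0::'a) \<rho>) / a ^ N" by simp
  finally show ?thesis .
qed

lemma cmod_ge_abs_Im_part: "cmod (of_real a + \<i> * of_real b) \<ge> \<bar>b\<bar>"
  using abs_Im_le_cmod[of "of_real a + \<i> * of_real b"] by simp

text \<open>On the support of \<open>f\<close> the inner product is at most
  \<open>2 * norm w\<close>, hence at most half of the modulus of \<open>b\<close>. The imaginary
  part alone then keeps the denominator away from 0, so the bound is uniform in \<epsilon>.\<close>

lemma norm_ridge_transform_tail:
  fixes f :: "'a::euclidean_space \<Rightarrow> real"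
  assumes bd: "\<And>x. \<bar>f x\<bar> \<le> 1" and supp: "\<And>x. norm x > 2 \<Longrightarrow> f x = 0"
    and b: "b \<noteq> 0" "4 * norm w \<le> \<bar>b\<bar>"
  shows "cmod (ridge_transform \<epsilon> N f (w, b)) \<le> measure lborel (cball (0::'a) 2) / (\<bar>b\<bar> / 2) ^ N"
proof (rule norm_ridge_transform_le[OF bd supp])
  fix y :: 'a assume y: "norm y \<le> 2"
  have "\<bar>w \<bullet> y\<bar> \<le> norm w * norm y" by (rule Cauchy_Schwarz_ineq2)
  also have "\<dots> \<le> norm w * 2" using y by (intro mult_left_mono) auto
  finally have "\<bar>b\<bar> / 2 \<le> \<bar>w \<bullet> y + b\<bar>" using b by linarith
  then show "\<bar>b\<bar> / 2 \<le> cmod (of_real (\<epsilon> * norm (fst (w, b))) + \<i> * of_real (fst (w, b) \<bullet> y + snd (w, b)))"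
    using cmod_ge_abs_Im_part[of "w \<bullet> y + b" "\<epsilon> * norm w"] by (simp del: of_real_mult of_real_add)
qed (use b in auto)

lemma norm_pair_square: "(norm (w, b::real))\<^sup>2 = (norm w)\<^sup>2 + b\<^sup>2"
  by (simp add: norm_Pair)

text \<open>The factor 4 is the one of the tail estimate. At equality in the case distinction the
  components have sizes \<open>4 / sqrt 17\<close> and \<open>1 / sqrt 17\<close>; the constants 1/2
  and 1/5 are round values below these.\<close>

lemma unit_pair_cases:
  assumes "norm (w, b::real) = 1"
  obtains "4 * norm w \<le> \<bar>b\<bar>" "\<bar>b\<bar> \<ge> 1 / 2" | "\<bar>b\<bar> < 4 * norm w" "norm w \<ge> 1 / 5"
proof (cases "4 * norm w \<le> \<bar>b\<bar>")
  case True
  have "16 * (norm w)\<^sup>2 \<le> b\<^sup>2" using power_mono[OF True, of 2] by (simp add: power_mult_distrib)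
  then have "(1 / 2)\<^sup>2 \<le> \<bar>b\<bar>\<^sup>2" using norm_pair_square[of w b] assms by (simp add: power_divide)
  then have "1 / 2 \<le> \<bar>b\<bar>" by (rule power2_le_imp_le) simp
  with True that show ?thesis by blast
next
  case False
  have "b\<^sup>2 \<le> 16 * (norm w)\<^sup>2" using power_mono[of "\<bar>b\<bar>" "4 * norm w" 2] False by (simp add: power_mult_distrib)
  then have "(1 / 5)\<^sup>2 \<le> (norm w)\<^sup>2" using norm_pair_square[of w b] assms by (simp add: power_divide)
  then have "1 / 5 \<le> norm w" by (rule power2_le_imp_le) simp
  with False that show ?thesis by force
qed

text \<open>The bound may depend on \<epsilon>: it serves integrability on the sphere, while the
  quantitative estimate is made in the square mean. Near the poles the tail estimate applies,
  elsewhere the real part of the denominator is at least \<open>\<epsilon> / 5\<close>.\<close>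

lemma ridge_transform_bounded_sphere:
  fixes f :: "'a::euclidean_space \<Rightarrow> real"
  assumes bd: "\<And>x. \<bar>f x\<bar> \<le> 1" and supp: "\<And>x. norm x > 2 \<Longrightarrow> f x = 0" and \<epsilon>: "\<epsilon> > 0"
  obtains B where "\<And>u. norm u = 1 \<Longrightarrow> cmod (ridge_transform \<epsilon> N f u) \<le> B"
proof
  let ?V = "measure lborel (cball (0::'a) 2)"
  fix u :: "'a \<times> real" assume u: "norm u = 1"
  obtain w b where wb: "u = (w, b)" by (cases u)
  have "norm (w, b) = 1" using u wb by simp
  then show "cmod (ridge_transform \<epsilon> N f u) \<le> ?V * 4 ^ N + ?V * (5 / \<epsilon>) ^ N"
  proof (cases rule: unit_pair_cases)
    case 1
    then have "cmod (ridge_transform \<epsilon> N f u) \<le> ?V / (\<bar>b\<bar> / 2) ^ N"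
      unfolding wb by (intro norm_ridge_transform_tail bd supp) auto
    also have "\<dots> \<le> ?V / (1 / 4) ^ N"
      using 1 by (intro divide_left_mono power_mono mult_pos_pos zero_less_power) auto
    also have "\<dots> = ?V * 4 ^ N" by (simp add: power_one_over)
    finally show ?thesis using \<epsilon> by (simp add: add_increasing2)
  next
    case 2
    have "cmod (ridge_transform \<epsilon> N f u) \<le> ?V / (\<epsilon> / 5) ^ N"
    proof (rule norm_ridge_transform_le[OF bd supp])
      fix y
      have "\<epsilon> / 5 \<le> \<epsilon> * norm w" using mult_left_mono[OF 2(2), of \<epsilon>] \<epsilon> by simp
      also have "\<dots> \<le> cmod (of_real (\<epsilon> * norm w) + \<i> * of_real (w \<bullet> y + b))"
        using complex_Re_le_cmod[of "of_real (\<epsilon> * norm w) + \<i> * of_real (w \<bullet> y + b)"] by simp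
      finally show "\<epsilon> / 5 \<le> cmod (of_real (\<epsilon> * norm (fst u)) + \<i> * of_real (fst u \<bullet> y + snd u))"
        unfolding wb by simp
    qed (use \<epsilon> in auto)
    also have "\<dots> = ?V * (5 / \<epsilon>) ^ N" by (simp add: power_divide)
    finally show ?thesis by (simp add: add_increasing)
  qed
qed

text \<open>Opening the inverse power as a Laplace integral in \<open>r\<close> produces the phase
  of \<open>- r * (w \<bullet> y + b)\<close>, and integrating over \<open>y\<close> gives the
  Fourier transform of \<open>f\<close> at \<open>r *\<^sub>R w\<close>, as in the Fourier slice
  theorem. As a function of \<open>b\<close>, the ridge transform is thus a one-dimensional Fourier
  transform of a function living on the half line.\<close>

lemma ridge_transform_eq_ft:
  fixes f :: "'a::euclidean_space \<Rightarrow> real" and k :: nat and w :: 'a and b :: real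
  assumes f: "integrable lborel f" and \<epsilon>: "\<epsilon> > 0" and w: "w \<noteq> 0"
  defines "\<phi> \<equiv> \<lambda>r. of_real (indicator {0..} r * (r ^ k * exp (- (\<epsilon> * norm w * r)))) * ft (\<lambda>y. of_real (f y)) (r *\<^sub>R w)"
  shows "integrable lborel \<phi>" and "ridge_transform \<epsilon> (Suc k) f (w, b) = ft \<phi> b / fact k"
proof -
  have [measurable]: "f \<in> borel_measurable borel" using f by auto
  let ?a = "\<epsilon> * norm w"
  have a: "?a > 0" using \<epsilon> w by simp
  let ?z = "\<lambda>y. complex_of_real ?a + \<i> * of_real (w \<bullet> y + b)"
  let ?h = "\<lambda>r::real. complex_of_real (indicator {0..} r * (r ^ k * exp (- (?a * r))))"
  have h: "integrable lborel ?h" using integrable_power_exp[OF a, of k] by (simp only: complex_of_real_integrable_eq)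
  have fc: "integrable lborel (\<lambda>y. complex_of_real (f y))" using f by simp
  have ftb: "cmod (ft (\<lambda>y. of_real (f y)) \<xi>) \<le> (\<integral>y. \<bar>f y\<bar> \<partial>lborel)" for \<xi>
    unfolding ft_def by (rule norm_lebesgue_integral_le) (use f in \<open>auto simp: norm_mult\<close>)
  show int: "integrable lborel \<phi>"
  proof (rule Bochner_Integration.integrable_bound[OF integrable_mult_right[OF integrable_norm[OF h]]])
    show "AE r in lborel. norm (\<phi> r) \<le> norm ((\<integral>y. \<bar>f y\<bar> \<partial>lborel) * norm (?h r))"
    proof (rule AE_I2)
      fix r
      have "norm (\<phi> r) \<le> norm (?h r) * (\<integral>y. \<bar>f y\<bar> \<partial>lborel)"
        unfolding \<phi>_def norm_mult using ftb by (intro mult_left_mono) auto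
      also have "\<dots> \<le> norm ((\<integral>y. \<bar>f y\<bar> \<partial>lborel) * norm (?h r))" by (simp add: mult.commute)
      finally show "norm (\<phi> r) \<le> norm ((\<integral>y. \<bar>f y\<bar> \<partial>lborel) * norm (?h r))" .
    qed
  qed (simp add: \<phi>_def, measurable)
  let ?H = "\<lambda>x::'a \<times> real. (of_real (f (fst x)) * ?h (snd x)) * cis (- (snd x * (w \<bullet> fst x + b)))"
  have H: "integrable (lborel \<Otimes>\<^sub>M lborel) ?H"
    by (rule integrable_mult_cis[OF integrable_pair_mult[OF fc h]]) measurable
  have "fact k * ridge_transform \<epsilon> (Suc k) f (w, b) = (\<integral>y. of_real (f y) * (fact k / ?z y ^ Suc k) \<partial>lborel)"
    unfolding ridge_transform_def integral_mult_right_zero[symmetric] by (simp only: fst_conv snd_conv times_divide_eq_right mult.commute)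
  also have "\<dots> = (\<integral>y. \<integral>r. ?H (y, r) \<partial>lborel \<partial>lborel)"
  proof (intro Bochner_Integration.integral_cong refl)
    fix y
    have "fact k / ?z y ^ Suc k = (\<integral>r. indicator {0..} r *\<^sub>R (of_real r ^ k * exp (- (of_real r * ?z y))) \<partial>lborel)"
      by (rule integral_power_exp_complex[symmetric]) (use a in auto)
    also have "\<dots> = (\<integral>r. ?h r * cis (- (r * (w \<bullet> y + b))) \<partial>lborel)"
      by (intro Bochner_Integration.integral_cong) (auto simp: scaleR_conv_of_real cis_conv_exp exp_of_real[symmetric] exp_add[symmetric] algebra_simps)
    finally have 1: "fact k / ?z y ^ Suc k = (\<integral>r. ?h r * cis (- (r * (w \<bullet> y + b))) \<partial>lborel)" .
    show "of_real (f y) * (fact k / ?z y ^ Suc k) = (\<integral>r. ?H (y, r) \<partial>lborel)"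
      unfolding 1 fst_conv snd_conv mult.assoc integral_mult_right_zero ..
  qed
  also have "\<dots> = (\<integral>r. \<integral>y. ?H (y, r) \<partial>lborel \<partial>lborel)"
  proof -
    have "integrable (lborel \<Otimes>\<^sub>M lborel) (\<lambda>(y, r). ?H (y, r))"
      using H by (simp only: case_prod_unfold fst_conv snd_conv)
    from lborel_pair.Fubini_integral[OF this] show ?thesis by (rule sym)
  qed
  also have "\<dots> = (\<integral>r. \<phi> r * cis (- (b * r)) \<partial>lborel)"
  proof (intro Bochner_Integration.integral_cong refl)
    fix r
    have "?H (y, r) = (?h r * cis (- (b * r))) * (of_real (f y) * cis (- ((r *\<^sub>R w) \<bullet> y)))" for y
    proof -
      have "cis (- (r * (w \<bullet> y + b))) = cis (- (b * r)) * cis (- ((r *\<^sub>R w) \<bullet> y))"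
        by (simp add: cis_mult algebra_simps)
      then show ?thesis by (simp only: fst_conv snd_conv mult_ac)
    qed
    then have "(\<integral>y. ?H (y, r) \<partial>lborel) = (?h r * cis (- (b * r))) * ft (\<lambda>y. of_real (f y)) (r *\<^sub>R w)"
      unfolding ft_def by (simp only: integral_mult_right_zero)
    then show "(\<integral>y. ?H (y, r) \<partial>lborel) = \<phi> r * cis (- (b * r))"
      unfolding \<phi>_def by (simp only: mult_ac)
  qed
  also have "\<dots> = ft \<phi> b" unfolding ft_def by simp
  finally show "ridge_transform \<epsilon> (Suc k) f (w, b) = ft \<phi> b / fact k"
    by (simp add: field_simps)
qed

text \<open>For fixed \<open>w\<close> the Gaussian form of Plancherel in \<open>b\<close> bounds
  the inner integral by that of the squared slice along the ray through \<open>w\<close>; octave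
  polar coordinates reassemble the rays. The restriction to \<open>\<bar>snd v\<bar> < 8\<close>
  allows a Gaussian weight to be inserted; it covers the part of the shell where
  \<open>\<bar>snd v\<bar> < 4 * norm (fst v)\<close>.\<close>

lemma nn_integral_shell_ridge_transform:
  fixes f :: "'a::euclidean_space \<Rightarrow> real"
  assumes f: "integrable lborel f" and \<epsilon>: "\<epsilon> > 0"
  shows "(\<integral>\<^sup>+v. indicator (shell \<inter> {v. \<bar>snd v\<bar> < 8}) v * ennreal ((cmod (ridge_transform \<epsilon> (DIM('a) + \<alpha> + 1) f v))\<^sup>2) \<partial>lborel)
    \<le> ennreal (exp 32 * gauss_moment TYPE(real) 0 * ln 2) *
       (\<integral>\<^sup>+\<xi>. ennreal (norm (\<xi>::'a) ^ (DIM('a) + 2 * \<alpha> + 1) * exp (- (2 * \<epsilon> * norm \<xi>)) * (cmod (ft (\<lambda>x. of_real (f x)) \<xi>))\<^sup>2) \<partial>lborel)"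
proof -
  have [measurable]: "f \<in> borel_measurable borel" using f by auto
  define n where "n = DIM('a)"
  have n: "n \<ge> 1" unfolding n_def by (simp add: Suc_leI)
  define k where "k = n + \<alpha>"
  define M where "M = n + 2 * \<alpha> + 1"
  let ?R = "ridge_transform \<epsilon> (Suc k) f" and ?F = "\<lambda>\<xi>. (cmod (ft (\<lambda>x. complex_of_real (f x)) \<xi>))\<^sup>2"
  let ?S = "{w::'a. 1 \<le> norm w \<and> norm w < 2}"
  let ?H = "\<lambda>\<xi>::'a. ennreal (norm \<xi> ^ M * exp (- (2 * \<epsilon> * norm \<xi>)) * ?F \<xi>)"
  let ?c = "exp 32 * gauss_moment TYPE(real) 0"
  have c: "?c \<ge> 0" using gauss_moment_nonneg[of 0, where 'a=real] by simp
  have [measurable]: "?S \<in> sets borel" by measurable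
  have inner: "(\<integral>\<^sup>+b. indicator {b. \<bar>b\<bar> < 8} b * ennreal ((cmod (?R (w, b)))\<^sup>2) \<partial>lborel)
     \<le> ennreal ?c * (\<integral>\<^sup>+r. ennreal (r ^ (n - 1)) * indicator {0<..} r * ?H (r *\<^sub>R w) \<partial>lborel)" if w: "w \<in> ?S" for w :: 'a
  proof -
    have w0: "w \<noteq> 0" "norm w \<ge> 1" using w by auto
    define \<phi> where "\<phi> = (\<lambda>r. of_real (indicator {0..} r * (r ^ k * exp (- (\<epsilon> * norm w * r)))) * ft (\<lambda>y. of_real (f y)) (r *\<^sub>R w))"
    have \<phi>: "integrable lborel \<phi>" "\<And>b. ?R (w, b) = ft \<phi> b / fact k"
      unfolding \<phi>_def by (rule ridge_transform_eq_ft[OF f \<epsilon> w0(1)])+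
    have [measurable]: "\<phi> \<in> borel_measurable borel" using \<phi>(1) by auto
    have "(\<integral>\<^sup>+b. indicator {b. \<bar>b\<bar> < 8} b * ennreal ((cmod (?R (w, b)))\<^sup>2) \<partial>lborel)
      \<le> (\<integral>\<^sup>+b. ennreal (exp 32) * ennreal (exp (- (1\<^sup>2 * (norm b)\<^sup>2 / 2)) * (cmod (ft \<phi> b))\<^sup>2) \<partial>lborel)"
    proof (rule nn_integral_mono)
      fix b :: real
      show "indicator {b. \<bar>b\<bar> < 8} b * ennreal ((cmod (?R (w, b)))\<^sup>2) \<le> ennreal (exp 32) * ennreal (exp (- (1\<^sup>2 * (norm b)\<^sup>2 / 2)) * (cmod (ft \<phi> b))\<^sup>2)"
      proof (cases "\<bar>b\<bar> < 8")
        case True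
        have "(cmod (?R (w, b)))\<^sup>2 \<le> (cmod (ft \<phi> b))\<^sup>2"
          unfolding \<phi>(2) norm_divide by (intro power_mono) (auto simp: divide_le_eq fact_ge_1 mult_le_cancel_left1)
        \<comment> \<open>The exponent 32 is half the square of 8.\<close>
        moreover have "1 \<le> exp 32 * exp (- (1\<^sup>2 * (norm b)\<^sup>2 / 2))"
          using power_mono[of "\<bar>b\<bar>" 8 2] True by (simp add: mult_exp_exp)
        ultimately have "1 * (cmod (?R (w, b)))\<^sup>2 \<le> (exp 32 * exp (- (1\<^sup>2 * (norm b)\<^sup>2 / 2))) * (cmod (ft \<phi> b))\<^sup>2"
          by (intro mult_mono) auto
        then show ?thesis using True by (simp add: ennreal_mult[symmetric] mult.assoc ennreal_leI)
      qed simp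
    qed
    also have "\<dots> = ennreal (exp 32) * (\<integral>\<^sup>+b. ennreal (exp (- (1\<^sup>2 * (norm b)\<^sup>2 / 2)) * (cmod (ft \<phi> b))\<^sup>2) \<partial>lborel)"
      by (intro nn_integral_cmult) measurable
    also have "\<dots> \<le> ennreal (exp 32) * (ennreal (gauss_moment TYPE(real) 0) * (\<integral>\<^sup>+r. ennreal ((norm (\<phi> r))\<^sup>2) \<partial>lborel))"
      by (intro mult_left_mono nn_integral_gauss_ft_norm_square_le \<phi>) auto
    also have "\<dots> = ennreal ?c * (\<integral>\<^sup>+r. ennreal ((norm (\<phi> r))\<^sup>2) \<partial>lborel)"
      using gauss_moment_nonneg[of 0, where 'a=real] by (simp add: ennreal_mult mult.assoc)
    also have "\<dots> \<le> ennreal ?c * (\<integral>\<^sup>+r. ennreal (r ^ (n - 1)) * indicator {0<..} r * ?H (r *\<^sub>R w) \<partial>lborel)"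
    proof (intro mult_left_mono nn_integral_mono_AE)
      have "AE r in lborel. (r::real) \<noteq> 0" by (rule AE_lborel_singleton)
      then show "AE r in lborel. ennreal ((norm (\<phi> r))\<^sup>2) \<le> ennreal (r ^ (n - 1)) * indicator {0<..} r * ?H (r *\<^sub>R w)"
      proof eventually_elim
        case (elim r)
        show ?case
        proof (cases "r > 0")
          case True
          \<comment> \<open>Of the \<open>2 * k\<close> powers of \<open>r\<close> in the squared
            slice, \<open>n - 1\<close> form the polar Jacobian; the other \<open>M\<close> are
            dominated by powers of \<open>norm (r *\<^sub>R w)\<close>, as
            \<open>norm w \<ge> 1\<close> on the shell.\<close>
          have kn: "k * 2 = (n - 1) + M" using n by (simp add: k_def M_def)
          have "(norm (\<phi> r))\<^sup>2 = (r ^ k)\<^sup>2 * (exp (- (\<epsilon> * norm w * r)))\<^sup>2 * ?F (r *\<^sub>R w)"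
            unfolding \<phi>_def using True by (simp add: norm_mult norm_power power_mult_distrib)
          also have "(r ^ k)\<^sup>2 = r ^ (n - 1) * r ^ M"
            by (simp only: power_mult[symmetric] kn power_add)
          also have "(exp (- (\<epsilon> * norm w * r)))\<^sup>2 = exp (- (2 * \<epsilon> * norm (r *\<^sub>R w)))"
            using True by (simp add: power2_eq_square mult_exp_exp)
          also have "r ^ (n - 1) * r ^ M * exp (- (2 * \<epsilon> * norm (r *\<^sub>R w))) * ?F (r *\<^sub>R w)
            \<le> r ^ (n - 1) * norm (r *\<^sub>R w) ^ M * exp (- (2 * \<epsilon> * norm (r *\<^sub>R w))) * ?F (r *\<^sub>R w)"
            using True w0 by (intro mult_right_mono mult_left_mono power_mono) auto
          finally have "(norm (\<phi> r))\<^sup>2 \<le> r ^ (n - 1) * (norm (r *\<^sub>R w) ^ M * exp (- (2 * \<epsilon> * norm (r *\<^sub>R w))) * ?F (r *\<^sub>R w))"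
            by (simp only: mult_ac)
          from ennreal_leI[OF this] have "ennreal ((norm (\<phi> r))\<^sup>2) \<le> ennreal (r ^ (n - 1)) * ?H (r *\<^sub>R w)"
            by (rule ord_le_eq_trans) (use True in \<open>intro ennreal_mult, auto\<close>)
          then show ?thesis using True by simp
        next
          case False
          with elim show ?thesis by (simp add: \<phi>_def)
        qed
      qed
    qed simp
    finally show ?thesis .
  qed
  have "(\<integral>\<^sup>+v. indicator (shell \<inter> {v. \<bar>snd v\<bar> < 8}) v * ennreal ((cmod (?R v))\<^sup>2) \<partial>lborel)
     = (\<integral>\<^sup>+w. (\<integral>\<^sup>+b. indicator ?S w * (indicator {b. \<bar>b\<bar> < 8} b * ennreal ((cmod (?R (w, b)))\<^sup>2)) \<partial>lborel) \<partial>lborel)"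
  proof -
    have "(\<integral>\<^sup>+v. indicator (shell \<inter> {v. \<bar>snd v\<bar> < 8}) v * ennreal ((cmod (?R v))\<^sup>2) \<partial>lborel)
       = (\<integral>\<^sup>+v. indicator ?S (fst v) * (indicator {b. \<bar>b\<bar> < 8} (snd v) * ennreal ((cmod (?R v))\<^sup>2)) \<partial>(lborel \<Otimes>\<^sub>M lborel))"
      unfolding lborel_prod by (intro nn_integral_cong) (auto simp: shell_def split: split_indicator)
    also have "\<dots> = (\<integral>\<^sup>+w. (\<integral>\<^sup>+b. indicator ?S w * (indicator {b. \<bar>b\<bar> < 8} b * ennreal ((cmod (?R (w, b)))\<^sup>2)) \<partial>lborel) \<partial>lborel)"
    proof (subst lborel.nn_integral_fst[symmetric])
      have [measurable]: "?R \<in> borel_measurable (borel \<Otimes>\<^sub>M borel)" unfolding borel_prod by measurable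
      show "(\<lambda>v. indicator ?S (fst v) * (indicator {b. \<bar>b\<bar> < 8} (snd v) * ennreal ((cmod (?R v))\<^sup>2))) \<in> borel_measurable (lborel \<Otimes>\<^sub>M lborel)"
        by measurable
    qed simp
    finally show ?thesis .
  qed
  also have "\<dots> \<le> (\<integral>\<^sup>+w. ennreal ?c * (\<integral>\<^sup>+r. ennreal (r ^ (n - 1)) * indicator {0<..} r * indicator ?S w * ?H (r *\<^sub>R w) \<partial>lborel) \<partial>lborel)"
  proof (rule nn_integral_mono)
    fix w :: 'a
    show "(\<integral>\<^sup>+b. indicator ?S w * (indicator {b. \<bar>b\<bar> < 8} b * ennreal ((cmod (?R (w, b)))\<^sup>2)) \<partial>lborel)
       \<le> ennreal ?c * (\<integral>\<^sup>+r. ennreal (r ^ (n - 1)) * indicator {0<..} r * indicator ?S w * ?H (r *\<^sub>R w) \<partial>lborel)"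
      using inner[of w] by (cases "w \<in> ?S") auto
  qed
  also have "\<dots> = ennreal ?c * (\<integral>\<^sup>+w. (\<integral>\<^sup>+r. ennreal (r ^ (n - 1)) * indicator {0<..} r * indicator ?S w * ?H (r *\<^sub>R w) \<partial>lborel) \<partial>lborel)"
    by (rule nn_integral_cmult) measurable
  also have "\<dots> = ennreal ?c * (ennreal (ln 2) * (\<integral>\<^sup>+\<xi>. ?H \<xi> \<partial>lborel))"
    unfolding n_def by (subst nn_integral_polar_octave) auto
  also have "\<dots> = ennreal (?c * ln 2) * (\<integral>\<^sup>+\<xi>. ?H \<xi> \<partial>lborel)"
  proof -
    have "ennreal (?c * ln 2) = ennreal ?c * ennreal (ln 2)" using c by (intro ennreal_mult) auto
    then show ?thesis by (simp only: mult.assoc)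
  qed
  finally show ?thesis unfolding k_def M_def n_def by simp
qed

text \<open>The sphere is split where \<open>\<bar>b\<bar> = 4 * norm w\<close>. Near the poles the
  tail estimate gives a bound free of \<epsilon>; the rest corresponds to a bounded part of the
  shell, on which passing from \<open>sgn v\<close> to \<open>v\<close> by homogeneity costs only a
  constant, and the weighted Fourier estimate applies.\<close>

lemma integral_sphere_ridge_transform_le:
  fixes L :: real and \<alpha> :: nat
  assumes L: "L \<ge> 0"
  obtains C where "C > 0" "\<And>(f :: 'a::euclidean_space \<Rightarrow> real) \<epsilon>. \<lbrakk>\<And>x y. \<bar>f x - f y\<bar> \<le> L * norm (x - y); \<And>x. \<bar>f x\<bar> \<le> 1;
     \<And>x. norm x > 2 \<Longrightarrow> f x = 0; f \<in> borel_measurable borel; 0 < \<epsilon>; \<epsilon> \<le> 1\<rbrakk>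
     \<Longrightarrow> (LINT u|sphere_unif. (cmod (ridge_transform \<epsilon> (DIM('a) + \<alpha> + 1) f u))\<^sup>2) \<le> C * \<epsilon>\<^sup>2 / \<epsilon> ^ (DIM('a) + 2 * \<alpha> + 1)"
proof
  define n where "n = DIM('a)"
  define N where "N = n + \<alpha> + 1"
  define M where "M = n + 2 * \<alpha> + 1"
  let ?V = "measure lborel (cball (0::'a) 2)" and ?K = "shell_const TYPE('a)"
  define C1 where "C1 = 4 * fact M * L\<^sup>2 * ?V * gauss_moment TYPE('a) 2"
  define C2 where "C2 = exp 32 * gauss_moment TYPE(real) 0 * ln 2"
  define C where "C = (?V * 4 ^ N)\<^sup>2 + ?K * (10 ^ (2 * N) * (C2 * C1)) + 1"
  have n: "n \<ge> 1" unfolding n_def by (simp add: Suc_leI)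
  have C1: "C1 \<ge> 0" unfolding C1_def using gauss_moment_nonneg[of 2, where 'a='a] by simp
  have C2: "C2 \<ge> 0" unfolding C2_def using gauss_moment_nonneg[of 0, where 'a=real] by simp
  have K: "?K > 0" by (rule shell_const_pos)
  show "C > 0" unfolding C_def using C1 C2 K by (intro add_nonneg_pos) auto
  fix f :: "'a \<Rightarrow> real" and \<epsilon> :: real
  assume lip: "\<And>x y. \<bar>f x - f y\<bar> \<le> L * norm (x - y)" and bd: "\<And>x. \<bar>f x\<bar> \<le> 1"
    and supp: "\<And>x. norm x > 2 \<Longrightarrow> f x = 0" and fm[measurable]: "f \<in> borel_measurable borel" and \<epsilon>: "0 < \<epsilon>" "\<epsilon> \<le> 1"
  define E where "E = \<epsilon>\<^sup>2 / \<epsilon> ^ M"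
  \<comment> \<open>Since \<open>M \<ge> 2\<close> and \<open>\<epsilon> \<le> 1\<close>; this lets
    the polar contribution, which does not depend on \<epsilon>, be absorbed.\<close>
  have E: "E \<ge> 1" unfolding E_def using \<epsilon> n power_decreasing[of 2 M \<epsilon>] by (simp add: M_def le_divide_eq)
  have fi: "integrable lborel f"
    by (rule integrable_bounded_support[of f 2]) (use bd supp in auto)
  let ?R = "ridge_transform \<epsilon> N f"
  define \<phi> where "\<phi> u = indicator {u. \<bar>snd u\<bar> < 4 * norm (fst u)} u * (cmod (?R u))\<^sup>2" for u
  have [measurable]: "\<phi> \<in> borel_measurable borel" unfolding \<phi>_def by measurable
  have [measurable]: "\<phi> \<in> borel_measurable sphere_unif"
    by (rule measurable_sphere_unif) measurable
  interpret S: prob_space "sphere_unif :: ('a \<times> real) measure" by (rule prob_space_sphere_unif)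
  have "(\<integral>\<^sup>+u. ennreal ((cmod (?R u))\<^sup>2) \<partial>sphere_unif) \<le> (\<integral>\<^sup>+u. ennreal ((?V * 4 ^ N)\<^sup>2) + ennreal (\<phi> u) \<partial>sphere_unif)"
  proof (rule nn_integral_mono)
    fix u :: "'a \<times> real" assume "u \<in> space sphere_unif"
    then have u: "norm u = 1" by (simp add: space_sphere_unif)
    obtain w b where wb: "u = (w, b)" by (cases u)
    have "norm (w, b) = 1" using u wb by simp
    then show "ennreal ((cmod (?R u))\<^sup>2) \<le> ennreal ((?V * 4 ^ N)\<^sup>2) + ennreal (\<phi> u)"
    proof (cases rule: unit_pair_cases)
      case 1
      then have "cmod (?R u) \<le> ?V / (\<bar>b\<bar> / 2) ^ N"
        unfolding wb by (intro norm_ridge_transform_tail bd supp) auto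
      also have "\<dots> \<le> ?V / (1 / 4) ^ N"
        using 1 by (intro divide_left_mono power_mono mult_pos_pos zero_less_power) auto
      also have "\<dots> = ?V * 4 ^ N" by (simp add: power_one_over)
      finally have "(cmod (?R u))\<^sup>2 \<le> (?V * 4 ^ N)\<^sup>2" by (intro power_mono) auto
      then show ?thesis by (intro add_increasing2 ennreal_leI) auto
    next
      case 2
      then show ?thesis unfolding \<phi>_def wb by (auto intro: add_increasing)
    qed
  qed
  also have "\<dots> = ennreal ((?V * 4 ^ N)\<^sup>2) + (\<integral>\<^sup>+u. ennreal (\<phi> u) \<partial>sphere_unif)"
    by (subst nn_integral_add) (auto simp: S.emeasure_space_1)
  also have "(\<integral>\<^sup>+u. ennreal (\<phi> u) \<partial>sphere_unif)
     = ennreal ?K * (\<integral>\<^sup>+v. ennreal (inverse (norm v ^ DIM('a \<times> real)) * indicator shell v) * ennreal (\<phi> (sgn v)) \<partial>lborel)"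
    by (rule nn_integral_sphere_unif_shell) measurable
  also have "(\<integral>\<^sup>+v. ennreal (inverse (norm v ^ DIM('a \<times> real)) * indicator shell v) * ennreal (\<phi> (sgn v)) \<partial>lborel)
     \<le> (\<integral>\<^sup>+v. ennreal (10 ^ (2 * N)) * (indicator (shell \<inter> {v. \<bar>snd v\<bar> < 8}) v * ennreal ((cmod (?R v))\<^sup>2)) \<partial>lborel)"
  proof (rule nn_integral_mono)
    fix v :: "'a \<times> real"
    show "ennreal (inverse (norm v ^ DIM('a \<times> real)) * indicator shell v) * ennreal (\<phi> (sgn v))
      \<le> ennreal (10 ^ (2 * N)) * (indicator (shell \<inter> {v. \<bar>snd v\<bar> < 8}) v * ennreal ((cmod (?R v))\<^sup>2))"
    proof (cases "v \<in> shell \<and> \<bar>snd v\<bar> < 4 * norm (fst v)")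
      case True
      have w: "1 \<le> norm (fst v)" "norm (fst v) < 2" using True by (auto simp: shell_def)
      have v1: "1 \<le> norm v" using w norm_fst_le[of "fst v" "snd v"] by simp
      \<comment> \<open>The two components are below 2 and 8.\<close>
      have v10: "norm v \<le> 10" using norm_Pair_le[of "fst v" "snd v"] True w by simp
      have sgn: "sgn v = inverse (norm v) *\<^sub>R v" by (rule sgn_div_norm)
      have "\<phi> (sgn v) \<le> (cmod (?R (sgn v)))\<^sup>2" unfolding \<phi>_def by (simp split: split_indicator)
      also have "cmod (?R (sgn v)) = cmod (?R v) * norm v ^ N"
        unfolding sgn using v1 by (subst ridge_transform_scaleR) (auto simp: norm_divide norm_mult norm_power power_inverse divide_inverse)
      also have "(cmod (?R v) * norm v ^ N)\<^sup>2 = (cmod (?R v))\<^sup>2 * norm v ^ (2 * N)"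
        by (simp add: power_mult_distrib power_mult[symmetric] mult.commute)
      also have "\<dots> \<le> (cmod (?R v))\<^sup>2 * 10 ^ (2 * N)"
        using v10 by (intro mult_left_mono power_mono) auto
      finally have "\<phi> (sgn v) \<le> (cmod (?R v))\<^sup>2 * 10 ^ (2 * N)" .
      moreover have "inverse (norm v ^ DIM('a \<times> real)) \<le> 1"
        using v1 by (intro inverse_le_1_iff[THEN iffD2] disjI2 one_le_power)
      moreover have "0 \<le> \<phi> (sgn v)" unfolding \<phi>_def by simp
      ultimately have "inverse (norm v ^ DIM('a \<times> real)) * \<phi> (sgn v) \<le> 1 * ((cmod (?R v))\<^sup>2 * 10 ^ (2 * N))"
        by (intro mult_mono) auto
      then have "ennreal (inverse (norm v ^ DIM('a \<times> real)) * \<phi> (sgn v)) \<le> ennreal (10 ^ (2 * N) * (cmod (?R v))\<^sup>2)"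
        by (intro ennreal_leI) (simp add: mult.commute)
      then show ?thesis using True w by (simp add: ennreal_mult' \<phi>_def del: DIM_prod)
    next
      case False
      have "\<phi> (sgn v) = 0" if v: "v \<in> shell"
      proof -
        have "norm v > 0" using v by (auto simp: shell_def)
        then have "\<bar>snd (sgn v)\<bar> < 4 * norm (fst (sgn v)) \<longleftrightarrow> \<bar>snd v\<bar> < 4 * norm (fst v)"
          by (simp add: sgn_div_norm abs_mult field_simps)
        then show ?thesis using False v by (simp add: \<phi>_def)
      qed
      then have "v \<notin> shell \<or> \<phi> (sgn v) = 0" by blast
      then show ?thesis by auto
    qed
  qed
  also have "\<dots> = ennreal (10 ^ (2 * N)) * (\<integral>\<^sup>+v. indicator (shell \<inter> {v. \<bar>snd v\<bar> < 8}) v * ennreal ((cmod (?R v))\<^sup>2) \<partial>lborel)"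
    by (rule nn_integral_cmult) measurable
  also have "\<dots> \<le> ennreal (10 ^ (2 * N)) * (ennreal C2 * ennreal (C1 * E))"
  proof (rule mult_left_mono)
    have "(\<integral>\<^sup>+v. indicator (shell \<inter> {v. \<bar>snd v\<bar> < 8}) v * ennreal ((cmod (?R v))\<^sup>2) \<partial>lborel)
      \<le> ennreal C2 * (\<integral>\<^sup>+\<xi>. ennreal (norm (\<xi>::'a) ^ M * exp (- (2 * \<epsilon> * norm \<xi>)) * (cmod (ft (\<lambda>x. of_real (f x)) \<xi>))\<^sup>2) \<partial>lborel)"
      unfolding C2_def M_def N_def n_def by (rule nn_integral_shell_ridge_transform[OF fi \<epsilon>(1)])
    also have "\<dots> \<le> ennreal C2 * ennreal (C1 * \<epsilon>\<^sup>2 / \<epsilon> ^ M)"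
      unfolding C1_def using n by (intro mult_left_mono nn_integral_ft_weighted[OF lip bd supp fm \<epsilon>(1) L]) (auto simp: M_def)
    finally show "(\<integral>\<^sup>+v. indicator (shell \<inter> {v. \<bar>snd v\<bar> < 8}) v * ennreal ((cmod (?R v))\<^sup>2) \<partial>lborel) \<le> ennreal C2 * ennreal (C1 * E)"
      unfolding E_def by simp
  qed simp
  finally have "(\<integral>\<^sup>+u. ennreal ((cmod (?R u))\<^sup>2) \<partial>sphere_unif) \<le> ennreal ((?V * 4 ^ N)\<^sup>2) + ennreal ?K * (ennreal (10 ^ (2 * N)) * (ennreal C2 * ennreal (C1 * E)))"
    by (simp add: mult_left_mono add_left_mono)
  also have "\<dots> = ennreal ((?V * 4 ^ N)\<^sup>2 + ?K * (10 ^ (2 * N) * (C2 * (C1 * E))))"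
    using K C1 C2 E by (simp add: ennreal_mult[symmetric] ennreal_plus[symmetric] del: ennreal_plus)
  also have "\<dots> \<le> ennreal (C * E)"
  proof (rule ennreal_leI)
    have "(?V * 4 ^ N)\<^sup>2 * 1 \<le> (?V * 4 ^ N)\<^sup>2 * E" using E by (intro mult_left_mono) auto
    then show "(?V * 4 ^ N)\<^sup>2 + ?K * (10 ^ (2 * N) * (C2 * (C1 * E))) \<le> C * E"
      unfolding C_def distrib_right mult.assoc using E by linarith
  qed
  finally have "(LINT u|sphere_unif. (cmod (?R u))\<^sup>2) \<le> C * E"
    using \<open>C > 0\<close> E by (intro integral_real_bounded) auto
  then show "(LINT u|sphere_unif. (cmod (ridge_transform \<epsilon> (DIM('a) + \<alpha> + 1) f u))\<^sup>2) \<le> C * \<epsilon>\<^sup>2 / \<epsilon> ^ (DIM('a) + 2 * \<alpha> + 1)"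
    unfolding E_def N_def M_def n_def by simp
qed

subsection \<open>The Poisson kernel\<close>

text \<open>In octave polar coordinates \<open>norm (r *\<^sub>R w) \<ge> r\<close>, which leaves a
  Gamma integral in \<open>r\<close> times the finite volume of the spherical shell.\<close>

lemma nn_integral_exp_neg_norm_finite:
  fixes \<epsilon> :: real assumes \<epsilon>: "\<epsilon> > 0"
  shows "(\<integral>\<^sup>+\<xi>. ennreal (exp (- (\<epsilon> * norm (\<xi>::'a::euclidean_space)))) \<partial>lborel) < \<infinity>"
proof -
  let ?S = "{w::'a. 1 \<le> norm w \<and> norm w < 2}" and ?n = "DIM('a)"
  let ?I = "\<integral>\<^sup>+r. ennreal (indicator {0..} r * (r ^ (?n - 1) * exp (- (\<epsilon> * r)))) \<partial>lborel"
  have [measurable]: "?S \<in> sets borel" by measurable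
  have I: "?I < \<infinity>"
    by (subst nn_integral_eq_integral[OF integrable_power_exp[OF \<epsilon>]]) (auto split: split_indicator)
  have S: "emeasure lborel ?S < \<infinity>"
    by (rule le_less_trans[OF emeasure_mono[of _ "cball 0 2"] emeasure_lborel_cball_finite[of "0::'a" 2]]) auto
  have "ennreal (ln 2) * (\<integral>\<^sup>+\<xi>. ennreal (exp (- (\<epsilon> * norm (\<xi>::'a)))) \<partial>lborel)
    = (\<integral>\<^sup>+w. (\<integral>\<^sup>+r. ennreal (r ^ (?n - 1)) * indicator {0<..} r * indicator ?S w * ennreal (exp (- (\<epsilon> * norm (r *\<^sub>R w)))) \<partial>lborel) \<partial>lborel)"
    by (rule nn_integral_polar_octave[symmetric]) measurable
  also have "\<dots> \<le> (\<integral>\<^sup>+w. (\<integral>\<^sup>+r. indicator ?S w * ennreal (indicator {0..} r * (r ^ (?n - 1) * exp (- (\<epsilon> * r)))) \<partial>lborel) \<partial>lborel)"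
  proof (intro nn_integral_mono)
    fix w :: 'a and r :: real
    show "ennreal (r ^ (?n - 1)) * indicator {0<..} r * indicator ?S w * ennreal (exp (- (\<epsilon> * norm (r *\<^sub>R w))))
      \<le> indicator ?S w * ennreal (indicator {0..} r * (r ^ (?n - 1) * exp (- (\<epsilon> * r))))"
    proof (cases "r > 0 \<and> w \<in> ?S")
      case True
      then have "exp (- (\<epsilon> * norm (r *\<^sub>R w))) \<le> exp (- (\<epsilon> * r))"
        using \<epsilon> by (simp add: mult_le_cancel_left1)
      then show ?thesis using True by (auto simp: ennreal_mult[symmetric] intro!: ennreal_leI mult_left_mono)
    qed auto
  qed
  also have "\<dots> = emeasure lborel ?S * ?I"
    by (subst nn_integral_cmult, measurable) (subst nn_integral_multc, auto)
  also have "\<dots> < \<infinity>" using I S by (simp add: ennreal_mult_less_top)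
  finally show ?thesis by (auto simp: ennreal_mult_less_top)
qed

lemma integrable_exp_neg_norm:
  fixes \<epsilon> :: real assumes \<epsilon>: "\<epsilon> > 0"
  shows "integrable lborel (\<lambda>\<xi>::'a::euclidean_space. exp (- (\<epsilon> * norm \<xi>)))"
  using nn_integral_exp_neg_norm_finite[OF \<epsilon>, where 'a='a] by (intro integrableI_bounded) auto

text \<open>The variable \<open>v\<close> is that of the subordination formula at
  \<open>r = \<epsilon> * norm \<xi> / 2\<close>: there
  \<open>r\<^sup>2 / v\<^sup>2 = s\<^sup>2 * (norm \<xi>)\<^sup>2 / 2\<close> for
  \<open>s = \<epsilon> / (sqrt 2 * v)\<close>, and \<open>2 / sqrt pi\<close> normalises the
  mixture.\<close>

definition poisson_mix :: "real \<Rightarrow> 'a::euclidean_space \<Rightarrow> real \<Rightarrow> real" where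
  "poisson_mix \<epsilon> z v = indicator {0<..} v * (2 / sqrt pi * exp (- v\<^sup>2) * gauss_ft (\<epsilon> / (sqrt 2 * v)) z)"

text \<open>Up to a factor the Poisson kernel of the upper half space at height \<epsilon>. Given as
  a mixture, it is visibly nonnegative, and its integrals reduce to Gaussian moments.\<close>

definition poisson :: "real \<Rightarrow> 'a::euclidean_space \<Rightarrow> real" where
  "poisson \<epsilon> z = (\<integral>v. poisson_mix \<epsilon> z v \<partial>lborel)"

lemma poisson_mix_nonneg: "\<epsilon> > 0 \<Longrightarrow> poisson_mix \<epsilon> z v \<ge> 0"
  unfolding poisson_mix_def by (auto simp: gauss_ft_nonneg split: split_indicator)

lemma poisson_mix_measurable [measurable]:
  "(\<lambda>x. poisson_mix \<epsilon> (fst x) (snd x)) \<in> borel_measurable (borel \<Otimes>\<^sub>M borel)"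
  unfolding poisson_mix_def gauss_ft_def by measurable

lemma poisson_measurable [measurable]: "poisson \<epsilon> \<in> borel_measurable borel"
proof -
  have "(\<lambda>(z, v). poisson_mix \<epsilon> z v) \<in> borel_measurable (borel \<Otimes>\<^sub>M (lborel :: real measure))"
    using poisson_mix_measurable[of \<epsilon>] by (simp add: case_prod_unfold cong: measurable_cong_sets)
  from lborel.borel_measurable_lebesgue_integral[OF this] show ?thesis
    unfolding poisson_def[abs_def] .
qed

text \<open>Both claims come from Fubini for the subordinated exponential in the variables \<xi> and
  \<open>v\<close>. Integrating its modulus over \<open>v\<close> gives back
  \<open>exp (- (\<epsilon> * norm \<xi>))\<close>, which is integrable; integrating over \<xi>
  gives the Gaussian transforms that make up the mixture.\<close>

lemma
  fixes z :: "'a::euclidean_space" assumes \<epsilon>: "\<epsilon> > 0"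
  shows integrable_poisson_mix: "integrable lborel (poisson_mix \<epsilon> z)"
    and integral_exp_neg_norm_cis: "(\<integral>\<xi>. of_real (exp (- (\<epsilon> * norm \<xi>))) * cis (\<xi> \<bullet> z) \<partial>lborel) = complex_of_real (poisson \<epsilon> z)"
proof -
  let ?e = "\<lambda>(\<xi>::'a) v. indicator {0<..} v * (2 / sqrt pi * exp (- v\<^sup>2) * exp (- ((\<epsilon> / (sqrt 2 * v))\<^sup>2 * (norm \<xi>)\<^sup>2 / 2)))"
  let ?h = "\<lambda>x. complex_of_real (?e (fst x) (snd x)) * cis (fst x \<bullet> z)"
  have e0: "?e \<xi> v \<ge> 0" for \<xi> v by (auto split: split_indicator)
  have inner: "(\<integral>\<^sup>+v. ennreal (?e \<xi> v) \<partial>lborel) = ennreal (exp (- (\<epsilon> * norm \<xi>)))" if "\<xi> \<noteq> 0" for \<xi>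
  proof -
    define r where "r = \<epsilon> * norm \<xi> / 2"
    have r: "r > 0" using \<epsilon> that by (simp add: r_def)
    have "(\<integral>\<^sup>+v. ennreal (?e \<xi> v) \<partial>lborel) = (\<integral>\<^sup>+v. ennreal (2 / sqrt pi) * (ennreal (exp (- v\<^sup>2 - r\<^sup>2 / v\<^sup>2)) * indicator {0<..} v) \<partial>lborel)"
    proof (rule nn_integral_cong)
      fix v
      have "exp (- v\<^sup>2) * exp (- ((\<epsilon> / (sqrt 2 * v))\<^sup>2 * (norm \<xi>)\<^sup>2 / 2)) = exp (- v\<^sup>2 - r\<^sup>2 / v\<^sup>2)"
        unfolding r_def by (simp add: mult_exp_exp power_mult_distrib power_divide)
      then have "2 / sqrt pi * exp (- v\<^sup>2) * exp (- ((\<epsilon> / (sqrt 2 * v))\<^sup>2 * (norm \<xi>)\<^sup>2 / 2)) = 2 / sqrt pi * exp (- v\<^sup>2 - r\<^sup>2 / v\<^sup>2)"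
        by (simp only: mult.assoc)
      then show "ennreal (?e \<xi> v) = ennreal (2 / sqrt pi) * (ennreal (exp (- v\<^sup>2 - r\<^sup>2 / v\<^sup>2)) * indicator {0<..} v)"
        by (simp add: ennreal_mult[symmetric] split: split_indicator)
    qed
    also have "\<dots> = ennreal (2 / sqrt pi) * ennreal (sqrt pi / 2 * exp (- (2 * r)))"
      by (subst nn_integral_cmult, measurable) (simp only: nn_integral_subordination[OF r])
    also have "\<dots> = ennreal (exp (- (\<epsilon> * norm \<xi>)))"
      by (subst ennreal_mult[symmetric]) (auto simp: r_def)
    finally show ?thesis .
  qed
  \<comment> \<open>The subordination formula requires \<open>r > 0\<close>, hence the origin is
    removed.\<close>
  have ae: "AE \<xi> in lborel. (\<xi>::'a) \<noteq> 0" by (rule AE_lborel_singleton)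
  have m[measurable]: "?h \<in> borel_measurable (lborel \<Otimes>\<^sub>M lborel)" by measurable
  have I: "integrable (lborel \<Otimes>\<^sub>M lborel) ?h"
  proof (rule integrableI_bounded)
    have "(\<integral>\<^sup>+x. ennreal (norm (?h x)) \<partial>(lborel \<Otimes>\<^sub>M lborel)) = (\<integral>\<^sup>+\<xi>. \<integral>\<^sup>+v. ennreal (norm (?h (\<xi>, v))) \<partial>lborel \<partial>lborel)"
      by (subst lborel.nn_integral_fst[symmetric]) auto
    also have "\<dots> = (\<integral>\<^sup>+\<xi>. \<integral>\<^sup>+v. ennreal (?e \<xi> v) \<partial>lborel \<partial>lborel)"
      by (intro nn_integral_cong) (simp only: fst_conv snd_conv norm_mult norm_of_real norm_cis mult_1_right abs_of_nonneg[OF e0])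
    also have "\<dots> = (\<integral>\<^sup>+\<xi>. ennreal (exp (- (\<epsilon> * norm (\<xi>::'a)))) \<partial>lborel)"
      by (rule nn_integral_cong_AE, rule AE_mp[OF ae], rule AE_I2, rule impI, rule inner)
    also have "\<dots> < \<infinity>" by (rule nn_integral_exp_neg_norm_finite[OF \<epsilon>])
    finally show "(\<integral>\<^sup>+x. ennreal (norm (?h x)) \<partial>(lborel \<Otimes>\<^sub>M lborel)) < \<infinity>" .
  qed (rule m)
  then have I': "integrable (lborel \<Otimes>\<^sub>M lborel) (\<lambda>(\<xi>, v). ?h (\<xi>, v))" by (simp only: case_prod_unfold prod.collapse)
  have v: "(\<integral>\<xi>. ?h (\<xi>, v) \<partial>lborel) = complex_of_real (poisson_mix \<epsilon> z v)" for v
  proof (cases "v > 0")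
    case True
    then have s: "\<epsilon> / (sqrt 2 * v) > 0" using \<epsilon> by simp
    have "(\<integral>\<xi>. ?h (\<xi>, v) \<partial>lborel) = (\<integral>\<xi>. complex_of_real (2 / sqrt pi * exp (- v\<^sup>2)) * (of_real (exp (- ((\<epsilon> / (sqrt 2 * v))\<^sup>2 * (norm \<xi>)\<^sup>2 / 2))) * cis (\<xi> \<bullet> z)) \<partial>lborel)"
      using True by (simp add: mult_ac)
    also have "\<dots> = complex_of_real (2 / sqrt pi * exp (- v\<^sup>2)) * of_real (gauss_ft (\<epsilon> / (sqrt 2 * v)) z)"
      unfolding integral_mult_right_zero integral_gaussian_cis[OF s] ..
    finally show ?thesis using True by (simp add: poisson_mix_def)
  qed (simp add: poisson_mix_def)
  have "integrable lborel (\<lambda>v. complex_of_real (poisson_mix \<epsilon> z v))"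
    using lborel_pair.integrable_snd[OF I'] unfolding v .
  then show "integrable lborel (poisson_mix \<epsilon> z)"
    by (simp only: complex_of_real_integrable_eq)
  have "complex_of_real (poisson \<epsilon> z) = (\<integral>v. \<integral>\<xi>. ?h (\<xi>, v) \<partial>lborel \<partial>lborel)"
    unfolding v poisson_def integral_complex_of_real ..
  also have "\<dots> = (\<integral>\<xi>. \<integral>v. ?h (\<xi>, v) \<partial>lborel \<partial>lborel)"
    by (rule lborel_pair.Fubini_integral[OF I'])
  also have "\<dots> = (\<integral>\<xi>. of_real (exp (- (\<epsilon> * norm \<xi>))) * cis (\<xi> \<bullet> z) \<partial>lborel)"
  proof (rule integral_cong_AE)
    show "(\<lambda>\<xi>. \<integral>v. ?h (\<xi>, v) \<partial>lborel) \<in> borel_measurable lborel"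
      using lborel_pair.integrable_fst[OF I'] by auto
    show "AE \<xi> in lborel. (\<integral>v. ?h (\<xi>, v) \<partial>lborel) = of_real (exp (- (\<epsilon> * norm \<xi>))) * cis (\<xi> \<bullet> z)"
      using ae
    proof eventually_elim
      case (elim \<xi>)
      have "has_bochner_integral lborel (?e \<xi>) (exp (- (\<epsilon> * norm \<xi>)))"
        by (rule has_bochner_integral_nn_integral) (use inner[OF elim] e0 in auto)
      then have "(\<integral>v. ?e \<xi> v \<partial>lborel) = exp (- (\<epsilon> * norm \<xi>))" by (rule has_bochner_integral_integral_eq)
      then show ?case by (simp only: fst_conv snd_conv integral_mult_left_zero integral_complex_of_real)
    qed
  qed measurable
  finally show "(\<integral>\<xi>. of_real (exp (- (\<epsilon> * norm \<xi>))) * cis (\<xi> \<bullet> z) \<partial>lborel) = complex_of_real (poisson \<epsilon> z)" by simp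
qed

lemma poisson_nonneg: "\<epsilon> > 0 \<Longrightarrow> poisson \<epsilon> z \<ge> 0"
  unfolding poisson_def by (intro integral_nonneg_AE AE_I2 poisson_mix_nonneg)

lemma nn_integral_poisson:
  fixes h :: "'a::euclidean_space \<Rightarrow> ennreal"
  assumes [measurable]: "h \<in> borel_measurable borel" and \<epsilon>: "\<epsilon> > 0"
  shows "(\<integral>\<^sup>+z. h z * ennreal (poisson \<epsilon> z) \<partial>lborel)
    = (\<integral>\<^sup>+v. ennreal (2 / sqrt pi * exp (- v\<^sup>2)) * indicator {0<..} v * (\<integral>\<^sup>+z. h z * ennreal (gauss_ft (\<epsilon> / (sqrt 2 * v)) z) \<partial>lborel) \<partial>lborel)"
proof -
  have m1[measurable]: "(\<lambda>x::'a \<times> real. poisson_mix \<epsilon> (fst x) (snd x)) \<in> borel_measurable (lborel \<Otimes>\<^sub>M lborel)"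
    by measurable
  have m2[measurable]: "poisson_mix \<epsilon> (z::'a) \<in> borel_measurable borel" for z
    using integrable_poisson_mix[OF \<epsilon>, of z] by auto
  have "(\<integral>\<^sup>+z. h z * ennreal (poisson \<epsilon> z) \<partial>lborel) = (\<integral>\<^sup>+z. \<integral>\<^sup>+v. h z * ennreal (poisson_mix \<epsilon> z v) \<partial>lborel \<partial>lborel)"
  proof (rule nn_integral_cong)
    fix z :: 'a
    have "ennreal (poisson \<epsilon> z) = (\<integral>\<^sup>+v. ennreal (poisson_mix \<epsilon> z v) \<partial>lborel)"
      unfolding poisson_def by (rule nn_integral_eq_integral[symmetric, OF integrable_poisson_mix[OF \<epsilon>]]) (simp add: poisson_mix_nonneg \<epsilon>)
    then show "h z * ennreal (poisson \<epsilon> z) = (\<integral>\<^sup>+v. h z * ennreal (poisson_mix \<epsilon> z v) \<partial>lborel)"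
      by (simp add: nn_integral_cmult)
  qed
  also have "\<dots> = (\<integral>\<^sup>+v. \<integral>\<^sup>+z. h z * ennreal (poisson_mix \<epsilon> z v) \<partial>lborel \<partial>lborel)"
    by (rule lborel_pair.Fubini'[symmetric]) (simp add: case_prod_unfold)
  also have "\<dots> = (\<integral>\<^sup>+v. ennreal (2 / sqrt pi * exp (- v\<^sup>2)) * indicator {0<..} v * (\<integral>\<^sup>+z. h z * ennreal (gauss_ft (\<epsilon> / (sqrt 2 * v)) z) \<partial>lborel) \<partial>lborel)"
  proof (rule nn_integral_cong)
    fix v :: real
    show "(\<integral>\<^sup>+z. h z * ennreal (poisson_mix \<epsilon> z v) \<partial>lborel) = ennreal (2 / sqrt pi * exp (- v\<^sup>2)) * indicator {0<..} v * (\<integral>\<^sup>+z. h z * ennreal (gauss_ft (\<epsilon> / (sqrt 2 * v)) z) \<partial>lborel)"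
    proof (cases "v > 0")
      case True
      have "(\<integral>\<^sup>+z. h z * ennreal (poisson_mix \<epsilon> z v) \<partial>lborel) = (\<integral>\<^sup>+z. ennreal (2 / sqrt pi * exp (- v\<^sup>2)) * (h z * ennreal (gauss_ft (\<epsilon> / (sqrt 2 * v)) z)) \<partial>lborel)"
      proof (rule nn_integral_cong)
        fix z :: 'a
        have "ennreal (poisson_mix \<epsilon> z v) = ennreal (2 / sqrt pi * exp (- v\<^sup>2) * gauss_ft (\<epsilon> / (sqrt 2 * v)) z)"
          using True by (simp add: poisson_mix_def)
        also have "\<dots> = ennreal (2 / sqrt pi * exp (- v\<^sup>2)) * ennreal (gauss_ft (\<epsilon> / (sqrt 2 * v)) z)"
          using True \<epsilon> by (intro ennreal_mult gauss_ft_nonneg) auto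
        finally show "h z * ennreal (poisson_mix \<epsilon> z v) = ennreal (2 / sqrt pi * exp (- v\<^sup>2)) * (h z * ennreal (gauss_ft (\<epsilon> / (sqrt 2 * v)) z))"
          by (simp only: mult_ac)
      qed
      also have "\<dots> = ennreal (2 / sqrt pi * exp (- v\<^sup>2)) * (\<integral>\<^sup>+z. h z * ennreal (gauss_ft (\<epsilon> / (sqrt 2 * v)) z) \<partial>lborel)"
        by (rule nn_integral_cmult) measurable
      finally show ?thesis using True by simp
    qed (simp add: poisson_mix_def)
  qed
  finally show ?thesis .
qed

lemma nn_integral_gauss_half: "(\<integral>\<^sup>+v. ennreal (exp (- v\<^sup>2)) * indicator {0<..} v \<partial>lborel) = ennreal (sqrt pi / 2)"
proof -
  have "AE v in lborel. (v::real) \<noteq> 0" by (rule AE_lborel_singleton)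
  then have "(\<integral>\<^sup>+v. ennreal (exp (- v\<^sup>2)) * indicator {0<..} v \<partial>lborel) = (\<integral>\<^sup>+v. ennreal (indicator {0..} v *\<^sub>R exp (- v\<^sup>2)) \<partial>lborel)"
    by (intro nn_integral_cong_AE) (auto elim!: eventually_mono split: split_indicator)
  also have "\<dots> = ennreal (sqrt pi / 2)"
    using gaussian_moment_0 by (subst nn_integral_eq_integral) (auto simp: has_bochner_integral_iff split: split_indicator)
  finally show ?thesis .
qed

lemma has_bochner_integral_poisson:
  assumes \<epsilon>: "\<epsilon> > 0"
  shows "has_bochner_integral lborel (poisson \<epsilon> :: 'a::euclidean_space \<Rightarrow> real) (gauss_moment TYPE('a) 0)"
proof (rule has_bochner_integral_nn_integral)
  have "(\<integral>\<^sup>+z. ennreal (poisson \<epsilon> (z::'a)) \<partial>lborel) = (\<integral>\<^sup>+z. 1 * ennreal (poisson \<epsilon> (z::'a)) \<partial>lborel)" by simp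
  also have "\<dots> = (\<integral>\<^sup>+v. ennreal (2 / sqrt pi * exp (- v\<^sup>2)) * indicator {0<..} v * (\<integral>\<^sup>+z. 1 * ennreal (gauss_ft (\<epsilon> / (sqrt 2 * v)) (z::'a)) \<partial>lborel) \<partial>lborel)"
    by (rule nn_integral_poisson[OF _ \<epsilon>]) measurable
  also have "\<dots> = (\<integral>\<^sup>+v. ennreal (2 / sqrt pi * gauss_moment TYPE('a) 0) * (ennreal (exp (- v\<^sup>2)) * indicator {0<..} v) \<partial>lborel)"
  proof (rule nn_integral_cong)
    fix v :: real
    show "ennreal (2 / sqrt pi * exp (- v\<^sup>2)) * indicator {0<..} v * (\<integral>\<^sup>+z. 1 * ennreal (gauss_ft (\<epsilon> / (sqrt 2 * v)) (z::'a)) \<partial>lborel)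
      = ennreal (2 / sqrt pi * gauss_moment TYPE('a) 0) * (ennreal (exp (- v\<^sup>2)) * indicator {0<..} v)"
    proof (cases "v > 0")
      case True
      then have "(\<integral>\<^sup>+z. 1 * ennreal (gauss_ft (\<epsilon> / (sqrt 2 * v)) (z::'a)) \<partial>lborel) = ennreal (gauss_moment TYPE('a) 0)"
        using nn_integral_gauss_moment[of "\<epsilon> / (sqrt 2 * v)" 0, where 'a='a] \<epsilon> by simp
      then show ?thesis using True gauss_moment_nonneg[of 0, where 'a='a] by (simp add: ennreal_mult[symmetric] mult_ac)
    qed simp
  qed
  also have "\<dots> = ennreal (2 / sqrt pi * gauss_moment TYPE('a) 0) * ennreal (sqrt pi / 2)"
    by (subst nn_integral_cmult, measurable) (simp only: nn_integral_gauss_half)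
  also have "\<dots> = ennreal (gauss_moment TYPE('a) 0)"
    using gauss_moment_nonneg[of 0, where 'a='a] by (subst ennreal_mult[symmetric]) auto
  finally show "(\<integral>\<^sup>+z. ennreal (poisson \<epsilon> (z::'a)) \<partial>lborel) = ennreal (gauss_moment TYPE('a) 0)" .
qed (use poisson_nonneg[OF \<epsilon>] gauss_moment_nonneg in auto)

text \<open>The increment of \<open>f\<close> is at most both 2 and \<open>L\<close> times the
  distance, and both bounds are needed because the kernel has no finite first moment. A mixture
  component of width comparable to \<open>\<epsilon> / v\<close> contributes an error of order
  \<open>min 1 (\<epsilon> / v)\<close>; integrating this over the scales between \<epsilon> and 1
  creates the logarithm. The factor \<open>gauss_moment TYPE('a) 0\<close> is the mass of the
  kernel.\<close>

lemma poisson_smoothing_error: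
  fixes f :: "'a::euclidean_space \<Rightarrow> real"
  assumes lip: "\<And>x y. \<bar>f x - f y\<bar> \<le> L * norm (x - y)" and bd: "\<And>x. \<bar>f x\<bar> \<le> 1"
    and fm[measurable]: "f \<in> borel_measurable borel" and L: "L \<ge> 0" and \<epsilon>: "0 < \<epsilon>" "\<epsilon> \<le> exp (- 1)"
  shows "\<bar>(\<integral>y. f y * poisson \<epsilon> (x - y) \<partial>lborel) - gauss_moment TYPE('a) 0 * f x\<bar>
    \<le> 2 * (2 * gauss_moment TYPE('a) 0 + L * gauss_moment TYPE('a) 1) * (3 * (\<epsilon> * ln (1 / \<epsilon>)))"
proof -
  let ?P = "poisson \<epsilon> :: 'a \<Rightarrow> real"
  let ?m0 = "gauss_moment TYPE('a) 0" and ?m1 = "gauss_moment TYPE('a) 1"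
  let ?D = "2 * ?m0 + L * ?m1"
  \<comment> \<open>One term for each range: up to \<epsilon> the bound by 2 is used, from
    \<epsilon> to 1 the Lipschitz bound, and beyond 1 the Lipschitz bound together with the decay of
    the mixing weight.\<close>
  let ?W = "\<lambda>v. ennreal 1 * indicator {0..\<epsilon>} v + (ennreal (\<epsilon> / v) * indicator {\<epsilon>..1} v + ennreal \<epsilon> * (ennreal (exp (- v\<^sup>2)) * indicator {0<..} v))"
  have m: "?m0 \<ge> 0" "?m1 \<ge> 0" by (rule gauss_moment_nonneg)+
  have D: "?D \<ge> 0" using m L by simp
  have P0: "?P z \<ge> 0" for z by (rule poisson_nonneg[OF \<epsilon>(1)])
  \<comment> \<open>Thus \<epsilon> is at most \<open>\<epsilon> * ln (1 / \<epsilon>)\<close>, and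
    each of the three terms of the majorant integrates to at most this quantity; hence the final
    factor 3.\<close>
  have "ln \<epsilon> \<le> - 1" using \<epsilon> by (metis ln_exp ln_mono exp_gt_zero)
  then have ln: "ln (1 / \<epsilon>) \<ge> 1" using \<epsilon> by (simp add: ln_div)
  have eln0: "0 \<le> \<epsilon> * ln (1 / \<epsilon>)" using \<epsilon> ln by (intro mult_nonneg_nonneg) linarith+
  have \<epsilon>1: "\<epsilon> \<le> 1" using \<epsilon>(2) exp_le_one_iff[of "- 1::real"] by linarith
  have hP: "has_bochner_integral lborel (\<lambda>y. ?P (x - y)) ?m0"
  proof (rule has_bochner_integral_nn_integral)
    have "(\<integral>\<^sup>+y. ennreal (?P (x - y)) \<partial>lborel) = (\<integral>\<^sup>+y. ennreal (?P y) \<partial>lborel)"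
      by (rule nn_integral_lborel_reflect) measurable
    also have "\<dots> = ennreal ?m0"
      using has_bochner_integral_poisson[OF \<epsilon>(1), where 'a='a] P0
      by (subst nn_integral_eq_integral) (auto simp: has_bochner_integral_iff)
    finally show "(\<integral>\<^sup>+y. ennreal (?P (x - y)) \<partial>lborel) = ennreal ?m0" .
  qed (use P0 m in auto)
  then have iP: "integrable lborel (\<lambda>y. ?P (x - y))" "(\<integral>y. ?P (x - y) \<partial>lborel) = ?m0"
    by (auto simp: has_bochner_integral_iff)
  have ifP: "integrable lborel (\<lambda>y. f y * ?P (x - y))"
    by (rule Bochner_Integration.integrable_bound[OF iP(1)])
       (use bd P0 in \<open>auto simp: abs_mult mult_left_le_one_le\<close>)
  have icP: "integrable lborel (\<lambda>y. f x * ?P (x - y))" using iP(1) by (rule integrable_mult_right)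
  have "(\<integral>y. f y * ?P (x - y) \<partial>lborel) - ?m0 * f x = (\<integral>y. f y * ?P (x - y) - f x * ?P (x - y) \<partial>lborel)"
    unfolding Bochner_Integration.integral_diff[OF ifP icP] integral_mult_right_zero iP(2) by (simp only: mult.commute)
  then have "ennreal \<bar>(\<integral>y. f y * ?P (x - y) \<partial>lborel) - ?m0 * f x\<bar> \<le> (\<integral>\<^sup>+y. ennreal (norm (f y * ?P (x - y) - f x * ?P (x - y))) \<partial>lborel)"
    using norm_integral_le_nn_integral[of lborel "\<lambda>y. f y * ?P (x - y) - f x * ?P (x - y)"] by simp
  also have "\<dots> \<le> (\<integral>\<^sup>+y. ennreal (min 2 (L * norm (x - y))) * ennreal (?P (x - y)) \<partial>lborel)"
  proof (rule nn_integral_mono)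
    fix y
    have "\<bar>f y - f x\<bar> \<le> min 2 (L * norm (x - y))"
      using lip[of y x] bd[of x] bd[of y] by (auto simp: norm_minus_commute)
    then have "\<bar>f y - f x\<bar> * ?P (x - y) \<le> min 2 (L * norm (x - y)) * ?P (x - y)"
      using P0 by (rule mult_right_mono)
    then have "norm (f y * ?P (x - y) - f x * ?P (x - y)) \<le> min 2 (L * norm (x - y)) * ?P (x - y)"
      using P0[of "x - y"] by (simp add: left_diff_distrib[symmetric] abs_mult)
    then show "ennreal (norm (f y * ?P (x - y) - f x * ?P (x - y))) \<le> ennreal (min 2 (L * norm (x - y))) * ennreal (?P (x - y))"
      using L P0[of "x - y"] by (subst ennreal_mult[symmetric]) (auto intro: ennreal_leI)
  qed
  also have "\<dots> = (\<integral>\<^sup>+z. ennreal (min 2 (L * norm z)) * ennreal (?P z) \<partial>lborel)"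
    by (rule nn_integral_lborel_reflect) measurable
  also have "\<dots> = (\<integral>\<^sup>+v. ennreal (2 / sqrt pi * exp (- v\<^sup>2)) * indicator {0<..} v * (\<integral>\<^sup>+z. ennreal (min 2 (L * norm (z::'a))) * ennreal (gauss_ft (\<epsilon> / (sqrt 2 * v)) z) \<partial>lborel) \<partial>lborel)"
    by (rule nn_integral_poisson[OF _ \<epsilon>(1)]) measurable
  also have "\<dots> \<le> (\<integral>\<^sup>+v. ennreal (2 * ?D) * ?W v \<partial>lborel)"
  proof (rule nn_integral_mono)
    fix v :: real
    let ?c = "2 / sqrt pi * exp (- v\<^sup>2)"
    let ?G = "\<integral>\<^sup>+z. ennreal (min 2 (L * norm (z::'a))) * ennreal (gauss_ft (\<epsilon> / (sqrt 2 * v)) z) \<partial>lborel"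
    show "ennreal ?c * indicator {0<..} v * ?G \<le> ennreal (2 * ?D) * ?W v"
    proof (cases "v > 0")
      case True
      let ?s = "\<epsilon> / (sqrt 2 * v)"
      have s: "?s > 0" using True \<epsilon> by simp
      have g: "gauss_ft ?s z \<ge> 0" for z :: 'a by (rule gauss_ft_nonneg[OF s])
      have "?G \<le> (\<integral>\<^sup>+z. ennreal 2 * ennreal (norm z ^ 0 * gauss_ft ?s (z::'a)) \<partial>lborel)"
        by (intro nn_integral_mono mult_mono ennreal_leI) auto
      also have "\<dots> = ennreal 2 * ennreal (?s ^ 0 * ?m0)"
        by (subst nn_integral_cmult, measurable) (subst nn_integral_gauss_moment[OF s], simp_all)
      also have "\<dots> = ennreal (2 * ?m0)" using m by (simp add: ennreal_mult)
      finally have G1: "?G \<le> ennreal (2 * ?m0)" .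
      have "?G \<le> (\<integral>\<^sup>+z. ennreal L * ennreal (norm z ^ 1 * gauss_ft ?s (z::'a)) \<partial>lborel)"
      proof (rule nn_integral_mono)
        fix z :: 'a
        have "min 2 (L * norm z) * gauss_ft ?s z \<le> L * norm z * gauss_ft ?s z"
          using g by (intro mult_right_mono) auto
        then show "ennreal (min 2 (L * norm z)) * ennreal (gauss_ft ?s z) \<le> ennreal L * ennreal (norm z ^ 1 * gauss_ft ?s z)"
          using L g[of z] by (simp add: ennreal_mult[symmetric] ennreal_leI mult.assoc)
      qed
      also have "\<dots> = ennreal L * ennreal (?s ^ 1 * ?m1)"
        by (subst nn_integral_cmult, measurable) (subst nn_integral_gauss_moment[OF s], simp_all)
      also have "\<dots> = ennreal (L * (?s * ?m1))"
        using mult_nonneg_nonneg[OF less_imp_le[OF s] m(2)] by (simp only: power_one_right ennreal_mult[OF L])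
      also have "\<dots> \<le> ennreal (L * (\<epsilon> / v * ?m1))"
      proof (intro ennreal_leI mult_left_mono mult_right_mono)
        have "1 * v \<le> sqrt 2 * v" using True by (intro mult_right_mono) auto
        then show "?s \<le> \<epsilon> / v" using True \<epsilon> by (intro divide_left_mono) auto
      qed (use L m in auto)
      finally have G2: "?G \<le> ennreal (L * (\<epsilon> / v * ?m1))" .
      have s2: "2 / sqrt pi \<le> 2"
      proof -
        have "1 \<le> sqrt pi" using pi_gt3 by simp
        then show ?thesis by (simp add: divide_le_eq)
      qed
      have e1: "exp (- v\<^sup>2) \<le> 1" by simp
      have c0: "?c \<ge> 0" by simp
      have c2: "?c \<le> 2 * exp (- v\<^sup>2)" using s2 by (intro mult_right_mono) auto
      have c2': "?c \<le> 2" using c2 e1 by linarith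
      show ?thesis
      proof (cases "v \<le> \<epsilon>")
        case le: True
        have "ennreal ?c * ?G \<le> ennreal 2 * ennreal (2 * ?m0)"
          by (intro mult_mono ennreal_leI c2' G1) auto
        also have "\<dots> = ennreal (2 * (2 * ?m0))" using m by (intro ennreal_mult[symmetric]) auto
        also have "\<dots> \<le> ennreal (2 * ?D)" using m L by (intro ennreal_leI) auto
        also have "\<dots> = ennreal (2 * ?D) * 1" by simp
        also have "\<dots> \<le> ennreal (2 * ?D) * ?W v"
          using le True by (intro mult_left_mono) (auto intro: add_increasing2)
        finally show ?thesis using True by simp
      next
        case gt: False
        have LD: "L * (\<epsilon> / v * ?m1) \<le> ?D * (\<epsilon> / v)"
          using m L True \<epsilon> by (simp add: field_simps)
        show ?thesis
        proof (cases "v \<le> 1")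
          case le1: True
          have "ennreal ?c * ?G \<le> ennreal 2 * ennreal (?D * (\<epsilon> / v))"
            by (intro mult_mono ennreal_leI c2' order_trans[OF G2] LD) auto
          also have "\<dots> = ennreal (2 * ?D) * ennreal (\<epsilon> / v)"
            using D True \<epsilon> by (simp only: ennreal_mult[symmetric] mult.assoc[symmetric] mult_nonneg_nonneg divide_nonneg_pos less_imp_le zero_le_numeral)
          also have "\<dots> \<le> ennreal (2 * ?D) * ?W v"
            using le1 gt True by (intro mult_left_mono) (auto intro: add_increasing add_increasing2)
          finally show ?thesis using True by simp
        next
          case gt1: False
          have "\<epsilon> / v \<le> \<epsilon> / 1" using gt1 \<epsilon> by (intro divide_left_mono) auto
          then have "?D * (\<epsilon> / v) \<le> ?D * \<epsilon>" using D by (intro mult_left_mono) auto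
          then have X: "L * (\<epsilon> / v * ?m1) \<le> ?D * \<epsilon>" using LD by linarith
          have "ennreal ?c * ?G \<le> ennreal (2 * exp (- v\<^sup>2)) * ennreal (?D * \<epsilon>)"
            by (rule mult_mono[OF ennreal_leI[OF c2] order_trans[OF G2 ennreal_leI[OF X]]]) auto
          also have "\<dots> = ennreal (2 * ?D) * (ennreal \<epsilon> * ennreal (exp (- v\<^sup>2)))"
          proof -
            have D2: "0 \<le> 2 * ?D" using D by simp
            have "ennreal (2 * exp (- v\<^sup>2)) * ennreal (?D * \<epsilon>) = ennreal (2 * exp (- v\<^sup>2) * (?D * \<epsilon>))"
              using D \<epsilon> by (intro ennreal_mult[symmetric]) auto
            also have "2 * exp (- v\<^sup>2) * (?D * \<epsilon>) = 2 * ?D * (\<epsilon> * exp (- v\<^sup>2))" by simp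
            also have "ennreal \<dots> = ennreal (2 * ?D) * ennreal (\<epsilon> * exp (- v\<^sup>2))"
              using D2 \<epsilon> by (intro ennreal_mult) auto
            also have "ennreal (\<epsilon> * exp (- v\<^sup>2)) = ennreal \<epsilon> * ennreal (exp (- v\<^sup>2))"
              using \<epsilon> by (intro ennreal_mult) auto
            finally show ?thesis .
          qed
          also have "\<dots> \<le> ennreal (2 * ?D) * ?W v"
            using gt1 gt True by (intro mult_left_mono) (auto intro: add_increasing add_increasing2)
          finally show ?thesis using True by simp
        qed
      qed
    qed simp
  qed
  also have "\<dots> = ennreal (2 * ?D) * (\<integral>\<^sup>+v. ?W v \<partial>lborel)"
    by (rule nn_integral_cmult) measurable
  also have "(\<integral>\<^sup>+v. ?W v \<partial>lborel)
     = ennreal \<epsilon> + (ennreal (\<epsilon> * ln (1 / \<epsilon>)) + ennreal \<epsilon> * ennreal (sqrt pi / 2))"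
  proof -
    have 1: "(\<integral>\<^sup>+v. ennreal 1 * indicator {0..\<epsilon>} v \<partial>lborel) = ennreal \<epsilon>"
      using \<epsilon> by simp
    have 2: "(\<integral>\<^sup>+v. ennreal (\<epsilon> / v) * indicator {\<epsilon>..1} v \<partial>lborel) = ennreal (\<epsilon> * ln 1 - \<epsilon> * ln \<epsilon>)"
      using \<epsilon> \<epsilon>1 by (intro nn_integral_FTC_Icc) (auto intro!: derivative_eq_intros simp: field_simps)
    have 3: "(\<integral>\<^sup>+v. ennreal \<epsilon> * (ennreal (exp (- v\<^sup>2)) * indicator {0<..} v) \<partial>lborel) = ennreal \<epsilon> * ennreal (sqrt pi / 2)"
      by (subst nn_integral_cmult, measurable) (simp only: nn_integral_gauss_half)
    show ?thesis
      by (subst nn_integral_add, measurable, subst nn_integral_add, measurable) (use \<epsilon> in \<open>simp only: 1 2 3, simp add: ln_div\<close>)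
  qed
  also have "\<dots> \<le> ennreal (3 * (\<epsilon> * ln (1 / \<epsilon>)))"
  proof -
    have "sqrt pi \<le> 2" using pi_less_4 real_sqrt_le_mono[of pi 4] by simp
    then have "\<epsilon> * (sqrt pi / 2) \<le> \<epsilon> * 1" using \<epsilon> by (intro mult_left_mono) auto
    moreover have "\<epsilon> * 1 \<le> \<epsilon> * ln (1 / \<epsilon>)" using \<epsilon> ln by (intro mult_left_mono) auto
    ultimately have "\<epsilon> + (\<epsilon> * ln (1 / \<epsilon>) + \<epsilon> * (sqrt pi / 2)) \<le> 3 * (\<epsilon> * ln (1 / \<epsilon>))" by linarith
    moreover have "ennreal \<epsilon> + (ennreal (\<epsilon> * ln (1 / \<epsilon>)) + ennreal \<epsilon> * ennreal (sqrt pi / 2)) = ennreal (\<epsilon> + (\<epsilon> * ln (1 / \<epsilon>) + \<epsilon> * (sqrt pi / 2)))"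
    proof -
      have "0 \<le> \<epsilon> * ln (1 / \<epsilon>)" using \<epsilon> ln by (intro mult_nonneg_nonneg) linarith+
      then show ?thesis using \<epsilon> by (simp only: ennreal_mult[symmetric] ennreal_plus[symmetric] less_imp_le mult_nonneg_nonneg add_nonneg_nonneg real_sqrt_ge_zero pi_ge_zero divide_nonneg_pos zero_less_numeral)
    qed
    ultimately show ?thesis by (simp add: ennreal_leI)
  qed
  finally have "ennreal \<bar>(\<integral>y. f y * ?P (x - y) \<partial>lborel) - ?m0 * f x\<bar> \<le> ennreal (2 * ?D) * ennreal (3 * (\<epsilon> * ln (1 / \<epsilon>)))"
    by (simp add: mult_left_mono)
  also have "\<dots> = ennreal (2 * ?D * (3 * (\<epsilon> * ln (1 / \<epsilon>))))"
    by (intro ennreal_mult[symmetric] mult_nonneg_nonneg[OF _ D] mult_nonneg_nonneg[OF _ eln0]) simp_all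
  finally show ?thesis
  proof (subst (asm) ennreal_le_iff)
    show "0 \<le> 2 * ?D * (3 * (\<epsilon> * ln (1 / \<epsilon>)))"
      by (intro mult_nonneg_nonneg[OF mult_nonneg_nonneg[OF _ D] mult_nonneg_nonneg[OF _ eln0]]) simp_all
  qed
qed

subsection \<open>Approximation on the unit ball\<close>

lemma pos_power_scale: "c > 0 \<Longrightarrow> pos_power \<alpha> (c * t) = c ^ \<alpha> * pos_power \<alpha> t"
  by (simp add: pos_power_def power_mult_distrib zero_less_mult_iff)

lemma pos_power_measurable [measurable]: "pos_power \<alpha> \<in> borel_measurable borel"
  unfolding pos_power_def[abs_def] by measurable

lemma pos_power_nonneg: "pos_power \<alpha> t \<ge> 0"
  by (simp add: pos_power_def)

lemma pos_power_le: "\<bar>t\<bar> \<le> a \<Longrightarrow> 1 \<le> a \<Longrightarrow> pos_power \<alpha> t \<le> a ^ \<alpha>"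
  by (auto simp: pos_power_def intro!: power_mono)

text \<open>The inverse power of order \<open>d\<close> is, up to a factorial, the Laplace integral
  of \<open>r ^ (d - 1)\<close>. Together with the average over the shell this is exactly the octave
  form of polar coordinates, so the Fourier transform of
  \<open>exp (- (\<epsilon> * norm \<xi>))\<close> appears, times \<open>ln 2\<close>.\<close>

lemma shell_average_power:
  fixes z :: "'a::euclidean_space" assumes \<epsilon>: "\<epsilon> > 0"
  defines "H \<equiv> \<lambda>w. indicator {w. 1 \<le> norm w \<and> norm w < 2} w *\<^sub>R (1 / (complex_of_real (\<epsilon> * norm w) - \<i> * of_real (w \<bullet> z)) ^ DIM('a))"
  shows "integral\<^sup>L lborel H = of_real (ln 2 / fact (DIM('a) - 1) * poisson \<epsilon> z)"
proof -
  define n where "n = DIM('a)"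
  have n: "n = Suc (n - 1)" unfolding n_def by simp
  let ?F = "\<lambda>\<xi>. of_real (exp (- (\<epsilon> * norm \<xi>))) * cis (\<xi> \<bullet> z)"
  let ?S = "{w::'a. 1 \<le> norm w \<and> norm w < 2}"
  let ?G = "\<lambda>(w::'a, r). (r ^ (n - 1) * indicator {0<..} r * indicator ?S w) *\<^sub>R ?F (r *\<^sub>R w)"
  have F: "integrable lborel ?F"
    using integrable_exp_neg_norm[OF \<epsilon>, where 'a='a] by (intro integrable_mult_cis) (simp_all only: complex_of_real_integrable_eq, measurable)
  have G: "integrable (lborel \<Otimes>\<^sub>M lborel) ?G" "integral\<^sup>L (lborel \<Otimes>\<^sub>M lborel) ?G = ln 2 *\<^sub>R integral\<^sup>L lborel ?F"
    using integral_polar_octave[OF F] unfolding n_def by auto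
  have inner: "(\<integral>r. ?G (w, r) \<partial>lborel) = fact (n - 1) * H w" for w
  proof (cases "w \<in> ?S")
    case True
    let ?A = "complex_of_real (\<epsilon> * norm w) - \<i> * of_real (w \<bullet> z)"
    have w: "w \<noteq> 0" using True by auto
    have A: "Re ?A > 0" using w \<epsilon> by simp
    have "(\<integral>r. ?G (w, r) \<partial>lborel) = (\<integral>r. indicator {0..} r *\<^sub>R (of_real r ^ (n - 1) * exp (- (of_real r * ?A))) \<partial>lborel)"
    proof (rule integral_cong_AE)
      have "AE r in lborel. (r::real) \<noteq> 0" by (rule AE_lborel_singleton)
      then show "AE r in lborel. ?G (w, r) = indicator {0..} r *\<^sub>R (of_real r ^ (n - 1) * exp (- (of_real r * ?A)))"
      proof eventually_elim
        case (elim r)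
        show ?case
        proof (cases "r > 0")
          case r: True
          have "?F (r *\<^sub>R w) = exp (- (of_real r * ?A))"
            using r by (simp add: cis_conv_exp exp_of_real[symmetric] exp_add[symmetric] algebra_simps)
          then show ?thesis using r True by (simp only: prod.case) (simp add: scaleR_conv_of_real)
        qed (use elim in auto)
      qed
    qed measurable
    also have "\<dots> = fact (n - 1) / ?A ^ Suc (n - 1)" by (rule integral_power_exp_complex[OF A])
    also have "\<dots> = fact (n - 1) * H w" unfolding H_def n_def[symmetric] using True n by simp
    finally show ?thesis .
  qed (simp add: H_def)
  have "fact (n - 1) * integral\<^sup>L lborel H = (\<integral>w. \<integral>r. ?G (w, r) \<partial>lborel \<partial>lborel)"
    unfolding inner integral_mult_right_zero ..
  also have "\<dots> = integral\<^sup>L (lborel \<Otimes>\<^sub>M lborel) ?G"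
    using lborel_pair.integral_fst'[OF G(1)] .
  also have "\<dots> = of_real (ln 2 * poisson \<epsilon> z)"
    unfolding G(2) integral_exp_neg_norm_cis[OF \<epsilon>] by (simp add: scaleR_conv_of_real)
  finally show ?thesis unfolding n_def by (simp add: field_simps)
qed

text \<open>Shifting \<open>b\<close> by \<open>w \<bullet> x\<close> turns the activation into
  \<open>t ^ \<alpha>\<close> on the positive half line. After exchanging with the integral over
  \<open>y\<close>, the inner integral is the Beta integral at \<open>A y\<close>, whose real part
  \<open>\<epsilon> * norm w\<close> is positive since \<open>w \<noteq> 0\<close>.\<close>

lemma
  fixes f :: "'a::euclidean_space \<Rightarrow> real"
  assumes f: "integrable lborel f" and supp: "\<And>x. norm x > 2 \<Longrightarrow> f x = 0"
    and \<epsilon>: "\<epsilon> > 0" and w: "w \<noteq> 0" and n: "n \<ge> 1"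
  shows integrable_pos_power_ridge_transform:
      "integrable lborel (\<lambda>b. of_real (pos_power \<alpha> (w \<bullet> x + b)) * ridge_transform \<epsilon> (\<alpha> + Suc n) f (w, b))"
    and integral_pos_power_ridge_transform: "\<i> ^ Suc \<alpha> * (\<integral>b. of_real (pos_power \<alpha> (w \<bullet> x + b)) * ridge_transform \<epsilon> (\<alpha> + Suc n) f (w, b) \<partial>lborel)
    = of_real (fact \<alpha> * fact (n - 1) / fact (\<alpha> + n)) * (\<integral>y. of_real (f y) * (1 / (of_real (\<epsilon> * norm w) - \<i> * of_real (w \<bullet> (x - y))) ^ n) \<partial>lborel)"
proof -
  have [measurable]: "f \<in> borel_measurable borel" using f by auto
  define A where "A y = complex_of_real (\<epsilon> * norm w) - \<i> * of_real (w \<bullet> (x - y))" for y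
  have A_measurable[measurable]: "A \<in> borel_measurable borel" unfolding A_def[abs_def] by measurable
  have ReA: "Re (A y) = \<epsilon> * norm w" for y by (simp add: A_def)
  have RA: "Re (A y) > 0" for y using \<epsilon> w by (simp add: ReA)
  let ?c = "complex_of_real (fact \<alpha> * fact (n - 1) / fact (\<alpha> + n))"
  \<comment> \<open>Bounds the ratio \<open>(1 + cmod (A y) + Re (A y)) / Re (A y)\<close> of the
    Beta majorant for all \<open>y\<close> in the support of \<open>f\<close>, which makes the
    majorant integrable on the product.\<close>
  define D where "D = (1 + (\<epsilon> * norm w + norm w * (norm x + 2)) + \<epsilon> * norm w) / (\<epsilon> * norm w)"
  have D0: "D \<ge> 0" unfolding D_def using \<epsilon> by (intro divide_nonneg_nonneg add_nonneg_nonneg mult_nonneg_nonneg) auto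
  have An: "cmod (A y) \<le> \<epsilon> * norm w + norm w * (norm x + 2)" if "norm y \<le> 2" for y
  proof -
    have "cmod (A y) \<le> cmod (complex_of_real (\<epsilon> * norm w)) + cmod (\<i> * of_real (w \<bullet> (x - y)))"
      unfolding A_def by (rule norm_triangle_ineq4)
    also have "\<dots> = \<epsilon> * norm w + \<bar>w \<bullet> (x - y)\<bar>" using \<epsilon> by (simp add: norm_mult)
    also have "\<bar>w \<bullet> (x - y)\<bar> \<le> norm w * norm (x - y)" by (rule Cauchy_Schwarz_ineq2)
    also have "\<dots> \<le> norm w * (norm x + 2)"
      using norm_triangle_ineq4[of x y] that by (intro mult_left_mono) auto
    finally show ?thesis by simp
  qed
  let ?K = "\<lambda>t y. indicator {0..} t *\<^sub>R (of_real t ^ \<alpha> / (A y + \<i> * of_real t) ^ (\<alpha> + Suc n))"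
  have K: "cmod (of_real (f y) * ?K t y) \<le> \<bar>f y\<bar> * (D ^ (\<alpha> + Suc n) * (indicator {0..} t * (1 / (1 + t)\<^sup>2)))" for t y
  proof (cases "norm y \<le> 2 \<and> t \<ge> 0")
    case True
    then have t: "t \<ge> 0" by simp
    have "cmod (of_real t ^ \<alpha> / (A y + \<i> * of_real t) ^ (\<alpha> + Suc n)) \<le> ((1 + cmod (A y) + Re (A y)) / Re (A y)) ^ (\<alpha> + Suc n) / (1 + t) ^ Suc n"
      by (rule cmod_beta_le[OF RA t])
    also have "\<dots> \<le> D ^ (\<alpha> + Suc n) / (1 + t) ^ 2"
    proof (rule frac_le)
      show "((1 + cmod (A y) + Re (A y)) / Re (A y)) ^ (\<alpha> + Suc n) \<le> D ^ (\<alpha> + Suc n)"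
        unfolding D_def ReA using An[of y] True \<epsilon> w by (intro power_mono divide_right_mono add_mono divide_nonneg_nonneg add_nonneg_nonneg) auto
      show "(1 + t) ^ 2 \<le> (1 + t) ^ Suc n" using t n by (intro power_increasing) auto
    qed (use D0 t in auto)
    finally have "cmod (of_real t ^ \<alpha> / (A y + \<i> * of_real t) ^ (\<alpha> + Suc n)) \<le> D ^ (\<alpha> + Suc n) * (1 / (1 + t)\<^sup>2)" by simp
    then show ?thesis unfolding norm_mult using t by (intro mult_mono) auto
  next
    case False
    have "0 \<le> \<bar>f y\<bar> * (D ^ (\<alpha> + Suc n) * (indicator {0..} t * (1 / (1 + t)\<^sup>2)))"
      using D0 by (intro mult_nonneg_nonneg) auto
    then show ?thesis using False supp[of y] by auto
  qed
  have I: "integrable (lborel \<Otimes>\<^sub>M lborel) (\<lambda>(t, y). of_real (f y) * ?K t y)"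
  proof (rule Bochner_Integration.integrable_bound)
    have 1: "integrable lborel (\<lambda>t::real. complex_of_real (D ^ (\<alpha> + Suc n) * (indicator {0..} t * (1 / (1 + t)\<^sup>2))))"
      unfolding complex_of_real_integrable_eq by (intro integrable_mult_right integrable_inverse_square_Ici)
    have 2: "integrable lborel (\<lambda>y. complex_of_real \<bar>f y\<bar>)"
      unfolding complex_of_real_integrable_eq by (rule integrable_abs[OF f])
    show "integrable (lborel \<Otimes>\<^sub>M lborel) (\<lambda>x. complex_of_real (D ^ (\<alpha> + Suc n) * (indicator {0..} (fst x) * (1 / (1 + fst x)\<^sup>2))) * complex_of_real \<bar>f (snd x)\<bar>)"
      by (rule integrable_pair_mult[OF 1 2])
    show "AE x in lborel \<Otimes>\<^sub>M lborel. norm (case x of (t, y) \<Rightarrow> of_real (f y) * ?K t y)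
      \<le> norm (complex_of_real (D ^ (\<alpha> + Suc n) * (indicator {0..} (fst x) * (1 / (1 + fst x)\<^sup>2))) * complex_of_real \<bar>f (snd x)\<bar>)"
    proof (rule AE_I2)
      fix x :: "real \<times> 'a"
      obtain t y where x: "x = (t, y)" by (cases x)
      have "0 \<le> D ^ (\<alpha> + Suc n) * (indicator {0..} t * (1 / (1 + t)\<^sup>2))"
        using D0 by (intro mult_nonneg_nonneg) auto
      then show "norm (case x of (t, y) \<Rightarrow> of_real (f y) * ?K t y)
      \<le> norm (complex_of_real (D ^ (\<alpha> + Suc n) * (indicator {0..} (fst x) * (1 / (1 + fst x)\<^sup>2))) * complex_of_real \<bar>f (snd x)\<bar>)"
        unfolding x prod.case fst_conv snd_conv norm_mult norm_of_real abs_abs using K[of y t] unfolding norm_mult norm_of_real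
        by (simp only: abs_of_nonneg mult.commute)
    qed
  qed measurable
  let ?q = "\<lambda>t. of_real (pos_power \<alpha> t) * ridge_transform \<epsilon> (\<alpha> + Suc n) f (w, t - w \<bullet> x)"
  have q_eq: "AE t in lborel. ?q t = (\<integral>y. of_real (f y) * ?K t y \<partial>lborel)"
  proof -
    \<comment> \<open>At \<open>t = 0\<close> the two integrands can differ when
      \<open>\<alpha> = 0\<close>: there \<open>pos_power\<close> is 0 but \<open>0 ^ 0\<close> is
      1.\<close>
    have "AE t in lborel. (t::real) \<noteq> 0" by (rule AE_lborel_singleton)
    then show ?thesis
    proof eventually_elim
      case (elim t)
      show ?case
      proof (cases "t > 0")
        case True
        have z: "of_real (\<epsilon> * norm w) + \<i> * of_real (w \<bullet> y + (t - w \<bullet> x)) = A y + \<i> * of_real t" for y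
          unfolding A_def by (simp add: inner_diff_right algebra_simps)
        have "?q t = (\<integral>y. of_real (t ^ \<alpha>) * (of_real (f y) / (A y + \<i> * of_real t) ^ (\<alpha> + Suc n)) \<partial>lborel)"
          unfolding ridge_transform_def fst_conv snd_conv z integral_mult_right_zero using True by (simp add: pos_power_def)
        also have "\<dots> = (\<integral>y. of_real (f y) * ?K t y \<partial>lborel)"
          using True by (intro Bochner_Integration.integral_cong) auto
        finally show ?thesis .
      qed (use elim in \<open>simp add: pos_power_def\<close>)
    qed
  qed
  have [measurable]: "ridge_transform \<epsilon> (\<alpha> + Suc n) f \<in> borel_measurable (borel \<Otimes>\<^sub>M borel)"
    unfolding borel_prod by measurable
  have qm: "?q \<in> borel_measurable lborel" by measurable
  have Kint: "integrable lborel (\<lambda>t. \<integral>y. of_real (f y) * ?K t y \<partial>lborel)"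
    by (rule lborel_pair.integrable_fst[OF I])
  have "integrable lborel ?q"
    using Kint by (rule integrable_cong_AE[THEN iffD2, rotated 3]) (use qm q_eq Kint in auto)
  then have "integrable lborel (\<lambda>b. ?q (w \<bullet> x + 1 * b))"
    by (rule lborel_integrable_real_affine) simp
  then show "integrable lborel (\<lambda>b. of_real (pos_power \<alpha> (w \<bullet> x + b)) * ridge_transform \<epsilon> (\<alpha> + Suc n) f (w, b))"
    by simp
  have "(\<integral>b. of_real (pos_power \<alpha> (w \<bullet> x + b)) * ridge_transform \<epsilon> (\<alpha> + Suc n) f (w, b) \<partial>lborel)
     = (\<integral>t. ?q t \<partial>lborel)"
    using lborel_integral_real_affine[of 1 "\<lambda>b. of_real (pos_power \<alpha> (w \<bullet> x + b)) * ridge_transform \<epsilon> (\<alpha> + Suc n) f (w, b)" "- (w \<bullet> x)"]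
    by simp
  also have "\<dots> = (\<integral>t. \<integral>y. of_real (f y) * ?K t y \<partial>lborel \<partial>lborel)"
    by (rule integral_cong_AE[OF qm _ q_eq]) (use Kint in auto)
  also have "\<dots> = (\<integral>y. \<integral>t. of_real (f y) * ?K t y \<partial>lborel \<partial>lborel)"
    by (rule lborel_pair.Fubini_integral[OF I, symmetric])
  also have "\<dots> = (\<integral>y. of_real (f y) * (?c / (\<i> ^ Suc \<alpha> * A y ^ n)) \<partial>lborel)"
    unfolding integral_mult_right_zero integral_beta_complex[OF RA n] by simp
  also have "\<dots> = (\<integral>y. (?c / \<i> ^ Suc \<alpha>) * (of_real (f y) * (1 / A y ^ n)) \<partial>lborel)"
    by (intro Bochner_Integration.integral_cong refl)
      (simp only: times_divide_eq_right times_divide_eq_left divide_divide_eq_left mult_1_left mult_1_right mult_ac)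
  also have "\<dots> = (?c / \<i> ^ Suc \<alpha>) * (\<integral>y. of_real (f y) * (1 / A y ^ n) \<partial>lborel)"
    by (rule integral_mult_right_zero)
  finally show "\<i> ^ Suc \<alpha> * (\<integral>b. of_real (pos_power \<alpha> (w \<bullet> x + b)) * ridge_transform \<epsilon> (\<alpha> + Suc n) f (w, b) \<partial>lborel)
    = of_real (fact \<alpha> * fact (n - 1) / fact (\<alpha> + n)) * (\<integral>y. of_real (f y) * (1 / (of_real (\<epsilon> * norm w) - \<i> * of_real (w \<bullet> (x - y))) ^ n) \<partial>lborel)"
    unfolding A_def by (simp del: power_Suc)
qed

lemma Re_mult_real: "Re (complex_of_real r * z) = r * Re z"
  by simp

text \<open>On the shell the Beta integral over \<open>b\<close> leaves an inverse power of order
  \<open>d\<close> of a complex linear form in \<open>w\<close>, and averaging over \<open>w\<close>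
  gives the Poisson kernel at \<open>x - y\<close>. The two factors \<open>fact (d - 1)\<close>
  cancel, and the remaining constant does not depend on \<open>f\<close>, \<open>x\<close> or
  \<epsilon>. Only the real part of the density is used, which is harmless as \<open>f\<close> and
  the kernel are real.\<close>

lemma sphere_ridge_reproduction:
  fixes f :: "'a::euclidean_space \<Rightarrow> real" and \<alpha> :: nat
  assumes bd: "\<And>x. \<bar>f x\<bar> \<le> 1" and supp: "\<And>x. norm x > 2 \<Longrightarrow> f x = 0"
    and fm[measurable]: "f \<in> borel_measurable borel" and \<epsilon>: "\<epsilon> > 0"
  shows "(LINT u|sphere_unif. pos_power \<alpha> (fst u \<bullet> x + snd u) * Re (\<i> ^ Suc \<alpha> * ridge_transform \<epsilon> (DIM('a) + \<alpha> + 1) f u))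
    = shell_const TYPE('a) * (fact \<alpha> * ln 2 / fact (\<alpha> + DIM('a))) * (\<integral>y. f y * poisson \<epsilon> (x - y) \<partial>lborel)"
proof -
  define n where "n = DIM('a)"
  have n: "n \<ge> 1" unfolding n_def by (simp add: Suc_leI)
  define N where "N = \<alpha> + Suc n"
  let ?q = "ridge_transform \<epsilon> N f" and ?S = "{w::'a. 1 \<le> norm w \<and> norm w < 2}"
  define \<phi> where "\<phi> u = pos_power \<alpha> (fst u \<bullet> x + snd u) * Re (\<i> ^ Suc \<alpha> * ?q u)" for u
  have [measurable]: "?S \<in> sets borel" by measurable
  have \<phi>m[measurable]: "\<phi> \<in> borel_measurable borel" unfolding \<phi>_def by measurable
  have \<phi>s: "\<phi> \<in> borel_measurable sphere_unif"
    by (rule measurable_sphere_unif) measurable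
  have fi: "integrable lborel f"
    by (rule integrable_bounded_support[of f 2]) (use bd supp in auto)
  interpret S: prob_space "sphere_unif :: ('a \<times> real) measure" by (rule prob_space_sphere_unif)
  obtain B where B: "\<And>u. norm u = 1 \<Longrightarrow> cmod (?q u) \<le> B"
    using ridge_transform_bounded_sphere[where f=f and N=N and \<epsilon>=\<epsilon>] bd supp \<epsilon> by blast
  have \<phi>i: "integrable sphere_unif \<phi>"
  proof (rule S.integrable_const_bound[OF _ \<phi>s])
    show "AE u in sphere_unif. norm (\<phi> u) \<le> (norm x + 1) ^ \<alpha> * B"
    proof (rule AE_I2)
      fix u :: "'a \<times> real" assume "u \<in> space sphere_unif"
      then have u: "norm u = 1" by (simp add: space_sphere_unif)
      have u1: "norm (fst u) \<le> 1" "\<bar>snd u\<bar> \<le> 1"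
        using u norm_fst_le[of "fst u" "snd u"] norm_snd_le[of "snd u" "fst u"] by auto
      have "\<bar>fst u \<bullet> x\<bar> \<le> norm (fst u) * norm x" by (rule Cauchy_Schwarz_ineq2)
      also have "\<dots> \<le> 1 * norm x" using u1 by (intro mult_right_mono) auto
      finally have "\<bar>fst u \<bullet> x + snd u\<bar> \<le> norm x + 1" using u1 by linarith
      then have "pos_power \<alpha> (fst u \<bullet> x + snd u) \<le> (norm x + 1) ^ \<alpha>" by (rule pos_power_le) simp
      moreover have "\<bar>Re (\<i> ^ Suc \<alpha> * ?q u)\<bar> \<le> B"
        using abs_Re_le_cmod[of "\<i> ^ Suc \<alpha> * ?q u"] B[OF u] by (simp add: norm_mult norm_power)
      ultimately show "norm (\<phi> u) \<le> (norm x + 1) ^ \<alpha> * B"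
        unfolding \<phi>_def norm_mult using pos_power_nonneg[of \<alpha> "fst u \<bullet> x + snd u"] by (intro mult_mono) auto
    qed
  qed
  have hom: "inverse (norm v ^ DIM('a \<times> real)) * indicator shell v * \<phi> (sgn v) = indicator ?S (fst v) * \<phi> v" for v
  proof (cases "v \<in> shell")
    case True
    then have v0: "norm v > 0" by (auto simp: shell_def)
    have sgn: "sgn v = inverse (norm v) *\<^sub>R v" by (rule sgn_div_norm)
    have "pos_power \<alpha> (fst (sgn v) \<bullet> x + snd (sgn v)) = pos_power \<alpha> (inverse (norm v) * (fst v \<bullet> x + snd v))"
      unfolding sgn by (simp add: algebra_simps)
    also have "\<dots> = inverse (norm v) ^ \<alpha> * pos_power \<alpha> (fst v \<bullet> x + snd v)"
      using v0 by (intro pos_power_scale) auto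
    finally have 1: "pos_power \<alpha> (fst (sgn v) \<bullet> x + snd (sgn v)) = inverse (norm v) ^ \<alpha> * pos_power \<alpha> (fst v \<bullet> x + snd v)" .
    have "?q (sgn v) = of_real (norm v ^ N) * ?q v"
      unfolding sgn using v0 by (subst ridge_transform_scaleR) (auto simp: power_inverse divide_inverse)
    then have "\<i> ^ Suc \<alpha> * ?q (sgn v) = of_real (norm v ^ N) * (\<i> ^ Suc \<alpha> * ?q v)"
      by (simp only: mult_ac)
    then have 2: "Re (\<i> ^ Suc \<alpha> * ?q (sgn v)) = norm v ^ N * Re (\<i> ^ Suc \<alpha> * ?q v)"
      by (simp only: Re_mult_real)
    \<comment> \<open>The choice \<open>N = \<alpha> + Suc n\<close> is made for this cancellation:
      the activation contributes degree \<alpha>, the density degree \<open>- N\<close>, the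
      projection to the sphere degree \<open>- Suc n\<close>.\<close>
    have 3: "inverse (norm v ^ Suc n) * (inverse (norm v) ^ \<alpha> * norm v ^ N) = 1"
      using v0 unfolding N_def by (simp add: power_add power_inverse field_simps)
    have "inverse (norm v ^ Suc n) * \<phi> (sgn v) = (inverse (norm v ^ Suc n) * (inverse (norm v) ^ \<alpha> * norm v ^ N)) * \<phi> v"
      unfolding \<phi>_def 1 2 by (simp only: mult_ac)
    then show ?thesis using True unfolding 3 by (simp add: shell_def n_def)
  qed (auto simp: shell_def)
  let ?G = "\<lambda>v. indicator ?S (fst v) * \<phi> v"
  have G: "integrable (lborel \<Otimes>\<^sub>M lborel) ?G"
    using \<phi>i unfolding integrable_sphere_unif_shell[OF \<phi>m] hom lborel_prod .
  define A where "A w y = complex_of_real (\<epsilon> * norm w) - \<i> * of_real (w \<bullet> (x - y))" for w y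
  have [measurable]: "(\<lambda>z. A (fst z) (snd z)) \<in> borel_measurable (borel \<Otimes>\<^sub>M borel)"
    unfolding A_def by measurable
  let ?c = "fact \<alpha> * fact (n - 1) / fact (\<alpha> + n) :: real"
  let ?J = "\<lambda>w y. indicator ?S w *\<^sub>R (of_real (f y) * (1 / A w y ^ n))"
  have J: "integrable (lborel \<Otimes>\<^sub>M lborel) (\<lambda>(w, y). ?J w y)"
  proof (rule Bochner_Integration.integrable_bound)
    have Sf: "emeasure lborel ?S < \<infinity>"
      by (rule le_less_trans[OF emeasure_mono[of _ "cball 0 2"] emeasure_lborel_cball_finite[of "0::'a" 2]]) auto
    have 1: "integrable lborel (\<lambda>w. complex_of_real (indicator ?S w * (1 / \<epsilon> ^ n)))"
      unfolding complex_of_real_integrable_eq using Sf by (intro integrable_mult_left) simp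
    have 2: "integrable lborel (\<lambda>y. complex_of_real (f y))"
      unfolding complex_of_real_integrable_eq by (rule fi)
    show "integrable (lborel \<Otimes>\<^sub>M lborel) (\<lambda>z. complex_of_real (indicator ?S (fst z) * (1 / \<epsilon> ^ n)) * complex_of_real (f (snd z)))"
      by (rule integrable_pair_mult[OF 1 2])
    show "AE z in lborel \<Otimes>\<^sub>M lborel. norm (case z of (w, y) \<Rightarrow> ?J w y) \<le> norm (complex_of_real (indicator ?S (fst z) * (1 / \<epsilon> ^ n)) * complex_of_real (f (snd z)))"
    proof (rule AE_I2)
      fix z :: "'a \<times> 'a"
      obtain w y where z: "z = (w, y)" by (cases z)
      show "norm (case z of (w, y) \<Rightarrow> ?J w y) \<le> norm (complex_of_real (indicator ?S (fst z) * (1 / \<epsilon> ^ n)) * complex_of_real (f (snd z)))"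
      proof (cases "w \<in> ?S")
        case True
        have "\<epsilon> * 1 \<le> \<epsilon> * norm w" using True \<epsilon> by (intro mult_left_mono) auto
        also have "\<dots> = Re (A w y)" by (simp add: A_def)
        also have "\<dots> \<le> cmod (A w y)" by (rule complex_Re_le_cmod)
        finally have "1 / cmod (A w y) ^ n \<le> 1 / \<epsilon> ^ n" using \<epsilon> by (intro divide_left_mono power_mono mult_pos_pos zero_less_power) auto
        then have "\<bar>f y\<bar> * (1 / cmod (A w y) ^ n) \<le> \<bar>f y\<bar> * (1 / \<epsilon> ^ n)" by (intro mult_left_mono) auto
        then show ?thesis using True \<epsilon> unfolding z by (simp add: norm_mult norm_divide norm_power mult.commute)
      qed (simp add: z)
    qed
  qed measurable
  have inner: "(\<integral>b. ?G (w, b) \<partial>lborel) = ?c * Re (\<integral>y. ?J w y \<partial>lborel)" for w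
  proof (cases "w \<in> ?S")
    case True
    then have w: "w \<noteq> 0" by auto
    let ?p = "\<lambda>b. of_real (pos_power \<alpha> (w \<bullet> x + b)) * ?q (w, b)"
    have pint: "integrable lborel ?p"
      unfolding N_def by (rule integrable_pos_power_ridge_transform[OF fi supp \<epsilon> w n])
    have pval: "\<i> ^ Suc \<alpha> * (\<integral>b. ?p b \<partial>lborel) = of_real ?c * (\<integral>y. of_real (f y) * (1 / A w y ^ n) \<partial>lborel)"
      unfolding N_def A_def by (rule integral_pos_power_ridge_transform[OF fi supp \<epsilon> w n])
    have "(\<integral>b. ?G (w, b) \<partial>lborel) = (\<integral>b. Re (\<i> ^ Suc \<alpha> * ?p b) \<partial>lborel)"
    proof (rule Bochner_Integration.integral_cong[OF refl])
      fix b
      have "\<i> ^ Suc \<alpha> * ?p b = of_real (pos_power \<alpha> (w \<bullet> x + b)) * (\<i> ^ Suc \<alpha> * ?q (w, b))"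
        by (simp only: mult_ac)
      then have "Re (\<i> ^ Suc \<alpha> * ?p b) = pos_power \<alpha> (w \<bullet> x + b) * Re (\<i> ^ Suc \<alpha> * ?q (w, b))"
        by (simp only: Re_mult_real)
      then show "?G (w, b) = Re (\<i> ^ Suc \<alpha> * ?p b)" using True by (simp add: \<phi>_def del: power_Suc)
    qed
    also have "\<dots> = Re (\<integral>b. \<i> ^ Suc \<alpha> * ?p b \<partial>lborel)"
      by (rule integral_Re) (rule integrable_mult_right[OF pint])
    also have "\<dots> = Re (of_real ?c * (\<integral>y. of_real (f y) * (1 / A w y ^ n) \<partial>lborel))"
      unfolding integral_mult_right_zero pval ..
    also have "\<dots> = ?c * Re (\<integral>y. ?J w y \<partial>lborel)"
      using True by (simp only: Re_mult_real) simp
    finally show ?thesis .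
  qed simp
  have H: "(\<integral>w. ?J w y \<partial>lborel) = of_real (f y * (ln 2 / fact (n - 1) * poisson \<epsilon> (x - y)))" for y
  proof -
    have "(\<integral>w. ?J w y \<partial>lborel) = (\<integral>w. of_real (f y) * (indicator ?S w *\<^sub>R (1 / A w y ^ n)) \<partial>lborel)"
      by (intro Bochner_Integration.integral_cong) auto
    also have "\<dots> = of_real (f y) * of_real (ln 2 / fact (n - 1) * poisson \<epsilon> (x - y))"
      unfolding integral_mult_right_zero n_def A_def shell_average_power[OF \<epsilon>] ..
    finally show ?thesis by simp
  qed
  have "(LINT u|sphere_unif. \<phi> u) = shell_const TYPE('a) * (\<integral>v. ?G v \<partial>(lborel \<Otimes>\<^sub>M lborel))"
    unfolding integral_sphere_unif_shell[OF \<phi>m] hom lborel_prod ..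
  also have "(\<integral>v. ?G v \<partial>(lborel \<Otimes>\<^sub>M lborel)) = (\<integral>w. \<integral>b. ?G (w, b) \<partial>lborel \<partial>lborel)"
    by (rule lborel_pair.integral_fst'[OF G, symmetric])
  also have "\<dots> = ?c * (\<integral>w. Re (\<integral>y. ?J w y \<partial>lborel) \<partial>lborel)"
    unfolding inner integral_mult_right_zero ..
  also have "(\<integral>w. Re (\<integral>y. ?J w y \<partial>lborel) \<partial>lborel) = Re (\<integral>w. \<integral>y. ?J w y \<partial>lborel \<partial>lborel)"
    by (rule integral_Re) (rule lborel_pair.integrable_fst[OF J])
  also have "(\<integral>w. \<integral>y. ?J w y \<partial>lborel \<partial>lborel) = (\<integral>y. \<integral>w. ?J w y \<partial>lborel \<partial>lborel)"
    by (rule lborel_pair.Fubini_integral[OF J, symmetric])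
  also have "\<dots> = of_real (\<integral>y. f y * (ln 2 / fact (n - 1) * poisson \<epsilon> (x - y)) \<partial>lborel)"
    unfolding H integral_complex_of_real ..
  also have "(\<integral>y. f y * (ln 2 / fact (n - 1) * poisson \<epsilon> (x - y)) \<partial>lborel) = (\<integral>y. (ln 2 / fact (n - 1)) * (f y * poisson \<epsilon> (x - y)) \<partial>lborel)"
    by (simp only: mult_ac)
  also have "\<dots> = ln 2 / fact (n - 1) * (\<integral>y. f y * poisson \<epsilon> (x - y) \<partial>lborel)"
    by (rule integral_mult_right_zero)
  finally have "(LINT u|sphere_unif. \<phi> u) = shell_const TYPE('a) * (?c * (ln 2 / fact (n - 1) * (\<integral>y. f y * poisson \<epsilon> (x - y) \<partial>lborel)))"
    by (simp only: Re_complex_of_real)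
  moreover have "N = DIM('a) + \<alpha> + 1" by (simp add: N_def n_def)
  ultimately show ?thesis unfolding \<phi>_def n_def by simp
qed

text \<open>The metric projection onto the unit ball is 1-Lipschitz, so composing with it extends
  \<open>f\<close> with the same bounds. The radial cutoff decreases with slope 1 from radius 1 to
  radius 2; the product rule then gives the constant 2.\<close>

lemma lipschitz_extension_compact_support:
  fixes f :: "'a::euclidean_space \<Rightarrow> real"
  assumes bd: "\<And>x. norm x \<le> 1 \<Longrightarrow> \<bar>f x\<bar> \<le> 1"
    and lip: "\<And>x y. norm x \<le> 1 \<Longrightarrow> norm y \<le> 1 \<Longrightarrow> \<bar>f x - f y\<bar> \<le> norm (x - y)"
  obtains g where "\<And>x. norm x \<le> 1 \<Longrightarrow> g x = f x" "\<And>x. \<bar>g x\<bar> \<le> 1" "\<And>x y. \<bar>g x - g y\<bar> \<le> 2 * norm (x - y)"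
    "\<And>x. norm x > 2 \<Longrightarrow> g x = 0" "g \<in> borel_measurable borel"
proof
  let ?B = "cball (0::'a) 1"
  define P where "P = closest_point ?B"
  define c where "c x = max 0 (min 1 (2 - norm x))" for x :: 'a
  define g where "g x = c x * f (P x)" for x
  have P: "norm (P x) \<le> 1" for x
    using closest_point_in_set[of ?B x] by (simp add: P_def)
  have Pl: "norm (P x - P y) \<le> norm (x - y)" for x y
    using closest_point_lipschitz[of ?B x y] by (simp add: P_def dist_norm)
  have c01: "0 \<le> c x" "c x \<le> 1" for x by (auto simp: c_def)
  have cl: "\<bar>c x - c y\<bar> \<le> norm (x - y)" for x y
    using norm_triangle_ineq3[of x y] unfolding c_def by linarith
  show "g x = f x" if "norm x \<le> 1" for x
    using that closest_point_self[of x ?B] by (simp add: g_def c_def P_def)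
  show "\<bar>g x\<bar> \<le> 1" for x
    unfolding g_def abs_mult using mult_mono[of "\<bar>c x\<bar>" 1 "\<bar>f (P x)\<bar>" 1] c01[of x] bd[OF P[of x]] by simp
  show gl: "\<bar>g x - g y\<bar> \<le> 2 * norm (x - y)" for x y
  proof -
    have "g x - g y = (c x - c y) * f (P x) + c y * (f (P x) - f (P y))"
      by (simp add: g_def algebra_simps)
    also have "\<bar>\<dots>\<bar> \<le> \<bar>c x - c y\<bar> * \<bar>f (P x)\<bar> + \<bar>c y\<bar> * \<bar>f (P x) - f (P y)\<bar>"
      by (simp only: abs_mult[symmetric] abs_triangle_ineq)
    also have "\<dots> \<le> norm (x - y) * 1 + 1 * norm (x - y)"
      using c01[of y] order_trans[OF lip[OF P P, of x y] Pl] by (intro add_mono mult_mono cl bd P) auto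
    finally show ?thesis by simp
  qed
  show "g x = 0" if "norm x > 2" for x using that by (simp add: g_def c_def)
  have "2-lipschitz_on UNIV g" by (rule lipschitz_onI) (auto simp: dist_norm gl)
  then have "continuous_on UNIV g" by (rule lipschitz_on_continuous_on)
  then show "g \<in> borel_measurable borel" by (rule borel_measurable_continuous_onI)
qed

text \<open>Reproduction, smoothing error and norm estimate for the compactly supported extension,
  with one constant for both conclusions. The parameter \<epsilon> is still free, and is balanced
  against \<delta> only at the end.\<close>

lemma unit_ball_approximation:
  fixes \<alpha> :: nat
  obtains C where "C > 0" "\<And>(f :: 'a::euclidean_space \<Rightarrow> real) \<epsilon>. \<lbrakk>\<And>x. norm x \<le> 1 \<Longrightarrow> \<bar>f x\<bar> \<le> 1;
      \<And>x y. norm x \<le> 1 \<Longrightarrow> norm y \<le> 1 \<Longrightarrow> \<bar>f x - f y\<bar> \<le> norm (x - y); 0 < \<epsilon>; \<epsilon> \<le> exp (- 1)\<rbrakk>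
    \<Longrightarrow> \<exists>p. p \<in> borel_measurable sphere_unif \<and> integrable sphere_unif (\<lambda>u. (p u)\<^sup>2) \<and>
       (LINT u|sphere_unif. (p u)\<^sup>2) \<le> C * (\<epsilon>\<^sup>2 / \<epsilon> ^ (DIM('a) + 2 * \<alpha> + 1)) \<and>
       (\<forall>x. norm x \<le> 1 \<longrightarrow> \<bar>f x - (LINT u|sphere_unif. pos_power \<alpha> (fst u \<bullet> x + snd u) * p u)\<bar> \<le> C * (\<epsilon> * ln (1 / \<epsilon>)))"
proof -
  let ?m0 = "gauss_moment TYPE('a) 0" and ?m1 = "gauss_moment TYPE('a) 1"
  \<comment> \<open>The reproduction constant times the mass of the Poisson kernel; dividing the
    density by it makes the represented function an average of \<open>f\<close>.\<close>
  define K where "K = shell_const TYPE('a) * (fact \<alpha> * ln 2 / fact (\<alpha> + DIM('a))) * ?m0"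
  have K: "K > 0" unfolding K_def using shell_const_pos[where 'a='a] gauss_moment_0_pos[where 'a='a] by (intro mult_pos_pos divide_pos_pos) auto
  have m: "?m0 > 0" "?m1 \<ge> 0" by (rule gauss_moment_0_pos gauss_moment_nonneg)+
  obtain C0 where C0: "C0 > 0" "\<And>(f :: 'a \<Rightarrow> real) \<epsilon>. \<lbrakk>\<And>x y. \<bar>f x - f y\<bar> \<le> 2 * norm (x - y); \<And>x. \<bar>f x\<bar> \<le> 1;
     \<And>x. norm x > 2 \<Longrightarrow> f x = 0; f \<in> borel_measurable borel; 0 < \<epsilon>; \<epsilon> \<le> 1\<rbrakk>
     \<Longrightarrow> (LINT u|sphere_unif. (cmod (ridge_transform \<epsilon> (DIM('a) + \<alpha> + 1) f u))\<^sup>2) \<le> C0 * \<epsilon>\<^sup>2 / \<epsilon> ^ (DIM('a) + 2 * \<alpha> + 1)"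
    by (rule integral_sphere_ridge_transform_le[where L=2 and \<alpha>=\<alpha> and 'a='a, OF zero_le_numeral]) blast
  \<comment> \<open>The smoothing constant at \<open>L = 2\<close>, the Lipschitz constant of the
    extension, divided by the mass of the kernel.\<close>
  define C1 where "C1 = 2 * (2 * ?m0 + 2 * ?m1) * 3 / ?m0"
  have C1: "C1 \<ge> 0" unfolding C1_def using m by simp
  define C where "C = C0 / K\<^sup>2 + C1"
  show ?thesis
  proof
    show "C > 0" unfolding C_def using C0(1) C1 K by (intro add_pos_nonneg divide_pos_pos) auto
    fix f :: "'a \<Rightarrow> real" and \<epsilon> :: real
    assume bd: "\<And>x. norm x \<le> 1 \<Longrightarrow> \<bar>f x\<bar> \<le> 1"
      and lip: "\<And>x y. norm x \<le> 1 \<Longrightarrow> norm y \<le> 1 \<Longrightarrow> \<bar>f x - f y\<bar> \<le> norm (x - y)"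
      and \<epsilon>: "0 < \<epsilon>" "\<epsilon> \<le> exp (- 1)"
    obtain g where g: "\<And>x. norm x \<le> 1 \<Longrightarrow> g x = f x" "\<And>x. \<bar>g x\<bar> \<le> 1" "\<And>x y. \<bar>g x - g y\<bar> \<le> 2 * norm (x - y)"
      "\<And>x. norm x > 2 \<Longrightarrow> g x = 0" "g \<in> borel_measurable borel"
      using lipschitz_extension_compact_support[OF bd lip] by blast
    note gm[measurable] = g(5)
    let ?N = "DIM('a) + \<alpha> + 1" and ?E = "\<epsilon>\<^sup>2 / \<epsilon> ^ (DIM('a) + 2 * \<alpha> + 1)"
    have \<epsilon>1: "\<epsilon> \<le> 1" using \<epsilon>(2) exp_le_one_iff[of "- 1::real"] by linarith
    have "ln \<epsilon> \<le> - 1" using \<epsilon> by (metis ln_exp ln_mono exp_gt_zero)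
    then have ln: "ln (1 / \<epsilon>) \<ge> 1" using \<epsilon> by (simp add: ln_div)
    have eln0: "0 \<le> \<epsilon> * ln (1 / \<epsilon>)" using \<epsilon> ln by (intro mult_nonneg_nonneg) linarith+
    let ?q = "ridge_transform \<epsilon> ?N g"
    define p where "p u = Re (\<i> ^ Suc \<alpha> * ?q u) / K" for u
    interpret S: prob_space "sphere_unif :: ('a \<times> real) measure" by (rule prob_space_sphere_unif)
    have pb: "\<bar>p u\<bar> \<le> cmod (?q u) / K" for u
      unfolding p_def using K abs_Re_le_cmod[of "\<i> ^ Suc \<alpha> * ?q u"] by (simp add: norm_mult norm_power divide_right_mono)
    have pm: "p \<in> borel_measurable sphere_unif"
      unfolding p_def by (rule measurable_sphere_unif) measurable
    have qm: "?q \<in> borel_measurable sphere_unif"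
      by (rule measurable_sphere_unif) measurable
    obtain B where B: "\<And>u. norm u = 1 \<Longrightarrow> cmod (?q u) \<le> B"
      using ridge_transform_bounded_sphere[where f=g and N="?N" and \<epsilon>=\<epsilon>] g(2,4) \<epsilon>(1) by blast
    have q2: "integrable sphere_unif (\<lambda>u. (cmod (?q u))\<^sup>2)"
      using qm B by (intro S.integrable_const_bound[of _ "B\<^sup>2"] AE_I2) (auto simp: space_sphere_unif intro!: power_mono)
    have p2: "(p u)\<^sup>2 \<le> (cmod (?q u))\<^sup>2 / K\<^sup>2" for u
      using power_mono[OF pb[of u], of 2] by (simp add: power_divide)
    have q2': "integrable sphere_unif (\<lambda>u. (cmod (?q u))\<^sup>2 / K\<^sup>2)" using q2 by simp
    have pi2: "integrable sphere_unif (\<lambda>u. (p u)\<^sup>2)"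
      by (rule Bochner_Integration.integrable_bound[OF q2']) (use pm p2 in auto)
    have "(LINT u|sphere_unif. (p u)\<^sup>2) \<le> (LINT u|sphere_unif. (cmod (?q u))\<^sup>2 / K\<^sup>2)"
      by (intro integral_mono pi2 q2' p2)
    also have "\<dots> = (LINT u|sphere_unif. (cmod (?q u))\<^sup>2) / K\<^sup>2" by simp
    also have "\<dots> \<le> (C0 * \<epsilon>\<^sup>2 / \<epsilon> ^ (DIM('a) + 2 * \<alpha> + 1)) / K\<^sup>2"
      by (intro divide_right_mono C0(2) g \<epsilon> \<epsilon>1) auto
    also have "\<dots> = (C0 / K\<^sup>2) * ?E" by simp
    also have "\<dots> \<le> C * ?E" unfolding C_def using C1 \<epsilon> by (intro mult_right_mono) auto
    finally have 1: "(LINT u|sphere_unif. (p u)\<^sup>2) \<le> C * ?E" .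
    have 2: "\<bar>f x - (LINT u|sphere_unif. pos_power \<alpha> (fst u \<bullet> x + snd u) * p u)\<bar> \<le> C * (\<epsilon> * ln (1 / \<epsilon>))" if x: "norm x \<le> 1" for x
    proof -
      let ?I = "\<integral>y. g y * poisson \<epsilon> (x - y) \<partial>lborel"
      have "(LINT u|sphere_unif. pos_power \<alpha> (fst u \<bullet> x + snd u) * p u)
         = (LINT u|sphere_unif. pos_power \<alpha> (fst u \<bullet> x + snd u) * Re (\<i> ^ Suc \<alpha> * ?q u) / K)"
        unfolding p_def by simp
      also have "\<dots> = shell_const TYPE('a) * (fact \<alpha> * ln 2 / fact (\<alpha> + DIM('a))) * ?I / K"
      proof -
        have "(LINT u|sphere_unif. pos_power \<alpha> (fst u \<bullet> x + snd u) * Re (\<i> ^ Suc \<alpha> * ?q u))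
          = shell_const TYPE('a) * (fact \<alpha> * ln 2 / fact (\<alpha> + DIM('a))) * ?I"
          by (rule sphere_ridge_reproduction) (use g \<epsilon> in auto)
        then show ?thesis unfolding integral_divide_zero by (simp only:)
      qed
      also have "\<dots> = ?I / ?m0"
        using shell_const_pos[where 'a='a] m unfolding K_def by (simp add: field_simps)
      finally have eq: "(LINT u|sphere_unif. pos_power \<alpha> (fst u \<bullet> x + snd u) * p u) = ?I / ?m0" .
      have "\<bar>f x - ?I / ?m0\<bar> = \<bar>?I - ?m0 * g x\<bar> / ?m0"
        using m g(1)[OF x] by (simp add: abs_div_pos[symmetric] field_simps abs_minus_commute)
      also have "\<dots> \<le> (2 * (2 * ?m0 + 2 * ?m1) * (3 * (\<epsilon> * ln (1 / \<epsilon>)))) / ?m0"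
        using m by (intro divide_right_mono poisson_smoothing_error[OF g(3) g(2) gm _ \<epsilon>]) auto
      also have "\<dots> = C1 * (\<epsilon> * ln (1 / \<epsilon>))" unfolding C1_def by simp
      also have "\<dots> \<le> C * (\<epsilon> * ln (1 / \<epsilon>))"
        unfolding C_def using C0(1) K by (intro mult_right_mono eln0) auto
      finally show ?thesis unfolding eq .
    qed
    show "\<exists>p. p \<in> borel_measurable sphere_unif \<and> integrable sphere_unif (\<lambda>u. (p u)\<^sup>2) \<and>
       (LINT u|sphere_unif. (p u)\<^sup>2) \<le> C * ?E \<and>
       (\<forall>x. norm x \<le> 1 \<longrightarrow> \<bar>f x - (LINT u|sphere_unif. pos_power \<alpha> (fst u \<bullet> x + snd u) * p u)\<bar> \<le> C * (\<epsilon> * ln (1 / \<epsilon>)))"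
      using pm pi2 1 2 by blast
  qed
qed

subsection \<open>The critical case\<close>

text \<open>
  The critical case: when \<open>d = 1\<close> and \<open>\<alpha> = 0\<close> the representation is exact, its density being a
  derivative of \<open>f\<close>. That derivative comes from the Radon--Nikodym theorem for the measures with
  distribution functions \<open>L x + f x\<close> and \<open>L x - f x\<close>, which add up to a multiple of Lebesgue measure.
\<close>

lemma lipschitz_bounded_density:
  fixes f :: "real \<Rightarrow> real"
  assumes lip: "\<And>x y. \<bar>f x - f y\<bar> \<le> L * \<bar>x - y\<bar>"
  obtains q where "q \<in> borel_measurable borel" "\<And>t. \<bar>q t\<bar> \<le> L"
    "\<And>a b. a \<le> b \<Longrightarrow> has_bochner_integral lborel (\<lambda>t. indicator {a<..b} t * q t) (f b - f a)"
proof -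
  have L0: "L \<ge> 0" using lip[of 1 0] by simp
  let ?F = "\<lambda>x. L * x + f x" and ?G = "\<lambda>x. L * x - f x"
  have cont: "continuous_on UNIV f"
  proof -
    have "L-lipschitz_on UNIV f" by (rule lipschitz_onI) (auto simp: dist_real_def lip L0)
    then show ?thesis by (rule lipschitz_on_continuous_on)
  qed
  have monoF: "x \<le> y \<Longrightarrow> ?F x \<le> ?F y" for x y using lip[of x y] by (auto simp: algebra_simps abs_le_iff)
  have monoG: "x \<le> y \<Longrightarrow> ?G x \<le> ?G y" for x y using lip[of x y] by (auto simp: algebra_simps abs_le_iff)
  have cF: "continuous (at_right a) ?F" and cG: "continuous (at_right a) ?G" for a
    using cont by (auto intro!: continuous_intros simp: continuous_on_eq_continuous_within intro: continuous_at_imp_continuous_within)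
  let ?\<mu> = "interval_measure ?F" and ?\<nu> = "interval_measure ?G"
  have e\<mu>: "emeasure ?\<mu> {a<..b} = ennreal (?F b - ?F a)" if "a \<le> b" for a b
    using that by (intro emeasure_interval_measure_Ioc monoF cF) auto
  have e\<nu>: "emeasure ?\<nu> {a<..b} = ennreal (?G b - ?G a)" if "a \<le> b" for a b
    using that by (intro emeasure_interval_measure_Ioc monoG cG) auto
  have sets_eq: "sets ?\<mu> = sets borel" "sets ?\<nu> = sets borel" by auto
  have sum: "emeasure ?\<mu> A + emeasure ?\<nu> A = ennreal (2 * L) * emeasure lborel A" if "A \<in> sets borel" for A
  proof -
    \<comment> \<open>The sum is made into a measure so that it can be identified on half-open
      intervals, which form a generator stable under intersection; there the increments of
      \<open>f\<close> cancel.\<close>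
    let ?N = "measure_of UNIV (sets borel) (\<lambda>A. emeasure ?\<mu> A + emeasure ?\<nu> A) :: real measure"
    have N: "emeasure ?N A = emeasure ?\<mu> A + emeasure ?\<nu> A" if "A \<in> sets borel" for A
    proof (rule emeasure_measure_of_sigma)
      show "sigma_algebra UNIV (sets borel :: real set set)"
        using sets.sigma_algebra_axioms[of "borel :: real measure"] by simp
      show "countably_additive (sets borel) (\<lambda>A. emeasure ?\<mu> A + emeasure ?\<nu> A)"
      proof (rule countably_additiveI)
        fix B :: "nat \<Rightarrow> real set" assume B: "range B \<subseteq> sets borel" "disjoint_family B"
        have "(\<Sum>i. emeasure ?\<mu> (B i)) = emeasure ?\<mu> (\<Union>i. B i)" "(\<Sum>i. emeasure ?\<nu> (B i)) = emeasure ?\<nu> (\<Union>i. B i)"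
          using B by (auto intro!: suminf_emeasure)
        then show "(\<Sum>i. emeasure ?\<mu> (B i) + emeasure ?\<nu> (B i)) = emeasure ?\<mu> (\<Union>i. B i) + emeasure ?\<nu> (\<Union>i. B i)"
          by (subst suminf_add[symmetric]) auto
      qed
    qed (use that in \<open>auto simp: positive_def\<close>)
    have N_eq: "?N = density lborel (\<lambda>_. ennreal (2 * L))"
    proof (rule measure_eqI_generator_eq[where E="range (\<lambda>(a, b). {a<..b})" and \<Omega>=UNIV and A="\<lambda>i::nat. {- real i<..real i}"])
      show "Int_stable (range (\<lambda>(a, b). {a<..b::real}))"
        by (auto intro!: Int_stableI simp: Int_greaterThanAtMost image_iff) blast
      fix X :: "real set" assume "X \<in> range (\<lambda>(a, b). {a<..b})"
      then obtain a b where X: "X = {a<..b}" by auto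
      show "emeasure ?N X = emeasure (density lborel (\<lambda>_. ennreal (2 * L))) X"
      proof (cases "a \<le> b")
        case True
        have "emeasure ?N X = emeasure ?\<mu> X + emeasure ?\<nu> X" by (rule N) (simp add: X)
        also have "\<dots> = ennreal (?F b - ?F a) + ennreal (?G b - ?G a)"
          unfolding X e\<mu>[OF True] e\<nu>[OF True] ..
        also have "\<dots> = ennreal ((?F b - ?F a) + (?G b - ?G a))"
          using monoF[OF True] monoG[OF True] by (intro ennreal_plus[symmetric]) linarith+
        also have "(?F b - ?F a) + (?G b - ?G a) = 2 * L * (b - a)" by (simp add: algebra_simps)
        also have "ennreal \<dots> = ennreal (2 * L) * ennreal (b - a)"
          using True L0 by (intro ennreal_mult) auto
        also have "\<dots> = emeasure (density lborel (\<lambda>_. ennreal (2 * L))) X"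
          unfolding X using True by (subst emeasure_density_const) auto
        finally show ?thesis .
      qed (simp add: X N)
    next
      show "(\<Union>i::nat. {- real i<..real i}) = UNIV"
      proof (intro equalityI subsetI UNIV_I)
        fix x :: real
        obtain i :: nat where "\<bar>x\<bar> < real i" using reals_Archimedean2 by blast
        then show "x \<in> (\<Union>i::nat. {- real i<..real i})" by (intro UN_I[of i]) auto
      qed
      show "emeasure ?N {- real i<..real i} \<noteq> \<infinity>" for i :: nat
        by (subst N) (simp_all only: e\<mu> e\<nu> ennreal_add_eq_top ennreal_neq_top infinity_ennreal_def, simp_all add: e\<mu> e\<nu>)
      have SB: "sets (borel :: real measure) = sigma_sets UNIV (range (\<lambda>(a, b). {a<..b}))"
        by (subst borel_sigma_sets_Ioc) (rule sets_measure_of, simp)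
      have "sets ?N = sets (borel :: real measure)"
        using sets.sigma_sets_eq[of "borel :: real measure"] by simp
      then show "sets ?N = sigma_sets UNIV (range (\<lambda>(a, b). {a<..b}))"
        unfolding SB .
      have "sets (density (lborel :: real measure) (\<lambda>_. ennreal (2 * L))) = sets borel" by simp
      then show "sets (density (lborel :: real measure) (\<lambda>_. ennreal (2 * L))) = sigma_sets UNIV (range (\<lambda>(a, b). {a<..b}))"
        unfolding SB .
    qed auto
    have "emeasure ?\<mu> A + emeasure ?\<nu> A = emeasure (density lborel (\<lambda>_. ennreal (2 * L))) A"
      unfolding N_eq[symmetric] by (rule N[OF that, symmetric])
    also have "\<dots> = ennreal (2 * L) * emeasure lborel A"
      by (rule emeasure_density_const) (use that in auto)
    finally show ?thesis .
  qed
  have "A \<in> null_sets ?\<mu> \<and> A \<in> null_sets ?\<nu>" if "A \<in> null_sets lborel" for A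
  proof -
    have A: "A \<in> sets borel" "emeasure lborel A = 0" using that by (auto simp: null_sets_def)
    then have "emeasure ?\<mu> A + emeasure ?\<nu> A = 0" using sum[OF A(1)] by (simp only: A(2) mult_zero_right)
    then have "emeasure ?\<mu> A = 0" "emeasure ?\<nu> A = 0" by (simp_all only: add_eq_0_iff_both_eq_0 zero_le)
    then show ?thesis using A by (simp add: null_sets_def)
  qed
  then have ac: "absolutely_continuous lborel ?\<mu>" "absolutely_continuous lborel ?\<nu>"
    unfolding absolutely_continuous_def by blast+
  obtain p where p[measurable]: "p \<in> borel_measurable borel" and dp: "density lborel p = ?\<mu>"
    using sigma_finite_measure.Radon_Nikodym[OF sigma_finite_lborel ac(1)] sets_eq by auto
  obtain r where r[measurable]: "r \<in> borel_measurable borel" and dr: "density lborel r = ?\<nu>"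
    using sigma_finite_measure.Radon_Nikodym[OF sigma_finite_lborel ac(2)] sets_eq by auto
  have "AE x in lborel. p x + r x = ennreal (2 * L)"
  proof (rule sigma_finite_measure.density_unique[OF sigma_finite_lborel])
    show "density lborel (\<lambda>x. p x + r x) = density lborel (\<lambda>x. ennreal (2 * L))"
    proof (rule measure_eqI)
      fix A assume "A \<in> sets (density lborel (\<lambda>x. p x + r x))"
      then have A[measurable]: "A \<in> sets borel" by simp
      have "emeasure (density lborel (\<lambda>x. p x + r x)) A = emeasure (density lborel p) A + emeasure (density lborel r) A"
        by (simp add: emeasure_density nn_integral_add[symmetric] distrib_right)
      then show "emeasure (density lborel (\<lambda>x. p x + r x)) A = emeasure (density lborel (\<lambda>x. ennreal (2 * L))) A"
        unfolding dp dr sum[OF A] by (simp add: emeasure_density_const)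
    qed simp
  qed auto
  then have pL: "AE x in lborel. p x \<le> ennreal (2 * L)"
    by eventually_elim (metis le_iff_add)
  \<comment> \<open>Here \<open>p\<close> is the derivative of \<open>L x + f x\<close>, so
    subtracting \<open>L\<close> leaves that of \<open>f\<close>. Clipping at \<open>2 * L\<close>
    changes \<open>p\<close> only on a null set and gives the bound on \<open>q\<close> at every
    point.\<close>
  define q where "q t = min (2 * L) (enn2real (p t)) - L" for t
  have qb: "\<bar>q t\<bar> \<le> L" for t unfolding q_def using L0 by (auto simp: abs_le_iff min_def)
  have qm[measurable]: "q \<in> borel_measurable borel" unfolding q_def by measurable
  have pq: "AE t in lborel. p t = ennreal (q t + L)"
    using pL
  proof eventually_elim
    case (elim t)
    then have "p t = ennreal (enn2real (p t))" by (metis ennreal_enn2real ennreal_less_top le_less_trans)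
    moreover have "enn2real (p t) \<le> 2 * L" using elim L0 by (metis enn2real_leI mult_nonneg_nonneg zero_le_numeral)
    ultimately show ?case by (simp add: q_def min_def)
  qed
  show ?thesis
  proof (rule that[OF qm qb])
    fix a b :: real assume ab: "a \<le> b"
    have "(\<integral>\<^sup>+t. ennreal (indicator {a<..b} t * (q t + L)) \<partial>lborel) = (\<integral>\<^sup>+t. p t * indicator {a<..b} t \<partial>lborel)"
      using pq by (intro nn_integral_cong_AE) (auto elim!: eventually_mono split: split_indicator)
    also have "\<dots> = emeasure (density lborel p) {a<..b}" by (simp add: emeasure_density)
    also have "\<dots> = ennreal (?F b - ?F a)" unfolding dp by (rule e\<mu>[OF ab])
    finally have 1: "has_bochner_integral lborel (\<lambda>t. indicator {a<..b} t * (q t + L)) (?F b - ?F a)"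
    proof (rule has_bochner_integral_nn_integral[rotated 3])
      have "0 \<le> q t + L" for t using qb[of t] by linarith
      then show "AE t in lborel. 0 \<le> indicator {a<..b} t * (q t + L)" by (intro AE_I2) simp
      show "0 \<le> ?F b - ?F a" using monoF[OF ab] by linarith
    qed measurable
    have 2: "has_bochner_integral lborel (\<lambda>t. indicator {a<..b} t * L) ((b - a) * L)"
      using ab by (intro has_bochner_integral_mult_left) (simp add: has_bochner_integral_iff)
    show "has_bochner_integral lborel (\<lambda>t. indicator {a<..b} t * q t) (f b - f a)"
      using has_bochner_integral_diff[OF 1 2] by (simp add: algebra_simps)
  qed
qed

text \<open>In the coordinate along \<open>e\<close>, for \<open>w > 0\<close>, the activation at
  \<open>x\<close> is the indicator of \<open>t < x\<close> with the threshold
  \<open>t = - b / w\<close>. Integrating the derivative of the extension over such thresholds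
  recovers its value at \<open>x\<close>, because the extension vanishes far to the left. A density
  of the form \<open>q (- b / w) / w\<^sup>2\<close> is homogeneous of degree -2, as the shell
  formula asks in this dimension.\<close>

lemma critical_case_representation:
  assumes dim: "DIM('a::euclidean_space) = 1"
  obtains C where "\<And>f :: 'a \<Rightarrow> real. \<lbrakk>\<And>x. norm x \<le> 1 \<Longrightarrow> \<bar>f x\<bar> \<le> 1;
      \<And>x y. norm x \<le> 1 \<Longrightarrow> norm y \<le> 1 \<Longrightarrow> \<bar>f x - f y\<bar> \<le> norm (x - y)\<rbrakk>
    \<Longrightarrow> \<exists>p. p \<in> borel_measurable sphere_unif \<and> integrable sphere_unif (\<lambda>u. (p u)\<^sup>2) \<and>
       (LINT u|sphere_unif. (p u)\<^sup>2) \<le> C \<and>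
       (\<forall>x. norm x \<le> 1 \<longrightarrow> f x = (LINT u|sphere_unif. pos_power 0 (fst u \<bullet> x + snd u) * p u))"
proof -
  obtain e :: 'a where e: "Basis = {e}" using dim by (auto simp: card_1_singleton_iff)
  have eB: "e \<in> Basis" unfolding e by (rule singletonI)
  have rep: "x = (x \<bullet> e) *\<^sub>R e" for x :: 'a using euclidean_representation[of x] unfolding e by simp
  have nrm: "norm x = \<bar>x \<bullet> e\<bar>" for x :: 'a
    using rep[of x] norm_Basis[OF eB] by (metis norm_scaleR mult_1_right)
  have inn: "w \<bullet> x = (w \<bullet> e) * (x \<bullet> e)" for w x :: 'a
    using euclidean_inner[of w x] unfolding e by simp
  let ?S = "{w::'a. 1 \<le> norm w \<and> norm w < 2}"
  have [measurable]: "?S \<in> sets borel" by measurable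
  let ?K = "shell_const TYPE('a)"
  \<comment> \<open>What is left as a function of \<open>w\<close> once \<open>b\<close> is
    integrated out: the Jacobian of the threshold substitution cancels one of the two powers of
    \<open>w \<bullet> e\<close> in the denominator.\<close>
  define m where "m w = indicator ?S w * (indicator {w. 0 < w \<bullet> e} w * inverse (w \<bullet> e))" for w :: 'a
  have m0: "m w \<ge> 0" for w unfolding m_def by (auto split: split_indicator)
  have mi: "integrable lborel m"
  proof (rule Bochner_Integration.integrable_bound)
    show "integrable lborel (indicator (cball 0 2) :: 'a \<Rightarrow> real)"
      using emeasure_lborel_cball_finite[of "0::'a" 2] by simp
    show "AE w in lborel. norm (m w) \<le> norm (indicator (cball (0::'a) 2) w :: real)"
      by (rule AE_I2) (auto simp: m_def nrm indicator_def inverse_le_1_iff)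
  qed (unfold m_def, measurable)
  have mpos: "integral\<^sup>L lborel m > 0"
  proof -
    \<comment> \<open>This ball is the part of the shell with \<open>1 < w \<bullet> e < 2\<close>,
      where the inverse exceeds 1/2.\<close>
    have B: "integrable lborel (\<lambda>w. indicator (ball ((3 / 2) *\<^sub>R e) (1 / 2)) w * (1 / 2) :: real)"
      using emeasure_lborel_ball_finite[of "(3 / 2) *\<^sub>R e" "1 / 2"]
      by (intro integrable_mult_left integrable_real_indicator) auto
    have "0 < measure lborel (ball ((3 / 2) *\<^sub>R e) (1 / 2)) * (1 / 2)"
      using content_ball_pos[of "1/2" "(3 / 2) *\<^sub>R e"] by simp
    also have "\<dots> = (\<integral>w. indicator (ball ((3 / 2) *\<^sub>R e) (1 / 2)) w * (1 / 2) \<partial>lborel)" by simp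
    also have "\<dots> \<le> integral\<^sup>L lborel m"
    proof (rule integral_mono[OF B mi])
      fix w :: 'a
      show "indicator (ball ((3 / 2) *\<^sub>R e) (1 / 2)) w * (1 / 2) \<le> m w"
      proof (cases "w \<in> ball ((3 / 2) *\<^sub>R e) (1 / 2)")
        case True
        then have "\<bar>3 / 2 - w \<bullet> e\<bar> < 1 / 2"
          using nrm[of "(3 / 2) *\<^sub>R e - w"] eB by (simp add: dist_norm inner_diff_left)
        then have "1 < w \<bullet> e" "w \<bullet> e < 2" by linarith+
        then show ?thesis using True by (simp add: m_def nrm field_simps)
      qed (simp add: m0)
    qed
    finally show ?thesis .
  qed
  define c where "c = ?K * integral\<^sup>L lborel m"
  have c: "c > 0" unfolding c_def using mpos shell_const_pos[where 'a='a] by simp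
  show ?thesis
  proof
    fix f :: "'a \<Rightarrow> real"
    assume bd: "\<And>x. norm x \<le> 1 \<Longrightarrow> \<bar>f x\<bar> \<le> 1"
      and lip: "\<And>x y. norm x \<le> 1 \<Longrightarrow> norm y \<le> 1 \<Longrightarrow> \<bar>f x - f y\<bar> \<le> norm (x - y)"
    obtain g where g: "\<And>x. norm x \<le> 1 \<Longrightarrow> g x = f x" "\<And>x. \<bar>g x\<bar> \<le> 1" "\<And>x y. \<bar>g x - g y\<bar> \<le> 2 * norm (x - y)"
      "\<And>x. norm x > 2 \<Longrightarrow> g x = 0" "g \<in> borel_measurable borel"
      using lipschitz_extension_compact_support[OF bd lip] by blast
    define \<psi> where "\<psi> t = g (t *\<^sub>R e)" for t
    have "\<bar>\<psi> s - \<psi> t\<bar> \<le> 2 * \<bar>s - t\<bar>" for s t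
      using g(3)[of "s *\<^sub>R e" "t *\<^sub>R e"] norm_Basis[OF eB] by (simp add: \<psi>_def scaleR_diff_left[symmetric])
    then obtain q where q: "q \<in> borel_measurable borel" "\<And>t. \<bar>q t\<bar> \<le> 2"
      "\<And>a b. a \<le> b \<Longrightarrow> has_bochner_integral lborel (\<lambda>t. indicator {a<..b} t * q t) (\<psi> b - \<psi> a)"
      by (rule lipschitz_bounded_density) blast
    note qm[measurable] = q(1)
    \<comment> \<open>The cone restricts the thresholds to modulus at most 3: the point -3 is
      outside the support of the extension, so integrating from there loses nothing, and on the
      sphere the cone keeps the denominator away from 0.\<close>
    define p where "p v = indicator {v. 0 < fst v \<bullet> e \<and> \<bar>snd v\<bar> \<le> 3 * (fst v \<bullet> e)} v * (q (- (snd v / (fst v \<bullet> e))) / (fst v \<bullet> e)\<^sup>2) / c" for v :: "'a \<times> real"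
    have pm[measurable]: "p \<in> borel_measurable borel" unfolding p_def by measurable
    have pms: "p \<in> borel_measurable sphere_unif"
      by (rule measurable_sphere_unif) measurable
    have pb: "\<bar>p u\<bar> \<le> 50 / c" if u: "norm u = 1" for u
    proof (cases "0 < fst u \<bullet> e \<and> \<bar>snd u\<bar> \<le> 3 * (fst u \<bullet> e)")
      case True
      have "norm (fst u, snd u) = 1" using u by simp
      \<comment> \<open>Inside the cone the slope is at most 3, which rules out the polar case with
        its slope of at least 4. With the bound 2 on \<open>q\<close>, the value 1/5 gives the
        constant 50.\<close>
      then have w: "1 / 5 \<le> fst u \<bullet> e"
        by (cases rule: unit_pair_cases) (use True in \<open>auto simp: nrm\<close>)
      have "(1 / 5)\<^sup>2 \<le> (fst u \<bullet> e)\<^sup>2" using w by (intro power_mono) auto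
      then have "\<bar>q (- (snd u / (fst u \<bullet> e)))\<bar> / (fst u \<bullet> e)\<^sup>2 \<le> 2 / (1 / 5)\<^sup>2"
        using q(2) by (intro frac_le) auto
      then have "\<bar>q (- (snd u / (fst u \<bullet> e)))\<bar> / (fst u \<bullet> e)\<^sup>2 / c \<le> 50 / c"
        using c by (intro divide_right_mono) (auto simp: power2_eq_square)
      then show ?thesis using True c by (simp add: p_def abs_mult)
    qed (use c in \<open>simp add: p_def\<close>)
    interpret S: prob_space "sphere_unif :: ('a \<times> real) measure" by (rule prob_space_sphere_unif)
    have p2b: "(p u)\<^sup>2 \<le> (50 / c)\<^sup>2" if "norm u = 1" for u
      using power_mono[OF pb[OF that], of 2] by simp
    have p2i: "integrable sphere_unif (\<lambda>u. (p u)\<^sup>2)"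
      using pms p2b by (intro S.integrable_const_bound[of _ "(50 / c)\<^sup>2"] AE_I2) (auto simp: space_sphere_unif)
    have p2: "(LINT u|sphere_unif. (p u)\<^sup>2) \<le> (50 / c)\<^sup>2"
      using integral_mono[OF p2i S.integrable_const[of "(50 / c)\<^sup>2"]] p2b by (simp add: space_sphere_unif S.prob_space[unfolded space_sphere_unif])
    have rp: "f x = (LINT u|sphere_unif. pos_power 0 (fst u \<bullet> x + snd u) * p u)" if x: "norm x \<le> 1" for x
    proof -
      define \<phi> where "\<phi> u = pos_power 0 (fst u \<bullet> x + snd u) * p u" for u
      have \<phi>m[measurable]: "\<phi> \<in> borel_measurable borel" unfolding \<phi>_def by measurable
      have \<phi>s: "\<phi> \<in> borel_measurable sphere_unif"
        by (rule measurable_sphere_unif) measurable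
      have \<phi>i: "integrable sphere_unif \<phi>"
      proof (rule S.integrable_const_bound[OF _ \<phi>s])
        show "AE u in sphere_unif. norm (\<phi> u) \<le> 50 / c"
          using pb c by (intro AE_I2) (auto simp: space_sphere_unif \<phi>_def pos_power_def)
      qed
      have hom: "inverse (norm v ^ DIM('a \<times> real)) * indicator shell v * \<phi> (sgn v) = indicator ?S (fst v) * \<phi> v" for v
      proof (cases "v \<in> shell")
        case True
        then have v0: "norm v > 0" by (auto simp: shell_def)
        have sgn: "sgn v = inverse (norm v) *\<^sub>R v" by (rule sgn_div_norm)
        have "pos_power 0 (fst (sgn v) \<bullet> x + snd (sgn v)) = pos_power 0 (inverse (norm v) * (fst v \<bullet> x + snd v))"
          unfolding sgn by (simp add: algebra_simps)
        then have 1: "pos_power 0 (fst (sgn v) \<bullet> x + snd (sgn v)) = pos_power 0 (fst v \<bullet> x + snd v)"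
          using pos_power_scale[of "inverse (norm v)" 0] v0 by simp
        have cond: "(0 < fst (sgn v) \<bullet> e \<and> \<bar>snd (sgn v)\<bar> \<le> 3 * (fst (sgn v) \<bullet> e)) \<longleftrightarrow> (0 < fst v \<bullet> e \<and> \<bar>snd v\<bar> \<le> 3 * (fst v \<bullet> e))"
          unfolding sgn using v0 by (simp add: abs_mult zero_less_mult_iff field_simps)
        have rat: "snd (sgn v) / (fst (sgn v) \<bullet> e) = snd v / (fst v \<bullet> e)"
          unfolding sgn using v0 by simp
        have sq: "(fst (sgn v) \<bullet> e)\<^sup>2 = (fst v \<bullet> e)\<^sup>2 / (norm v)\<^sup>2"
          unfolding sgn by (simp add: power_mult_distrib field_simps)
        have 2: "p (sgn v) = (norm v)\<^sup>2 * p v"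
          using cond unfolding p_def rat sq by (simp add: indicator_def)
        show ?thesis using True v0 unfolding \<phi>_def 1 2 DIM_prod dim by (simp add: shell_def power2_eq_square field_simps)
      qed (auto simp: shell_def)
      let ?G = "\<lambda>v. indicator ?S (fst v) * \<phi> v"
      have G: "integrable (lborel \<Otimes>\<^sub>M lborel) ?G"
        using \<phi>i unfolding integrable_sphere_unif_shell[OF \<phi>m] hom lborel_prod .
      have inner: "(\<integral>b. ?G (w, b) \<partial>lborel) = f x / c * m w" for w
      proof (cases "w \<in> ?S \<and> 0 < w \<bullet> e")
        case True
        let ?a = "w \<bullet> e" and ?x = "x \<bullet> e"
        have x1: "\<bar>?x\<bar> \<le> 1" using x nrm[of x] by simp
        have "(\<integral>b. ?G (w, b) \<partial>lborel) = \<bar>- ?a\<bar> *\<^sub>R (\<integral>t. ?G (w, 0 + (- ?a) * t) \<partial>lborel)"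
          by (rule lborel_integral_real_affine) (use True in auto)
        also have "(\<integral>t. ?G (w, 0 + (- ?a) * t) \<partial>lborel) = (\<integral>t. (1 / (c * ?a\<^sup>2)) * (indicator {- 3<..?x} t * q t) \<partial>lborel)"
        proof (rule integral_cong_AE)
          \<comment> \<open>At the endpoints the half-open interval disagrees with the conditions
            \<open>t < ?x\<close> and \<open>\<bar>t\<bar> \<le> 3\<close>:
            \<open>pos_power 0\<close> vanishes at 0, and the cone is closed.\<close>
          have "AE t in lborel. t \<noteq> - 3 \<and> t \<noteq> ?x"
            by (intro AE_conjI AE_lborel_singleton)
          then show "AE t in lborel. ?G (w, 0 + (- ?a) * t) = (1 / (c * ?a\<^sup>2)) * (indicator {- 3<..?x} t * q t)"
          proof eventually_elim
            case (elim t)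
            have "w \<bullet> x + - ?a * t = ?a * (?x - t)" by (simp add: inn[of w x] algebra_simps)
            then have 1: "pos_power 0 (w \<bullet> x + - ?a * t) = (if t < ?x then 1 else 0)"
              using True by (auto simp: pos_power_def zero_less_mult_iff)
            have 2: "\<bar>- ?a * t\<bar> \<le> 3 * ?a \<longleftrightarrow> \<bar>t\<bar> \<le> 3"
              using True by (simp add: abs_mult)
            have 3: "- ((- ?a * t) / ?a) = t" using True by simp
            have mem: "(w, - ?a * t) \<in> {v. 0 < fst v \<bullet> e \<and> \<bar>snd v\<bar> \<le> 3 * (fst v \<bullet> e)} \<longleftrightarrow> \<bar>t\<bar> \<le> 3"
              using True 2 by (simp only: mem_Collect_eq fst_conv snd_conv) blast
            have 4: "p (w, - ?a * t) = (if \<bar>t\<bar> \<le> 3 then q t / ?a\<^sup>2 / c else 0)"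
              unfolding p_def fst_conv snd_conv 3 indicator_def mem by simp
            have S: "indicator ?S w = (1 :: real)" using True by simp
            show ?case
              using elim x1 unfolding \<phi>_def fst_conv snd_conv add_0 1 4 S
              by (auto simp: indicator_def abs_le_iff)
          qed
        qed (use \<phi>m in \<open>simp_all add: borel_prod[symmetric]\<close>)
        also have "\<dots> = (1 / (c * ?a\<^sup>2)) * (\<psi> ?x - \<psi> (- 3))"
          unfolding integral_mult_right_zero using q(3)[of "- 3" ?x] x1 by (simp add: has_bochner_integral_iff)
        also have "\<psi> (- 3) = 0" unfolding \<psi>_def using g(4)[of "(- 3) *\<^sub>R e"] norm_Basis[OF eB] by simp
        also have "\<psi> ?x = f x" unfolding \<psi>_def using rep[of x] g(1)[OF x] by simp
        finally show ?thesis using True c by (simp add: m_def power2_eq_square field_simps)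
      next
        case False
        then have "?G (w, b) = 0" for b by (auto simp: \<phi>_def p_def)
        then have "(\<integral>b. ?G (w, b) \<partial>lborel) = 0" by (simp only: Bochner_Integration.integral_zero)
        moreover have "m w = 0" using False by (auto simp: m_def)
        ultimately show ?thesis by (simp only: mult_zero_right)
      qed
      have "(LINT u|sphere_unif. \<phi> u) = ?K * (\<integral>v. ?G v \<partial>(lborel \<Otimes>\<^sub>M lborel))"
        unfolding integral_sphere_unif_shell[OF \<phi>m] hom lborel_prod ..
      also have "(\<integral>v. ?G v \<partial>(lborel \<Otimes>\<^sub>M lborel)) = (\<integral>w. \<integral>b. ?G (w, b) \<partial>lborel \<partial>lborel)"
        by (rule lborel_pair.integral_fst'[OF G, symmetric])
      also have "\<dots> = f x / c * integral\<^sup>L lborel m"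
        unfolding inner integral_mult_right_zero ..
      also have "?K * (f x / c * integral\<^sup>L lborel m) = f x"
        using mpos shell_const_pos[where 'a='a] unfolding c_def by (simp add: field_simps)
      finally show ?thesis unfolding \<phi>_def by simp
    qed
    show "\<exists>p. p \<in> borel_measurable sphere_unif \<and> integrable sphere_unif (\<lambda>u. (p u)\<^sup>2) \<and>
       (LINT u|sphere_unif. (p u)\<^sup>2) \<le> (50 / c)\<^sup>2 \<and>
       (\<forall>x. norm x \<le> 1 \<longrightarrow> f x = (LINT u|sphere_unif. pos_power 0 (fst u \<bullet> x + snd u) * p u))"
      using pms p2i p2 rp by blast
  qed
qed

section \<open>Rescaling to radius \<open>R\<close> and height \<eta>, and the choice of
  \<epsilon>\<close>

lemma F2_approximation_rescale:
  fixes f :: "real ^ 'd \<Rightarrow> real"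
  assumes R: "R > 0" and \<eta>: "\<eta> > 0" and B: "B \<ge> 0"
    and pm: "p \<in> borel_measurable sphere_unif" and pi: "integrable sphere_unif (\<lambda>u. (p u)\<^sup>2)"
    and pB: "(LINT u|sphere_unif. (p u)\<^sup>2) \<le> B\<^sup>2"
    and err: "\<And>y. norm y \<le> 1 \<Longrightarrow> \<bar>f (R *\<^sub>R y) / \<eta> - (LINT u|sphere_unif. pos_power \<alpha> (fst u \<bullet> y + snd u) * p u)\<bar> \<le> e"
  shows "\<exists>g \<in> F2 R \<alpha>. gamma2 R \<alpha> g \<le> \<eta> * B \<and> (SUP x\<in>cball 0 R. \<bar>f x - g x\<bar>) \<le> \<eta> * e"
proof
  define p' where "p' u = \<eta> * p u" for u
  define g where "g x = (LINT u|sphere_unif. pos_power \<alpha> ((fst u /\<^sub>R R) \<bullet> x + snd u) * p' u)" for x :: "real ^ 'd"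
  have p'2: "(p' u)\<^sup>2 = \<eta>\<^sup>2 * (p u)\<^sup>2" for u by (simp add: p'_def power_mult_distrib)
  have rep: "F2_repr R \<alpha> g p'"
    unfolding F2_repr_def g_def p'2 using pm pi by (auto simp: p'_def[abs_def])
  then show "g \<in> F2 R \<alpha>" by (auto simp: F2_def)
  have "gamma2 R \<alpha> g \<le> sqrt (LINT u|sphere_unif. (p' u)\<^sup>2)"
    unfolding gamma2_def
  \<comment> \<open>Any single representing density bounds the infimum from above; over the reals
    this requires the set of values to be bounded below, here by 0.\<close>
  proof (intro real_sqrt_le_mono cINF_lower)
    show "bdd_below ((\<lambda>p. LINT u|sphere_unif. (p u)\<^sup>2) ` {p. F2_repr R \<alpha> g p})"
      by (rule bdd_belowI[of _ 0]) auto
  qed (simp add: rep)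
  also have "(LINT u|sphere_unif. (p' u)\<^sup>2) = \<eta>\<^sup>2 * (LINT u|sphere_unif. (p u)\<^sup>2)"
    unfolding p'2 by simp
  also have "sqrt \<dots> \<le> sqrt (\<eta>\<^sup>2 * B\<^sup>2)" using pB by (intro real_sqrt_le_mono mult_left_mono) auto
  also have "\<dots> = \<eta> * B" using \<eta> B by (simp add: real_sqrt_mult)
  finally have gam: "gamma2 R \<alpha> g \<le> \<eta> * B" .
  have "(SUP x\<in>cball 0 R. \<bar>f x - g x\<bar>) \<le> \<eta> * e"
  proof (rule cSUP_least)
    show "cball (0 :: real ^ 'd) R \<noteq> {}" using R by simp
    fix x :: "real ^ 'd" assume "x \<in> cball 0 R"
    then have x: "norm x \<le> R" by simp
    \<comment> \<open>The activation at \<open>x\<close> has the argument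
      \<open>fst u \<bullet> y + snd u\<close>, so both \<open>R\<close> and \<eta> are removed by
      evaluating the unit-ball representation at \<open>y\<close>.\<close>
    define y where "y = x /\<^sub>R R"
    have y: "norm y \<le> 1" "R *\<^sub>R y = x" using x R by (auto simp: y_def field_simps)
    have "g x = \<eta> * (LINT u|sphere_unif. pos_power \<alpha> (fst u \<bullet> y + snd u) * p u)"
    proof -
      have "g x = (LINT u|sphere_unif. \<eta> * (pos_power \<alpha> (fst u \<bullet> y + snd u) * p u))"
        unfolding g_def p'_def y_def by (simp add: mult_ac)
      then show ?thesis by simp
    qed
    then have "f x - g x = \<eta> * (f (R *\<^sub>R y) / \<eta> - (LINT u|sphere_unif. pos_power \<alpha> (fst u \<bullet> y + snd u) * p u))"
      using \<eta> y(2) by (simp add: right_diff_distrib)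
    then have "\<bar>f x - g x\<bar> = \<eta> * \<bar>f (R *\<^sub>R y) / \<eta> - (LINT u|sphere_unif. pos_power \<alpha> (fst u \<bullet> y + snd u) * p u)\<bar>"
      using \<eta> by (simp only: abs_mult abs_of_pos)
    also have "\<dots> \<le> \<eta> * e" using err[OF y(1)] \<eta> by (intro mult_left_mono) auto
    finally show "\<bar>f x - g x\<bar> \<le> \<eta> * e" .
  qed
  with gam show "gamma2 R \<alpha> g \<le> \<eta> * B \<and> (SUP x\<in>cball 0 R. \<bar>f x - g x\<bar>) \<le> \<eta> * e" ..
qed

theorem proposition6:
  fixes \<alpha> :: nat
  shows "\<exists>c C :: real. \<forall>(R :: real) (\<eta> :: real) (\<delta> :: real) (f :: real ^ 'd \<Rightarrow> real).
    R > 0 \<longrightarrow> \<eta> > 0 \<longrightarrow> \<delta> / \<eta> > c \<longrightarrow>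
    (\<forall>x y. norm x \<le> R \<longrightarrow> norm y \<le> R \<longrightarrow>
       \<bar>f x\<bar> \<le> \<eta> \<and> \<bar>f x - f y\<bar> \<le> \<eta> * inverse R * norm (x - y)) \<longrightarrow>
    (\<exists>g \<in> F2 R \<alpha>. gamma2 R \<alpha> g \<le> \<delta> \<and>
       (SUP x\<in>cball 0 R. \<bar>f x - g x\<bar>)
         \<le> C * \<eta> * inv_root_power (\<delta> / \<eta>) (real \<alpha> + (real CARD('d) - 1) / 2) * ln (\<delta> / \<eta>))"
proof -
  define s where "s = real \<alpha> + (real CARD('d) - 1) / 2"
  have d1: "real CARD('d) \<ge> 1" by (simp add: Suc_leI)
  have s0: "s \<ge> 0" unfolding s_def using d1 by simp
  have dim: "DIM(real ^ 'd) = CARD('d)" by simp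
  have norm_bd: "\<bar>f (R *\<^sub>R y) / \<eta>\<bar> \<le> 1"
    if R: "R > 0" and \<eta>: "\<eta> > 0" and H: "\<forall>x y. norm x \<le> R \<longrightarrow> norm y \<le> R \<longrightarrow>
       \<bar>f x\<bar> \<le> \<eta> \<and> \<bar>f x - f y\<bar> \<le> \<eta> * inverse R * norm (x - y)"
      and y: "norm y \<le> 1" for f :: "real ^ 'd \<Rightarrow> real" and R \<eta> y
  proof -
    have "norm (R *\<^sub>R y) \<le> R" using R y by (simp add: mult_left_le)
    then have "\<bar>f (R *\<^sub>R y)\<bar> \<le> \<eta>" using H by blast
    then show ?thesis using \<eta> by simp
  qed
  have norm_lip: "\<bar>f (R *\<^sub>R y) / \<eta> - f (R *\<^sub>R z) / \<eta>\<bar> \<le> norm (y - z)"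
    if R: "R > 0" and \<eta>: "\<eta> > 0" and H: "\<forall>x y. norm x \<le> R \<longrightarrow> norm y \<le> R \<longrightarrow>
       \<bar>f x\<bar> \<le> \<eta> \<and> \<bar>f x - f y\<bar> \<le> \<eta> * inverse R * norm (x - y)"
      and y: "norm y \<le> 1" and z: "norm z \<le> 1" for f :: "real ^ 'd \<Rightarrow> real" and R \<eta> y z
  proof -
    have "norm (R *\<^sub>R y) \<le> R" "norm (R *\<^sub>R z) \<le> R" using R y z by (simp_all add: mult_left_le)
    then have h: "\<bar>f (R *\<^sub>R y) - f (R *\<^sub>R z)\<bar> \<le> \<eta> * inverse R * norm (R *\<^sub>R y - R *\<^sub>R z)"
      using H by blast
    have "norm (R *\<^sub>R y - R *\<^sub>R z) = R * norm (y - z)"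
      using R by (simp add: scaleR_diff_right[symmetric])
    then have "\<bar>f (R *\<^sub>R y) - f (R *\<^sub>R z)\<bar> \<le> \<eta> * norm (y - z)" using h R by (simp add: field_simps)
    then show ?thesis
      using \<eta> by (simp add: diff_divide_distrib[symmetric] divide_le_eq mult.commute)
  qed
  show ?thesis
  proof (cases "s = 0")
    \<comment> \<open>This forces \<open>\<alpha> = 0\<close> and dimension 1, where
      \<open>inv_root_power\<close> is 0 and the approximation has to be exact.\<close>
    case True
    have "0 \<le> (real CARD('d) - 1) / 2" using d1 by simp
    then have "real \<alpha> = 0"
      using True unfolding s_def by (metis add_nonneg_eq_0_iff of_nat_0_le_iff)
    moreover from this have "real CARD('d) = 1"
      using True unfolding s_def by simp
    ultimately have "\<alpha> = 0" and "DIM(real ^ 'd) = 1" unfolding dim by simp_all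
    obtain C where C: "\<And>f :: real ^ 'd \<Rightarrow> real. \<lbrakk>\<And>x. norm x \<le> 1 \<Longrightarrow> \<bar>f x\<bar> \<le> 1;
        \<And>x y. norm x \<le> 1 \<Longrightarrow> norm y \<le> 1 \<Longrightarrow> \<bar>f x - f y\<bar> \<le> norm (x - y)\<rbrakk>
      \<Longrightarrow> \<exists>p. p \<in> borel_measurable sphere_unif \<and> integrable sphere_unif (\<lambda>u. (p u)\<^sup>2) \<and>
         (LINT u|sphere_unif. (p u)\<^sup>2) \<le> C \<and>
         (\<forall>x. norm x \<le> 1 \<longrightarrow> f x = (LINT u|sphere_unif. pos_power 0 (fst u \<bullet> x + snd u) * p u))"
      by (rule critical_case_representation[OF \<open>DIM(real ^ 'd) = 1\<close>]) blast
    show ?thesis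
    \<comment> \<open>The witnesses are \<open>sqrt \<bar>C\<bar>\<close> for the threshold and 0
      for the constant of the error. The absolute value spares a proof that \<open>C\<close> is
      nonnegative.\<close>
    proof (intro exI allI impI)
      fix R \<eta> \<delta> :: real and f :: "real ^ 'd \<Rightarrow> real"
      assume R: "R > 0" and \<eta>: "\<eta> > 0" and \<delta>: "\<delta> / \<eta> > sqrt \<bar>C\<bar>"
        and H: "\<forall>x y. norm x \<le> R \<longrightarrow> norm y \<le> R \<longrightarrow> \<bar>f x\<bar> \<le> \<eta> \<and> \<bar>f x - f y\<bar> \<le> \<eta> * inverse R * norm (x - y)"
      have "\<exists>p. p \<in> borel_measurable sphere_unif \<and> integrable sphere_unif (\<lambda>u. (p u)\<^sup>2) \<and>
         (LINT u|sphere_unif. (p u)\<^sup>2) \<le> C \<and>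
         (\<forall>x. norm x \<le> 1 \<longrightarrow> f (R *\<^sub>R x) / \<eta> = (LINT u|sphere_unif. pos_power 0 (fst u \<bullet> x + snd u) * p u))"
        by (intro C norm_bd[OF R \<eta> H] norm_lip[OF R \<eta> H])
      then obtain p where p: "p \<in> borel_measurable sphere_unif" "integrable sphere_unif (\<lambda>u. (p u)\<^sup>2)"
        "(LINT u|sphere_unif. (p u)\<^sup>2) \<le> C"
        "\<And>x. norm x \<le> 1 \<Longrightarrow> f (R *\<^sub>R x) / \<eta> = (LINT u|sphere_unif. pos_power 0 (fst u \<bullet> x + snd u) * p u)"
        by blast
      have pB: "(LINT u|sphere_unif. (p u)\<^sup>2) \<le> (sqrt \<bar>C\<bar>)\<^sup>2" using p(3) by simp
      have err: "\<bar>f (R *\<^sub>R y) / \<eta> - (LINT u|sphere_unif. pos_power \<alpha> (fst u \<bullet> y + snd u) * p u)\<bar> \<le> 0" if "norm y \<le> 1" for y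
        using p(4)[OF that] \<open>\<alpha> = 0\<close> by simp
      have "\<exists>g\<in>F2 R \<alpha>. gamma2 R \<alpha> g \<le> \<eta> * sqrt \<bar>C\<bar> \<and> (SUP x\<in>cball 0 R. \<bar>f x - g x\<bar>) \<le> \<eta> * 0"
        by (rule F2_approximation_rescale[OF R \<eta> _ p(1,2) pB err]) auto
      then obtain g where g: "g \<in> F2 R \<alpha>" "gamma2 R \<alpha> g \<le> \<eta> * sqrt \<bar>C\<bar>" "(SUP x\<in>cball 0 R. \<bar>f x - g x\<bar>) \<le> 0"
        by auto
      have "\<eta> * sqrt \<bar>C\<bar> \<le> \<delta>" using \<delta> \<eta> by (simp add: less_divide_eq mult.commute)
      with g show "\<exists>g \<in> F2 R \<alpha>. gamma2 R \<alpha> g \<le> \<delta> \<and>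
       (SUP x\<in>cball 0 R. \<bar>f x - g x\<bar>) \<le> 0 * \<eta> * inv_root_power (\<delta> / \<eta>) (real \<alpha> + (real CARD('d) - 1) / 2) * ln (\<delta> / \<eta>)"
        by (intro bexI[of _ g]) auto
    qed
  next
    case False
    then have s: "s > 0" using s0 by simp
    let ?M = "DIM(real ^ 'd) + 2 * \<alpha> + 1"
    obtain C0 where C0: "C0 > 0" "\<And>(f :: real ^ 'd \<Rightarrow> real) \<epsilon>. \<lbrakk>\<And>x. norm x \<le> 1 \<Longrightarrow> \<bar>f x\<bar> \<le> 1;
        \<And>x y. norm x \<le> 1 \<Longrightarrow> norm y \<le> 1 \<Longrightarrow> \<bar>f x - f y\<bar> \<le> norm (x - y); 0 < \<epsilon>; \<epsilon> \<le> exp (- 1)\<rbrakk>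
      \<Longrightarrow> \<exists>p. p \<in> borel_measurable sphere_unif \<and> integrable sphere_unif (\<lambda>u. (p u)\<^sup>2) \<and>
         (LINT u|sphere_unif. (p u)\<^sup>2) \<le> C0 * (\<epsilon>\<^sup>2 / \<epsilon> ^ ?M) \<and>
         (\<forall>x. norm x \<le> 1 \<longrightarrow> \<bar>f x - (LINT u|sphere_unif. pos_power \<alpha> (fst u \<bullet> x + snd u) * p u)\<bar> \<le> C0 * (\<epsilon> * ln (1 / \<epsilon>)))"
      by (rule unit_ball_approximation[where 'a="real ^ 'd" and \<alpha>=\<alpha>]) blast
    define A where "A = max 1 (sqrt C0)"
    have A: "A \<ge> 1" "C0 \<le> A\<^sup>2" using C0(1) real_sqrt_pow2[of C0] power_mono[of "sqrt C0" A 2] by (auto simp: A_def)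
    define C where "C = C0 * A powr (1 / s) / s"
    show ?thesis
    \<comment> \<open>The threshold \<open>A * exp s\<close> is what makes \<epsilon> at most
      \<open>exp (- 1)\<close>, the range in which the unit-ball approximation holds.\<close>
    proof (intro exI allI impI)
      fix R \<eta> \<delta> :: real and f :: "real ^ 'd \<Rightarrow> real"
      assume R: "R > 0" and \<eta>: "\<eta> > 0" and \<delta>: "\<delta> / \<eta> > A * exp s"
        and H: "\<forall>x y. norm x \<le> R \<longrightarrow> norm y \<le> R \<longrightarrow> \<bar>f x\<bar> \<le> \<eta> \<and> \<bar>f x - f y\<bar> \<le> \<eta> * inverse R * norm (x - y)"
      define D where "D = \<delta> / \<eta>"
      have DA: "D > A * exp s" using \<delta> by (simp add: D_def)
      have "1 * 1 \<le> A * exp s" using A s by (intro mult_mono) auto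
      then have D: "D > 1" using DA by simp
      \<comment> \<open>The solution of \<open>\<epsilon> powr s = A / D\<close>, at which the bound
        \<open>C0 * \<epsilon> powr (- 2 * s)\<close> for the squared norm equals
        \<open>C0 / A\<^sup>2 * D\<^sup>2\<close>, hence is at most
        \<open>D\<^sup>2\<close>.\<close>
      define \<epsilon> where "\<epsilon> = (A / D) powr (1 / s)"
      have AD: "A / D > 0" using A D by simp
      have \<epsilon>0: "\<epsilon> > 0" unfolding \<epsilon>_def using A D by simp
      have \<epsilon>s: "\<epsilon> powr s = A / D" unfolding \<epsilon>_def using A D s by (simp add: powr_powr)
      have "A / D \<le> exp (- s)" using DA D by (simp add: exp_minus field_simps)
      then have "\<epsilon> \<le> exp (- s) powr (1 / s)" unfolding \<epsilon>_def using AD s by (intro powr_mono2) auto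
      also have "\<dots> = exp (- 1)" using s by (simp add: powr_def)
      finally have \<epsilon>1: "\<epsilon> \<le> exp (- 1)" .
      have "\<exists>p. p \<in> borel_measurable sphere_unif \<and> integrable sphere_unif (\<lambda>u. (p u)\<^sup>2) \<and>
         (LINT u|sphere_unif. (p u)\<^sup>2) \<le> C0 * (\<epsilon>\<^sup>2 / \<epsilon> ^ ?M) \<and>
         (\<forall>x. norm x \<le> 1 \<longrightarrow> \<bar>f (R *\<^sub>R x) / \<eta> - (LINT u|sphere_unif. pos_power \<alpha> (fst u \<bullet> x + snd u) * p u)\<bar> \<le> C0 * (\<epsilon> * ln (1 / \<epsilon>)))"
        by (intro C0(2) norm_bd[OF R \<eta> H] norm_lip[OF R \<eta> H] \<epsilon>0 \<epsilon>1)
      then obtain p where p: "p \<in> borel_measurable sphere_unif" "integrable sphere_unif (\<lambda>u. (p u)\<^sup>2)"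
        "(LINT u|sphere_unif. (p u)\<^sup>2) \<le> C0 * (\<epsilon>\<^sup>2 / \<epsilon> ^ ?M)"
        "\<And>x. norm x \<le> 1 \<Longrightarrow> \<bar>f (R *\<^sub>R x) / \<eta> - (LINT u|sphere_unif. pos_power \<alpha> (fst u \<bullet> x + snd u) * p u)\<bar> \<le> C0 * (\<epsilon> * ln (1 / \<epsilon>))"
        by blast
      have "\<epsilon>\<^sup>2 / \<epsilon> ^ ?M = \<epsilon> powr (2 - real ?M)"
        unfolding powr_diff powr_realpow[OF \<epsilon>0] using powr_realpow[OF \<epsilon>0, of 2] by simp
      also have "2 - real ?M = - s + - s" unfolding s_def by (simp add: field_simps)
      also have "\<epsilon> powr (- s + - s) = (D / A)\<^sup>2"
        unfolding powr_add powr_minus \<epsilon>s by (simp add: power2_eq_square)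
      finally have "C0 * (\<epsilon>\<^sup>2 / \<epsilon> ^ ?M) = C0 / A\<^sup>2 * D\<^sup>2" by (simp add: power_divide)
      also have "\<dots> \<le> 1 * D\<^sup>2" using A by (intro mult_right_mono) (auto simp: divide_le_eq_1)
      finally have pB: "(LINT u|sphere_unif. (p u)\<^sup>2) \<le> D\<^sup>2" using p(3) by simp
      have "\<exists>g\<in>F2 R \<alpha>. gamma2 R \<alpha> g \<le> \<eta> * D \<and> (SUP x\<in>cball 0 R. \<bar>f x - g x\<bar>) \<le> \<eta> * (C0 * (\<epsilon> * ln (1 / \<epsilon>)))"
        by (rule F2_approximation_rescale[OF R \<eta> _ p(1,2) pB p(4)]) (use D in auto)
      then obtain g where g: "g \<in> F2 R \<alpha>" "gamma2 R \<alpha> g \<le> \<eta> * D" "(SUP x\<in>cball 0 R. \<bar>f x - g x\<bar>) \<le> \<eta> * (C0 * (\<epsilon> * ln (1 / \<epsilon>)))"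
        by blast
      have D\<delta>: "\<eta> * D = \<delta>" using \<eta> by (simp add: D_def)
      have bound: "\<eta> * (C0 * (\<epsilon> * ln (1 / \<epsilon>))) \<le> C * \<eta> * inv_root_power (\<delta> / \<eta>) (real \<alpha> + (real CARD('d) - 1) / 2) * ln (\<delta> / \<eta>)"
      proof -
        have "ln (1 / \<epsilon>) = (ln D - ln A) / s"
          unfolding \<epsilon>_def using AD A D by (simp add: ln_div ln_powr minus_divide_left)
        \<comment> \<open>Dropping \<open>ln A\<close> leaves the logarithm of
          \<open>\<delta> / \<eta>\<close>; the factor \<open>1 / s\<close> and the power of
          \<open>A\<close> from \<epsilon> are collected in \<open>C\<close>.\<close>
        also have "\<dots> \<le> ln D / s" using A s by (intro divide_right_mono) auto
        finally have l: "ln (1 / \<epsilon>) \<le> ln D / s" .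
        have "\<epsilon> = A powr (1 / s) / D powr (1 / s)"
          unfolding \<epsilon>_def by (rule powr_divide)
        also have "\<dots> = A powr (1 / s) * D powr (- (1 / s))"
          unfolding powr_minus divide_inverse ..
        also have "- (1 / s) = - 1 / s" by (rule minus_divide_left)
        finally have e: "\<epsilon> = A powr (1 / s) * D powr (- 1 / s)" .
        have "inv_root_power D s = D powr (- 1 / s)"
          using s by (simp only: inv_root_power_def less_imp_neq[symmetric] if_False)
        then have "\<eta> * (C0 * (\<epsilon> * (ln D / s))) = C * \<eta> * inv_root_power D s * ln D"
          unfolding C_def e by (simp only: times_divide_eq_right times_divide_eq_left mult_ac)
        moreover have "\<eta> * (C0 * (\<epsilon> * ln (1 / \<epsilon>))) \<le> \<eta> * (C0 * (\<epsilon> * (ln D / s)))"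
          using l \<eta> C0(1) \<epsilon>0 by (intro mult_left_mono) auto
        ultimately show ?thesis unfolding s_def D_def by simp
      qed
      show "\<exists>g \<in> F2 R \<alpha>. gamma2 R \<alpha> g \<le> \<delta> \<and>
       (SUP x\<in>cball 0 R. \<bar>f x - g x\<bar>) \<le> C * \<eta> * inv_root_power (\<delta> / \<eta>) (real \<alpha> + (real CARD('d) - 1) / 2) * ln (\<delta> / \<eta>)"
        using g(1,2) order_trans[OF g(3) bound] unfolding D\<delta> by blast
    qed
  qed
qed

end
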